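(* Let $N\ge 1$ be an integer, and for $p\in[1+\frac4N,3+\frac4N]$ and $c>0$ let $\mathcal{E}$, $\sigma(c)$ and $\overline{m}(c)=\inf_{u\in\sigma(c)}\mathcal{E}(u)$ be as defined in the context. Put $c(p,N)=\inf\{c>0:\overline{m}(c)<0\}$. (i) If $p\in[1+\frac4N,3+\frac4N)$, then: a) $c(p,N)\in(0,\infty)$; b) $\overline{m}(c)=0$ for every $c\in(0,c(p,N)]$; c) $\overline{m}(c)<0$ for every $c\in(c(p,N),\infty)$, and $c\mapsto\overline{m}(c)$ is strictly decreasing on $(c(p,N),\infty)$. (ii) If $p\in[1+\frac4N,3+\frac4N)$, the mapping $c\mapsto\overline{m}(c)$ is continuous at each $c>0$. (iii) If $p=3+\frac4N$, put $c_N=\inf\{c>0:\exists\,u\in\sigma(c)\text{ such that }\mathcal{E}(u)\le0\}$. Then $c_N\in(0,\infty)$, $\overline{m}(c)=0$ for every $c\in(0,c_N)$, and $\overline{m}(c)=-\infty$ for every $c\in(c_N,\infty)$.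
   Context: For $c>0$, $$\sigma(c)=\Big\{u\in H^1(\mathbb{R}^N):\int_{\mathbb{R}^N}|u|^2|\nabla u|^2dx<\infty,\ \|u\|_{L^2(\mathbb{R}^N)}^2=c\Big\},$$ $$\mathcal{E}(u)=\frac12\int_{\mathbb{R}^N}|\nabla u|^2dx+\int_{\mathbb{R}^N}|u|^2|\nabla u|^2dx-\frac1{p+1}\int_{\mathbb{R}^N}|u|^{p+1}dx,$$ and $\overline{m}(c)=\inf_{u\in\sigma(c)}\mathcal{E}(u)\in[-\infty,\infty)$. *)

theory Defs
  imports "HOL-Analysis.Analysis"
begin

definition partial_derivative :: "'n \<Rightarrow> (real ^ 'n \<Rightarrow> real) \<Rightarrow> real ^ 'n::finite \<Rightarrow> real" where
  "partial_derivative i f x = frechet_derivative f (at x) (axis i 1)"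

primrec C_k :: "nat \<Rightarrow> (real ^ 'n::finite \<Rightarrow> real) \<Rightarrow> bool" where
  "C_k 0 f \<longleftrightarrow> continuous_on UNIV f"
| "C_k (Suc k) f \<longleftrightarrow> f differentiable_on UNIV \<and> (\<forall>i. C_k k (partial_derivative i f))"

definition test_function :: "(real ^ 'n::finite \<Rightarrow> real) \<Rightarrow> bool" where
  "test_function \<phi> \<longleftrightarrow> (\<forall>k. C_k k \<phi>) \<and> compact (closure {x. \<phi> x \<noteq> 0})"

definition locally_integrable ::
    "(real ^ 'n::finite \<Rightarrow> 'b::{banach, second_countable_topology}) \<Rightarrow> bool" where
  "locally_integrable f \<longleftrightarrow> (\<forall>K. compact K \<longrightarrow> set_integrable lborel K f)"

text \<open>Functions are Borel representatives of their classes modulo null sets. Local integrability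
  makes all integrals below genuine, so a weak gradient is unique up to a null set.\<close>

definition has_weak_gradient ::
    "(real ^ 'n::finite \<Rightarrow> real) \<Rightarrow> (real ^ 'n \<Rightarrow> real ^ 'n) \<Rightarrow> bool" where
  "has_weak_gradient u g \<longleftrightarrow> locally_integrable u \<and> locally_integrable g \<and>
     (\<forall>\<phi> i. test_function \<phi> \<longrightarrow>
        (LINT x|lborel. u x * partial_derivative i \<phi> x) = - (LINT x|lborel. g x $ i * \<phi> x))"

definition weak_gradient :: "(real ^ 'n::finite \<Rightarrow> real) \<Rightarrow> real ^ 'n \<Rightarrow> real ^ 'n" where
  "weak_gradient u = (SOME g. has_weak_gradient u g)"

definition L2 :: "(real ^ 'n::finite \<Rightarrow> 'b::{banach, second_countable_topology}) set" where
  "L2 = {f \<in> borel_measurable lborel. integrable lborel (\<lambda>x. norm (f x) ^ 2)}"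

definition H1 :: "(real ^ 'n::finite \<Rightarrow> real) set" where
  "H1 = {u \<in> L2. (\<exists>g. has_weak_gradient u g) \<and> weak_gradient u \<in> L2}"

definition mass_sphere :: "real \<Rightarrow> (real ^ 'n::finite \<Rightarrow> real) set" (\<open>\<sigma>\<close>) where
  "\<sigma> c = {u \<in> H1. integrable lborel (\<lambda>x. \<bar>u x\<bar> ^ 2 * norm (weak_gradient u x) ^ 2) \<and>
                  (LINT x|lborel. \<bar>u x\<bar> ^ 2) = c}"

text \<open>On \<open>\<sigma> c\<close> the first two integrals are finite by definition; the last one is finite for
  \<open>1 + 4/N \<le> p \<le> 3 + 4/N\<close>, since \<open>p + 1\<close> is then below the Sobolev exponent \<open>2 \<cdot> 2N/(N-2)\<close>
  available from \<open>\<nabla>(u\<^sup>2) \<in> L\<^sup>2\<close> (for \<open>N \<le> 2\<close> there is no upper restriction).\<close>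

definition energy :: "real \<Rightarrow> (real ^ 'n::finite \<Rightarrow> real) \<Rightarrow> real" where
  "energy p u =
     1 / 2 * (LINT x|lborel. norm (weak_gradient u x) ^ 2)
     + (LINT x|lborel. \<bar>u x\<bar> ^ 2 * norm (weak_gradient u x) ^ 2)
     - 1 / (p + 1) * (LINT x|lborel. \<bar>u x\<bar> powr (p + 1))"

text \<open>The type argument carries the space dimension \<open>CARD('n)\<close>. Infima are taken in the extended
  reals, so that an unbounded set has infimum \<open>-\<infinity>\<close> and an empty one \<open>\<infinity>\<close>.\<close>

definition m_bar :: "'n::finite itself \<Rightarrow> real \<Rightarrow> real \<Rightarrow> ereal" where
  "m_bar _ p c = (INF u \<in> (\<sigma> c :: (real ^ 'n \<Rightarrow> real) set). ereal (energy p u))"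

definition critical_mass :: "'n::finite itself \<Rightarrow> real \<Rightarrow> ereal" where
  "critical_mass N p = (INF c \<in> {c. c > 0 \<and> m_bar N p c < 0}. ereal c)"

text \<open>The threshold \<open>c\<^sub>N\<close> is the case \<open>p = 3 + 4 / CARD('n)\<close>.\<close>

definition nonpos_energy_mass :: "'n::finite itself \<Rightarrow> real \<Rightarrow> ereal" where
  "nonpos_energy_mass _ p =
     (INF c \<in> {c. c > 0 \<and> (\<exists>u \<in> (\<sigma> c :: (real ^ 'n \<Rightarrow> real) set). energy p u \<le> 0)}. ereal c)"

end

(*
Let N be the dimension and, on the mass sphere of mass 1, write A(u) for the kinetic part
1/2 int |grad u|^2 + int u^2 |grad u|^2 of the energy and B(u) for the potential part
1/(p+1) int |u|^(p+1). The dilation u(s^(-1/N) x) maps mass 1 to mass s and gives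
m(c) = c g(c^(-2/N)) with g(t) = inf (t A(u) - B(u)). As an infimum of affine functions g is
concave, hence continuous, and it is nondecreasing because A > 0; this yields (ii) and the
monotonicity in (i). The mass preserving dilation t^(N/2) u(t x) shows m <= 0 as t -> 0, and
m = -infinity for p = 3 + 4/N as t -> infinity as soon as some energy is negative.

The analytic input is the pair of Gagliardo-Nirenberg inequalities
int |u|^(2+4/N) <= K c^(2/N) int |grad u|^2 and int |u|^(4+4/N) <= K c^(2/N) int u^2 |grad u|^2,
between whose exponents p + 1 lies. Both follow from one statement about a function v >= 0
whose translates satisfy int |v(x+h) - v(x)|^2 <= |h|^2 D, applied to v = |u| and v = u^2. It is
proved by cutting v into dyadic layers, without Sobolev embedding or mollification. The
translation estimates come from testing the weak gradient against increments of test functions.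
*)
theory Submission
  imports Defs "HOL-Computational_Algebra.Polynomial"
begin

section \<open>Test functions\<close>

text \<open>Translates are used because an L^2 bound on v(x+h) - v(x) survives 1-Lipschitz cuts of
  v: neither |u| nor a dyadic layer needs a weak gradient of its own, and for u^2 the chain rule is
  needed only along segments. The two inequalities match because int v^r is the mass c both for v =
  |u|, r = 2 and for v = u^2, r = 1. They carry the same factor c^(2/N), so one constant bounds the
  potential part by c^(2/N) times the whole kinetic part. This makes the thresholds positive.
  Finiteness of g needs more: B <= eps A + C on mass 1 for every eps > 0, by interpolating p + 1
  between 2 and 4 + 4/N. This uses p < 3 + 4/N strictly, so the endpoint is treated on single
  functions, without g. There the potential part and int u^2 |grad u|^2 scale by the same power
  t^(N+2), against t^2 for int |grad u|^2. A function of smaller mass with energy <= 0 is first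
  dilated to larger mass, which makes its energy strictly negative.\<close>

lemma partial_derivative_eq:
  assumes "(f has_derivative f') (at x)"
  shows "partial_derivative i f x = f' (axis i 1)"
  unfolding partial_derivative_def using frechet_derivative_at[OF assms] by simp

lemma C_k_continuous: "C_k k f \<Longrightarrow> continuous_on UNIV f"
  by (cases k) (auto simp: differentiable_imp_continuous_on)

text \<open>Needed for the product rule, where an undifferentiated factor of order
  \<open>Suc k\<close> stands next to a derivative of order \<open>k\<close>.\<close>

lemma C_k_Suc: "C_k (Suc k) f \<Longrightarrow> C_k k f"
proof (induction k arbitrary: f)
  case 0
  then show ?case using C_k_continuous by (metis C_k.simps(1))
next
  case (Suc k)
  then show ?case by (metis C_k.simps(2))
qed

lemma C_k_const: "C_k k (\<lambda>x. c)"
proof (induction k arbitrary: c)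
  case (Suc k)
  have "partial_derivative i (\<lambda>x. c) = (\<lambda>x. 0)" for i :: 'a
    by (rule ext, subst partial_derivative_eq[OF has_derivative_const]) simp
  then show ?case using Suc by (simp add: differentiable_on_def)
qed simp

lemma C_k_add:
  assumes "C_k k f" "C_k k g"
  shows "C_k k (\<lambda>x. f x + g x)"
  using assms
proof (induction k arbitrary: f g)
  case 0
  then show ?case by (simp add: continuous_on_add)
next
  case (Suc k)
  have "partial_derivative i (\<lambda>x. f x + g x) = (\<lambda>x. partial_derivative i f x + partial_derivative i g x)" for i
  proof
    fix x
    have "(f has_derivative frechet_derivative f (at x)) (at x)"
      "(g has_derivative frechet_derivative g (at x)) (at x)"
      using Suc.prems by (auto simp: differentiable_on_def frechet_derivative_works)
    from has_derivative_add[OF this]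
    show "partial_derivative i (\<lambda>x. f x + g x) x = partial_derivative i f x + partial_derivative i g x"
      by (subst partial_derivative_eq) (auto simp: partial_derivative_def)
  qed
  then show ?case using Suc by (auto simp: differentiable_on_def)
qed

lemma partial_derivative_mult:
  assumes "f differentiable_on UNIV" "g differentiable_on UNIV"
  shows "partial_derivative i (\<lambda>x. f x * g x) x =
    f x * partial_derivative i g x + partial_derivative i f x * g x"
proof -
  have "(f has_derivative frechet_derivative f (at x)) (at x)"
    "(g has_derivative frechet_derivative g (at x)) (at x)"
    using assms by (auto simp: differentiable_on_def frechet_derivative_works)
  from has_derivative_mult[OF this] show ?thesis
    by (subst partial_derivative_eq) (auto simp: partial_derivative_def)
qed

lemma C_k_mult:
  assumes "C_k k f" "C_k k g"
  shows "C_k k (\<lambda>x. f x * g x)"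
  using assms
proof (induction k arbitrary: f g)
  case 0
  then show ?case by (simp add: continuous_on_mult)
next
  case (Suc k)
  have "partial_derivative i (\<lambda>x. f x * g x) =
      (\<lambda>x. f x * partial_derivative i g x + partial_derivative i f x * g x)" for i
    using Suc.prems by (intro ext partial_derivative_mult) auto
  moreover have "C_k k (\<lambda>x. f x * partial_derivative i g x + partial_derivative i f x * g x)" for i
    using Suc.prems C_k_Suc by (intro C_k_add Suc.IH) auto
  moreover have "(\<lambda>x. f x * g x) differentiable_on UNIV"
    using Suc.prems by (auto simp: differentiable_on_def)
  ultimately show ?case by simp
qed

lemma C_k_prod:
  assumes "finite S" "\<And>i. i \<in> S \<Longrightarrow> C_k k (f i)"
  shows "C_k k (\<lambda>x. \<Prod>i\<in>S. f i x)"
  using assms by (induction S rule: finite_induct) (auto intro: C_k_const C_k_mult)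

lemma C_k_power:
  assumes "C_k k f"
  shows "C_k k (\<lambda>x. f x ^ n)"
  using C_k_prod[of "{..<n}" k "\<lambda>_. f"] assms by simp

lemma partial_derivative_affine:
  assumes "f differentiable_on UNIV"
  shows "partial_derivative i (\<lambda>x. f (t *\<^sub>R x + b)) x = t * partial_derivative i f (t *\<^sub>R x + b)"
proof -
  let ?D = "frechet_derivative f (at (t *\<^sub>R x + b))"
  have f: "(f has_derivative ?D) (at (t *\<^sub>R x + b))"
    using assms by (auto simp: differentiable_on_def frechet_derivative_works)
  have l: "((\<lambda>x. t *\<^sub>R x + b) has_derivative (\<lambda>h. t *\<^sub>R h)) (at x)"
    by (auto intro!: derivative_eq_intros)
  have "((\<lambda>x. f (t *\<^sub>R x + b)) has_derivative (\<lambda>h. ?D (t *\<^sub>R h))) (at x)"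
    using has_derivative_compose[OF l f] .
  moreover have "?D (t *\<^sub>R axis i 1) = t * ?D (axis i 1)"
    using linear_scale[OF has_derivative_linear[OF f]] by simp
  ultimately show ?thesis
    by (simp only: partial_derivative_eq) (simp add: partial_derivative_def)
qed

lemma differentiable_on_affine:
  fixes f :: "'a::real_normed_vector \<Rightarrow> real"
  assumes "f differentiable_on UNIV"
  shows "(\<lambda>x. f (t *\<^sub>R x + b)) differentiable_on UNIV"
proof -
  have "(\<lambda>x. t *\<^sub>R x + b) differentiable at x" for x
    by (intro derivative_intros)
  then show ?thesis
    using assms differentiable_chain_at[of "\<lambda>x. t *\<^sub>R x + b" _ f]
    by (auto simp: differentiable_on_def o_def)
qed

lemma C_k_affine:
  assumes "C_k k f"
  shows "C_k k (\<lambda>x. f (t *\<^sub>R x + b))"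
  using assms
proof (induction k arbitrary: f)
  case 0
  then have "continuous_on UNIV f" by simp
  then have "continuous_on UNIV (\<lambda>x. f (t *\<^sub>R x + b))"
    by (rule continuous_on_compose2) (auto intro!: continuous_on_add continuous_on_scaleR)
  then show ?case by simp
next
  case (Suc k)
  have "partial_derivative i (\<lambda>x. f (t *\<^sub>R x + b)) =
      (\<lambda>x. t * partial_derivative i f (t *\<^sub>R x + b))" for i
    using Suc.prems by (intro ext partial_derivative_affine) auto
  moreover have "C_k k (\<lambda>x. t * partial_derivative i f (t *\<^sub>R x + b))" for i
    using Suc.prems by (intro C_k_mult[OF C_k_const] Suc.IH) auto
  ultimately show ?case using Suc.prems differentiable_on_affine[of f t b] by simp
qed

text \<open>The classical smooth function exp(-1/t), cut to 0 for t <= 0. The polynomial factor in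
  1/t makes the family closed under differentiation, so smoothness of every order is one induction
  with \<open>p\<close> generalised.\<close>

definition flat :: "real poly \<Rightarrow> real \<Rightarrow> real" where
  "flat p t = (if t > 0 then poly p (1 / t) * exp (- (1 / t)) else 0)"

lemma tendsto_poly_div_exp: "((\<lambda>s::real. poly p s * exp (- s)) \<longlongrightarrow> 0) at_top"
proof -
  have "((\<lambda>s::real. \<Sum>i\<le>degree p. coeff p i * (s ^ i / exp s)) \<longlongrightarrow> (\<Sum>i\<le>degree p. coeff p i * 0)) at_top"
    by (intro tendsto_intros tendsto_power_div_exp_0)
  then show ?thesis
    by (simp add: poly_altdef sum_distrib_right exp_minus divide_inverse mult.assoc)
qed

lemma tendsto_flat: "(flat p \<longlongrightarrow> 0) (at 0)"
proof (subst filterlim_at_split, intro conjI)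
  show "(flat p \<longlongrightarrow> 0) (at_left 0)"
    by (rule Lim_transform_eventually[OF tendsto_const])
      (auto simp: flat_def eventually_at_filter)
  have "((\<lambda>t. poly p (inverse t) * exp (- inverse t)) \<longlongrightarrow> 0) (at_right 0)"
    by (rule filterlim_compose[OF tendsto_poly_div_exp filterlim_inverse_at_top_right])
  then show "(flat p \<longlongrightarrow> 0) (at_right 0)"
    by (rule Lim_transform_eventually)
      (auto simp: flat_def eventually_at_filter inverse_eq_divide)
qed

text \<open>The inner derivative of 1/t contributes 1/t^2, the factor \<open>[:0, 0, 1:]\<close>.
  Differentiating the exponential leaves \<open>p\<close>, differentiating the polynomial gives
  \<open>- pderiv p\<close>.\<close>

lemma DERIV_flat: "DERIV (flat p) t :> flat ([:0, 0, 1:] * (p - pderiv p)) t"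
proof (cases t "0::real" rule: linorder_cases)
  case less
  have "DERIV (\<lambda>t. 0) t :> (0::real)" by simp
  moreover have "eventually (\<lambda>s. flat p s = 0) (nhds t)"
    using order_tendstoD(2)[OF filterlim_ident less] by eventually_elim (auto simp: flat_def)
  ultimately show ?thesis
    using less by (subst DERIV_cong_ev[OF refl _ refl]) (auto simp: flat_def)
next
  case equal
  \<comment> \<open>At 0 the difference quotient stays in the family: dividing by \<open>h\<close>
    multiplies the polynomial in 1/h by its variable.\<close>
  have "(flat p h - flat p 0) / (h - 0) = flat (pCons 0 p) h" for h
    by (simp add: flat_def)
  then show ?thesis
    using tendsto_flat[of "pCons 0 p"] equal
    by (simp add: has_field_derivative_iff flat_def[of _ 0])
next
  case greater
  have "DERIV (\<lambda>t. poly p (1 / t) * exp (- (1 / t))) t :> flat ([:0, 0, 1:] * (p - pderiv p)) t"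
    using greater
    by (auto intro!: derivative_eq_intros DERIV_chain2[OF poly_DERIV]
        simp: flat_def field_simps power2_eq_square)
  moreover have "eventually (\<lambda>s. flat p s = poly p (1 / s) * exp (- (1 / s))) (nhds t)"
    using order_tendstoD(1)[OF filterlim_ident greater] by eventually_elim (auto simp: flat_def)
  ultimately show ?thesis
    by (subst DERIV_cong_ev[OF refl _ refl])
qed

text \<open>Used with \<open>s = 1\<close> and \<open>s = -1\<close>, for the two faces of a box in
  each coordinate direction.\<close>

lemma C_k_flat: "C_k k (\<lambda>x. flat p (s * x $ i + b))"
proof (induction k arbitrary: p)
  case 0
  have "continuous_on UNIV (flat p)"
    by (meson DERIV_flat DERIV_isCont continuous_at_imp_continuous_on)
  moreover have "continuous_on UNIV (\<lambda>x. s * x $ i + b)"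
    by (intro continuous_on_add continuous_on_mult continuous_on_const continuous_on_component continuous_on_id)
  ultimately have "continuous_on UNIV (\<lambda>x. flat p (s * x $ i + b))"
    by (rule continuous_on_compose2) auto
  then show ?case by simp
next
  case (Suc k)
  let ?q = "[:0, 0, 1:] * (p - pderiv p)"
  have d: "((\<lambda>x. flat p (s * x $ i + b)) has_derivative (\<lambda>h. flat ?q (s * x $ i + b) * (s * h $ i))) (at x)" for x
  proof -
    have "((\<lambda>x. s * x $ i + b) has_derivative (\<lambda>h. s * h $ i)) (at x)"
      by (auto intro!: derivative_eq_intros bounded_linear.has_derivative[OF bounded_linear_vec_nth])
    from has_derivative_compose[OF this DERIV_flat[unfolded has_field_derivative_def]]
    show ?thesis .
  qed
  have "partial_derivative j (\<lambda>x. flat p (s * x $ i + b)) =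
      (\<lambda>x. (s * axis j 1 $ i) * flat ?q (s * x $ i + b))" for j
    by (rule ext, subst partial_derivative_eq[OF d]) simp
  moreover have "C_k k (\<lambda>x. (s * axis j 1 $ i) * flat ?q (s * x $ i + b))" for j
    by (intro C_k_mult[OF C_k_const] Suc.IH)
  ultimately show ?case
    using d by (auto simp: differentiable_on_def differentiable_def)
qed

text \<open>As a product over coordinates it is positive exactly on the open box. Boxes are the
  right shape because they generate the Borel sets.\<close>

definition bump :: "real ^ 'n::finite \<Rightarrow> real ^ 'n \<Rightarrow> real ^ 'n \<Rightarrow> real" where
  "bump a b x = (\<Prod>i\<in>UNIV. flat 1 (x $ i - a $ i) * flat 1 (b $ i - x $ i))"

lemma C_k_bump: "C_k k (bump a b)"
proof -
  have "C_k k (\<lambda>x. flat 1 (1 * x $ i + - a $ i) * flat 1 (-1 * x $ i + b $ i))" for i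
    by (intro C_k_mult C_k_flat)
  then have "C_k k (\<lambda>x. \<Prod>i\<in>UNIV. flat 1 (1 * x $ i + - a $ i) * flat 1 (-1 * x $ i + b $ i))"
    by (intro C_k_prod) auto
  then show ?thesis unfolding bump_def[abs_def] by (simp add: algebra_simps)
qed

lemma flat_1_bounds: "0 \<le> flat 1 t" "flat 1 t \<le> 1" "flat 1 t = 0 \<longleftrightarrow> t \<le> 0"
  by (auto simp: flat_def)

lemma bump_nonneg: "0 \<le> bump a b x"
  unfolding bump_def by (intro prod_nonneg ballI mult_nonneg_nonneg flat_1_bounds)

lemma bump_le_1: "bump a b x \<le> 1"
  unfolding bump_def by (intro prod_le_1 conjI mult_nonneg_nonneg mult_le_one flat_1_bounds)

lemma bump_pos_iff: "0 < bump a b x \<longleftrightarrow> x \<in> box a b"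
proof -
  have "0 < bump a b x \<longleftrightarrow> bump a b x \<noteq> 0" using bump_nonneg[of a b x] by auto
  also have "\<dots> \<longleftrightarrow> (\<forall>i. \<not> x $ i - a $ i \<le> 0 \<and> \<not> b $ i - x $ i \<le> 0)"
    by (simp add: bump_def flat_1_bounds)
  also have "\<dots> \<longleftrightarrow> x \<in> box a b"
    by (simp add: mem_box_cart not_le)
  finally show ?thesis .
qed

section \<open>Compact support and closure properties of test functions\<close>

lemma test_functionI:
  assumes "\<And>k. C_k k f" "\<And>x. f x \<noteq> 0 \<Longrightarrow> x \<in> K" "compact K"
  shows "test_function f"
proof -
  have "bounded {x. f x \<noteq> 0}"
    using assms(2) by (intro bounded_subset[OF compact_imp_bounded[OF assms(3)]]) blast
  then show ?thesis
    using assms(1) unfolding test_function_def by (simp only: compact_closure simp_thms)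
qed

lemma test_function_support:
  assumes "test_function f"
  obtains K where "compact K" "\<And>x. x \<notin> K \<Longrightarrow> f x = 0"
proof (rule that)
  show "compact (closure {x. f x \<noteq> 0})" using assms by (simp only: test_function_def)
  show "f x = 0" if "x \<notin> closure {x. f x \<noteq> 0}" for x
    using that closure_subset[of "{x. f x \<noteq> 0}"] by blast
qed

lemma test_function_mult:
  assumes "test_function f" "\<And>k. C_k k g"
  shows "test_function (\<lambda>x. f x * g x)"
proof -
  obtain K where K: "compact K" "\<And>x. x \<notin> K \<Longrightarrow> f x = 0" using test_function_support[OF assms(1)] by blast
  show ?thesis
  proof (rule test_functionI)
    show "C_k k (\<lambda>x. f x * g x)" for k
      using assms(1) by (intro C_k_mult[OF _ assms(2)]) (simp add: test_function_def)
    show "x \<in> K" if "f x * g x \<noteq> 0" for x using that K(2) by fastforce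
  qed fact
qed

lemma test_function_bump: "test_function (bump a b)"
proof (rule test_functionI)
  show "x \<in> cbox a b" if "bump a b x \<noteq> 0" for x
    using that bump_nonneg[of a b x] bump_pos_iff[of a b x] box_subset_cbox[of a b] by auto
qed (auto intro: C_k_bump)

lemma test_function_affine:
  assumes "test_function f" "t \<noteq> 0"
  shows "test_function (\<lambda>x. f (t *\<^sub>R x + b))"
proof -
  obtain K where K: "compact K" "\<And>x. x \<notin> K \<Longrightarrow> f x = 0" using test_function_support[OF assms(1)] by blast
  have "compact ((\<lambda>y. (1 / t) *\<^sub>R (y - b)) ` K)"
    by (intro compact_continuous_image continuous_intros K)
  moreover have "x \<in> (\<lambda>y. (1 / t) *\<^sub>R (y - b)) ` K" if "f (t *\<^sub>R x + b) \<noteq> 0" for x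
    using that K(2) assms(2) by (intro image_eqI[of _ _ "t *\<^sub>R x + b"]) auto
  moreover have "C_k k (\<lambda>x. f (t *\<^sub>R x + b))" for k
    using assms(1) C_k_affine unfolding test_function_def by blast
  ultimately show ?thesis by (intro test_functionI)
qed

lemma test_function_partial_derivative:
  assumes "test_function f"
  shows "test_function (partial_derivative i f)"
proof -
  obtain K where K: "compact K" "\<And>x. x \<notin> K \<Longrightarrow> f x = 0" using test_function_support[OF assms] by blast
  have "partial_derivative i f x = 0" if "x \<notin> K" for x
  proof -
    have "open (- K)" using K(1) by (simp add: compact_imp_closed open_Compl)
    moreover have "0 = f y" if "y \<in> - K" for y using that K(2) by simp
    ultimately have "(f has_derivative (\<lambda>h. 0)) (at x)"
      using that by (intro has_derivative_transform_within_open[OF has_derivative_const, of "- K"]) auto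
    then show ?thesis by (simp add: partial_derivative_eq)
  qed
  moreover have "C_k k (partial_derivative i f)" for k
    using assms unfolding test_function_def by (metis C_k.simps(2))
  ultimately show ?thesis using K(1) by (metis test_functionI)
qed

lemma test_function_differentiable: "test_function f \<Longrightarrow> f differentiable_on UNIV"
  unfolding test_function_def by (metis C_k.simps(2))

lemma test_function_continuous: "test_function f \<Longrightarrow> continuous_on UNIV f"
  unfolding test_function_def using C_k_continuous by blast

lemma test_function_measurable: "test_function f \<Longrightarrow> f \<in> borel_measurable borel"
  using test_function_continuous by (rule borel_measurable_continuous_onI)

lemma test_function_bounded:
  assumes "test_function f"
  obtains B where "B > 0" "\<And>x. \<bar>f x\<bar> \<le> B"
proof -
  obtain K where K: "compact K" "\<And>x. x \<notin> K \<Longrightarrow> f x = 0" using test_function_support[OF assms] by blast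
  have "compact (f ` K)"
    using K(1) test_function_continuous[OF assms]
    by (intro compact_continuous_image) (auto intro: continuous_on_subset)
  then obtain B where "B > 0" "\<forall>y\<in>f ` K. norm y \<le> B"
    using bounded_pos compact_imp_bounded by blast
  then show ?thesis using K(2) that by (metis abs_zero imageI less_imp_le real_norm_def)
qed

section \<open>Integration\<close>

lemma nn_integral_lborel_affine:
  fixes f :: "'a::euclidean_space \<Rightarrow> ennreal"
  assumes [measurable]: "f \<in> borel_measurable borel" and c: "c \<noteq> 0"
  shows "(\<integral>\<^sup>+x. f (c *\<^sub>R x + t) \<partial>lborel) = ennreal (1 / \<bar>c\<bar> ^ DIM('a)) * (\<integral>\<^sup>+x. f x \<partial>lborel)"
proof -
  have "(\<integral>\<^sup>+x. f x \<partial>lborel) = ennreal (\<bar>c\<bar> ^ DIM('a)) * (\<integral>\<^sup>+x. f (c *\<^sub>R x + t) \<partial>lborel)"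
    by (subst lborel_affine[OF c, of t])
      (simp add: nn_integral_density nn_integral_distr nn_integral_cmult add.commute)
  moreover have "ennreal (1 / \<bar>c\<bar> ^ DIM('a)) * ennreal (\<bar>c\<bar> ^ DIM('a)) = 1"
    using c by (simp add: ennreal_mult[symmetric])
  ultimately show ?thesis
    by (simp add: mult.assoc[symmetric])
qed

lemma integrable_lborel_affine:
  fixes f :: "'a::euclidean_space \<Rightarrow> 'b::{banach, second_countable_topology}"
  assumes f: "integrable lborel f" and c: "c \<noteq> 0"
  shows "integrable lborel (\<lambda>x. f (c *\<^sub>R x + t))"
proof -
  have [measurable]: "f \<in> borel_measurable borel" using f by auto
  have "(\<integral>\<^sup>+x. norm (f (c *\<^sub>R x + t)) \<partial>lborel) < \<infinity>"
    using f c nn_integral_lborel_affine[of "\<lambda>x. norm (f x)" c t]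
    by (simp add: integrable_iff_bounded ennreal_mult_less_top)
  then show ?thesis by (simp add: integrable_iff_bounded)
qed

lemma integrable_lborel_affine_iff:
  fixes f :: "'a::euclidean_space \<Rightarrow> 'b::{banach, second_countable_topology}"
  assumes c: "c \<noteq> 0"
  shows "integrable lborel (\<lambda>x. f (c *\<^sub>R x + t)) \<longleftrightarrow> integrable lborel f"
proof
  assume "integrable lborel (\<lambda>x. f (c *\<^sub>R x + t))"
  from integrable_lborel_affine[OF this, of "1 / c" "- (1 / c) *\<^sub>R t"] c
  show "integrable lborel f" by (simp add: algebra_simps)
qed (rule integrable_lborel_affine[OF _ c])

lemma integral_lborel_affine:
  fixes f :: "'a::euclidean_space \<Rightarrow> 'b::{banach, second_countable_topology}"
  assumes c: "c \<noteq> 0"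
  shows "(LINT x|lborel. f (c *\<^sub>R x + t)) = (1 / \<bar>c\<bar> ^ DIM('a)) *\<^sub>R (LINT x|lborel. f x)"
proof (cases "integrable lborel f")
  case True
  then have [measurable]: "f \<in> borel_measurable borel" by auto
  have "(LINT x|lborel. f x) = \<bar>c\<bar> ^ DIM('a) *\<^sub>R (LINT x|lborel. f (c *\<^sub>R x + t))"
    by (subst lborel_affine[OF c, of t])
      (simp add: integral_density integral_distr add.commute)
  then show ?thesis using c by simp
next
  case False
  \<comment> \<open>Both integrals take the default value 0 here.\<close>
  then show ?thesis using c by (simp add: integrable_lborel_affine_iff not_integrable_integral_eq)
qed

lemma integral_lborel_translate:
  fixes f :: "'a::euclidean_space \<Rightarrow> 'b::{banach, second_countable_topology}"
  shows "(LINT x|lborel. f (x + t)) = (LINT x|lborel. f x)"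
  using integral_lborel_affine[of 1 f t] by simp

text \<open>Integrability of the cut-off to each closed ball makes that cut-off measurable, and the
  cut-offs converge pointwise to \<open>f\<close>.\<close>

lemma locally_integrable_measurable:
  fixes f :: "real ^ 'n::finite \<Rightarrow> 'b::{banach, second_countable_topology}"
  assumes "locally_integrable f"
  shows "f \<in> borel_measurable borel"
proof (rule borel_measurable_LIMSEQ_metric)
  show "(\<lambda>x. indicator (cball 0 (real n)) x *\<^sub>R f x) \<in> borel_measurable borel" for n
  proof -
    have "integrable lborel (\<lambda>x. indicator (cball 0 (real n)) x *\<^sub>R f x)"
      using assms unfolding locally_integrable_def set_integrable_def by simp
    then show ?thesis using borel_measurable_integrable by fastforce
  qed
  show "(\<lambda>n. indicator (cball 0 (real n)) x *\<^sub>R f x) \<longlonglongrightarrow> f x" for x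
  proof (rule tendsto_eventually)
    obtain m :: nat where "norm x \<le> real m" using real_arch_simple by blast
    then show "eventually (\<lambda>n. indicator (cball 0 (real n)) x *\<^sub>R f x = f x) sequentially"
      by (intro eventually_sequentiallyI[of m]) auto
  qed
qed

lemma locally_integrable_mult_test:
  fixes f :: "real ^ 'n::finite \<Rightarrow> real"
  assumes f: "locally_integrable f" and \<phi>: "test_function \<phi>"
  shows "integrable lborel (\<lambda>x. f x * \<phi> x)"
proof -
  obtain K where K: "compact K" "\<And>x. x \<notin> K \<Longrightarrow> \<phi> x = 0" using test_function_support[OF \<phi>] by blast
  obtain B where B: "B > 0" "\<And>x. \<bar>\<phi> x\<bar> \<le> B" using test_function_bounded[OF \<phi>] by blast
  note [measurable] = locally_integrable_measurable[OF f] test_function_measurable[OF \<phi>]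
  have "integrable lborel (\<lambda>x. B * (indicator K x *\<^sub>R f x))"
    using f K(1) unfolding locally_integrable_def set_integrable_def by simp
  then show ?thesis
  proof (rule Bochner_Integration.integrable_bound)
    show "AE x in lborel. norm (f x * \<phi> x) \<le> norm (B * (indicator K x *\<^sub>R f x))"
    proof (rule AE_I2)
      fix x
      show "norm (f x * \<phi> x) \<le> norm (B * (indicator K x *\<^sub>R f x))"
        using B K(2)[of x] by (cases "x \<in> K") (auto simp: abs_mult mult.commute intro!: mult_right_mono)
    qed
  qed simp
qed

lemma locally_integrable_integral_box_eq_0:
  fixes f :: "real ^ 'n::finite \<Rightarrow> real"
  assumes f: "locally_integrable f"
    and 0: "\<And>\<phi>. test_function \<phi> \<Longrightarrow> (LINT x|lborel. f x * \<phi> x) = 0"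
  shows "(LINT x|lborel. indicator (box a b) x * f x) = 0"
proof -
  note [measurable] = locally_integrable_measurable[OF f]
  \<comment> \<open>smooth, supported in the closed box, and increasing to the indicator of the open one\<close>
  define \<phi> where "\<phi> n x = 1 + (-1) * (1 + (-1) * bump a b x) ^ n" for n x
  have C: "C_k k (\<phi> n)" for k n
    unfolding \<phi>_def by (intro C_k_add C_k_const C_k_mult C_k_power C_k_bump)
  have out: "\<phi> n x = 0" if "x \<notin> box a b" for n x
    using that bump_pos_iff[of a b x] bump_nonneg[of a b x] by (simp add: \<phi>_def)
  have t: "test_function (\<phi> n)" for n
    by (rule test_functionI[OF C, of _ "cbox a b"]) (use out box_subset_cbox in blast, simp)
  have bd: "\<bar>\<phi> n x\<bar> \<le> 1" for n x
    using bump_le_1[of a b x] bump_nonneg[of a b x] power_le_one[of "1 - bump a b x" n]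
    by (simp add: \<phi>_def abs_le_iff)
  have lim: "(\<lambda>n. \<phi> n x) \<longlonglongrightarrow> indicator (box a b) x" for x
  proof (cases "x \<in> box a b")
    case True
    then have "(\<lambda>n. 1 - (1 - bump a b x) ^ n) \<longlonglongrightarrow> 1 - 0"
      using bump_pos_iff[of a b x] bump_le_1[of a b x]
      by (intro tendsto_intros LIMSEQ_realpow_zero) auto
    then show ?thesis using True by (simp add: \<phi>_def)
  qed (simp add: out)
  have "(\<lambda>n. LINT x|lborel. f x * \<phi> n x) \<longlonglongrightarrow> (LINT x|lborel. indicator (box a b) x * f x)"
  proof (rule integral_dominated_convergence)
    show "integrable lborel (\<lambda>x. norm (indicator (cbox a b) x *\<^sub>R f x))"
      using f unfolding locally_integrable_def set_integrable_def by (intro integrable_norm) simp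
    show "AE x in lborel. (\<lambda>n. f x * \<phi> n x) \<longlonglongrightarrow> indicator (box a b) x * f x"
      using tendsto_mult[OF tendsto_const lim] by (intro AE_I2) (simp add: mult.commute)
    show "AE x in lborel. norm (f x * \<phi> n x) \<le> norm (indicator (cbox a b) x *\<^sub>R f x)" for n
    proof (rule AE_I2)
      fix x
      show "norm (f x * \<phi> n x) \<le> norm (indicator (cbox a b) x *\<^sub>R f x)"
        using bd[of n x] out[of x n] box_subset_cbox[of a b]
        by (cases "x \<in> box a b") (auto simp: abs_mult mult_left_le)
    qed
    show "(\<lambda>x. f x * \<phi> n x) \<in> borel_measurable lborel" for n
      using test_function_measurable[OF t, of n] by simp
  qed simp
  then have "(\<lambda>n. 0) \<longlonglongrightarrow> (LINT x|lborel. indicator (box a b) x * f x)"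
    using 0[OF t] by simp
  then show ?thesis by (simp add: LIMSEQ_const_iff)
qed

text \<open>The fundamental lemma of the calculus of variations. Since \<open>ennreal\<close> sends
  negative numbers to 0, \<open>P\<close> and \<open>Q\<close> have the positive and the negative
  part of \<open>f\<close> as densities. They agree and are finite on open boxes, hence coincide, so
  the two parts are equal almost everywhere, which forces both to vanish.\<close>

lemma AE_eq_0_if_test_integrals_eq_0:
  fixes f :: "real ^ 'n::finite \<Rightarrow> real"
  assumes f: "locally_integrable f"
    and 0: "\<And>\<phi>. test_function \<phi> \<Longrightarrow> (LINT x|lborel. f x * \<phi> x) = 0"
  shows "AE x in lborel. f x = 0"
proof -
  note [measurable] = locally_integrable_measurable[OF f]
  define P where "P = density lborel (\<lambda>x. ennreal (f x))"
  define Q where "Q = density lborel (\<lambda>x. ennreal (- f x))"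
  have *: "emeasure P (box a b) = emeasure Q (box a b) \<and> emeasure P (box a b) \<noteq> \<infinity>" for a b
  proof -
    let ?g = "\<lambda>x. indicator (box a b) x * f x"
    have "integrable lborel (\<lambda>x. indicator (cbox a b) x *\<^sub>R f x)"
      using f unfolding locally_integrable_def set_integrable_def by simp
    then have int: "integrable lborel ?g"
      using box_subset_cbox[of a b]
      by (elim Bochner_Integration.integrable_bound) (auto simp: indicator_def)
    have P: "emeasure P (box a b) = (\<integral>\<^sup>+x. ennreal (?g x) \<partial>lborel)"
      unfolding P_def by (subst emeasure_density) (auto intro!: nn_integral_cong simp: indicator_def)
    have Q: "emeasure Q (box a b) = (\<integral>\<^sup>+x. ennreal (- ?g x) \<partial>lborel)"
      unfolding Q_def by (subst emeasure_density) (auto intro!: nn_integral_cong simp: indicator_def)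
    have fin: "emeasure P (box a b) \<noteq> \<infinity>" "emeasure Q (box a b) \<noteq> \<infinity>"
      using int unfolding P Q real_integrable_def by auto
    have "enn2real (emeasure P (box a b)) = enn2real (emeasure Q (box a b))"
      using locally_integrable_integral_box_eq_0[OF assms, of a b]
      unfolding P Q real_lebesgue_integral_def[OF int] by simp
    with fin show ?thesis by (metis ennreal_enn2real infinity_ennreal_def less_top)
  qed
  have "P = Q"
  proof (rule measure_eqI_generator_eq)
    let ?E = "range (\<lambda>(a, b). box a b :: (real ^ 'n) set)"
    let ?A = "\<lambda>n::nat. box (- (real n *\<^sub>R One)) (real n *\<^sub>R One) :: (real ^ 'n) set"
    show "Int_stable ?E" by (force simp: Int_stable_def box_Int_box)
    show "?E \<subseteq> Pow UNIV" by simp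
    show "sets P = sigma_sets UNIV ?E" "sets Q = sigma_sets UNIV ?E"
      by (auto simp: P_def Q_def borel_eq_box)
    show "range ?A \<subseteq> ?E" by auto
    show "(\<Union>i. ?A i) = UNIV" unfolding UN_box_eq_UNIV by auto
    show "emeasure P X = emeasure Q X" if "X \<in> ?E" for X using that * by auto
    show "emeasure P (?A i) \<noteq> \<infinity>" for i using * by blast
  qed
  then have "AE x in lborel. ennreal (f x) = ennreal (- f x)"
    unfolding P_def Q_def by (intro sigma_finite_measure.density_unique[OF sigma_finite_lborel]) auto
  then show ?thesis
    by eventually_elim (metis add.inverse_inverse ennreal_eq_zero_iff ennreal_neg linorder_linear neg_0_le_iff_le)
qed

text \<open>A density rather than a restricted space, so that Borel measurability carries over unchanged.\<close>

definition unit_interval :: "real measure" where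
  "unit_interval = density lborel (indicator {0..1})"

lemma sets_unit_interval [simp, measurable_cong]: "sets unit_interval = sets borel"
  by (simp add: unit_interval_def)

lemma space_unit_interval [simp]: "space unit_interval = UNIV"
  by (simp add: unit_interval_def)

lemma emeasure_unit_interval_UNIV [simp]: "emeasure unit_interval UNIV = 1"
  by (simp add: unit_interval_def emeasure_density)

interpretation unit_interval: finite_measure unit_interval
  by (rule finite_measureI) simp

interpretation lborel_unit: pair_sigma_finite "lborel :: 'a::euclidean_space measure" unit_interval ..

interpretation unit_unit: pair_sigma_finite unit_interval unit_interval ..

lemma AE_unit_interval: "(AE t in unit_interval. P t) \<longleftrightarrow> (AE t in lborel. t \<in> {0..1} \<longrightarrow> P t)"
  unfolding unit_interval_def by (subst AE_density) (auto simp: indicator_def)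

lemma AE_unit_intervalI: "(\<And>t. 0 \<le> t \<Longrightarrow> t \<le> 1 \<Longrightarrow> P t) \<Longrightarrow> AE t in unit_interval. P t"
  by (simp add: AE_unit_interval)

lemma integral_unit_interval:
  assumes [measurable]: "f \<in> borel_measurable borel"
  shows "(LINT t|unit_interval. f t) = (LINT t|lborel. indicator {0..1} t * (f t :: real))"
proof -
  have *: "unit_interval = density lborel (\<lambda>t. ennreal (indicator {0..1} t))"
    by (simp add: unit_interval_def ennreal_indicator)
  show ?thesis by (subst *, subst integral_density) auto
qed

lemma nn_integral_unit_const: "(\<integral>\<^sup>+t. c \<partial>unit_interval) = c"
  by simp

text \<open>Tonelli: each \<open>t\<close> contributes the same integral by translation invariance,
  and \<open>unit_interval\<close> has total mass 1. Averaging along segments therefore costs no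
  constant.\<close>

lemma pair_nn_integral_translate:
  fixes f :: "real ^ 'n::finite \<Rightarrow> ennreal"
  assumes [measurable]: "f \<in> borel_measurable borel"
  shows "(\<integral>\<^sup>+x. (\<integral>\<^sup>+t. f (x + t *\<^sub>R h) \<partial>unit_interval) \<partial>lborel) = (\<integral>\<^sup>+x. f x \<partial>lborel)"
proof -
  have "(\<integral>\<^sup>+x. (\<integral>\<^sup>+t. f (x + t *\<^sub>R h) \<partial>unit_interval) \<partial>lborel)
      = (\<integral>\<^sup>+t. (\<integral>\<^sup>+x. f (x + t *\<^sub>R h) \<partial>lborel) \<partial>unit_interval)"
    by (rule lborel_unit.Fubini'[symmetric]) simp
  also have "\<dots> = (\<integral>\<^sup>+t. (\<integral>\<^sup>+x. f x \<partial>lborel) \<partial>unit_interval)"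
    using nn_integral_lborel_affine[of f 1] by (simp add: one_ennreal_def[symmetric])
  finally show ?thesis by (simp add: nn_integral_unit_const)
qed

section \<open>Translates of weakly differentiable functions\<close>

definition directional_derivative :: "real ^ 'n \<Rightarrow> (real ^ 'n \<Rightarrow> real) \<Rightarrow> real ^ 'n::finite \<Rightarrow> real" where
  "directional_derivative h \<phi> x = (\<Sum>i\<in>UNIV. h $ i * partial_derivative i \<phi> x)"

lemma has_derivative_directional_derivative:
  assumes "\<phi> differentiable_on UNIV"
  shows "(\<phi> has_derivative (\<lambda>h. directional_derivative h \<phi> x)) (at x)"
proof -
  let ?D = "frechet_derivative \<phi> (at x)"
  have D: "(\<phi> has_derivative ?D) (at x)"
    using assms by (auto simp: differentiable_on_def frechet_derivative_works)
  interpret linear ?D using has_derivative_linear[OF D] .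
  have "?D h = directional_derivative h \<phi> x" for h
  proof -
    have "?D h = ?D (\<Sum>i\<in>UNIV. h $ i *\<^sub>R axis i 1)" by (simp add: basis_expansion flip: scalar_mult_eq_scaleR)
    also have "\<dots> = directional_derivative h \<phi> x"
      by (simp add: sum scale directional_derivative_def partial_derivative_def)
    finally show ?thesis .
  qed
  then have "?D = (\<lambda>h. directional_derivative h \<phi> x)" by blast
  with D show ?thesis by simp
qed

lemma directional_derivative_minus: "directional_derivative (- h) \<phi> x = - directional_derivative h \<phi> x"
  by (simp add: directional_derivative_def sum_negf)

lemma directional_derivative_scaleR: "directional_derivative (t *\<^sub>R h) \<phi> x = t * directional_derivative h \<phi> x"
  by (simp add: directional_derivative_def sum_distrib_left mult.assoc)

lemma test_function_sum:
  assumes "finite S" "\<And>i. i \<in> S \<Longrightarrow> test_function (f i)"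
  shows "test_function (\<lambda>x. \<Sum>i\<in>S. f i x)"
proof -
  have "\<forall>i\<in>S. \<exists>K. compact K \<and> (\<forall>x. x \<notin> K \<longrightarrow> f i x = 0)"
    using assms(2) test_function_support by metis
  then obtain K where K: "\<forall>i\<in>S. compact (K i) \<and> (\<forall>x. x \<notin> K i \<longrightarrow> f i x = 0)" by metis
  show ?thesis
  proof (rule test_functionI)
    show "compact (\<Union>i\<in>S. K i)" using assms(1) K by (intro compact_UN) auto
    show "x \<in> (\<Union>i\<in>S. K i)" if "(\<Sum>i\<in>S. f i x) \<noteq> 0" for x
      using that K by (meson UN_I sum.neutral)
    show "C_k k (\<lambda>x. \<Sum>i\<in>S. f i x)" for k
      using assms
    proof (induction S rule: finite_induct)
      case (insert i S)
      then have "C_k k (\<lambda>x. f i x + (\<Sum>i\<in>S. f i x))"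
        by (intro C_k_add) (auto simp only: test_function_def insert_iff)
      with insert show ?case by simp
    qed (simp only: sum.empty C_k_const)
  qed
qed

lemma test_function_directional_derivative:
  assumes "test_function \<phi>"
  shows "test_function (directional_derivative h \<phi>)"
proof -
  have "test_function (\<lambda>x. partial_derivative i \<phi> x * h $ i)" for i
    by (intro test_function_mult test_function_partial_derivative assms C_k_const)
  then show ?thesis
    unfolding directional_derivative_def[abs_def] by (intro test_function_sum) (simp_all only: mult.commute finite)
qed

lemma directional_derivative_translate:
  assumes "test_function \<phi>"
  shows "directional_derivative h (\<lambda>x. \<phi> (x + b)) x = directional_derivative h \<phi> (x + b)"
  using partial_derivative_affine[OF test_function_differentiable[OF assms], of _ 1 b]
  by (simp add: directional_derivative_def)

text \<open>The fundamental theorem of calculus on the segment from \<open>x\<close> to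
  \<open>x + h\<close>.\<close>

lemma test_function_increment:
  assumes "test_function \<phi>"
  shows "\<phi> (x + h) - \<phi> x = (LINT t|unit_interval. directional_derivative h \<phi> (x + t *\<^sub>R h))"
proof -
  note d = test_function_directional_derivative[OF assms, of h]
  have [measurable]: "directional_derivative h \<phi> \<in> borel_measurable borel"
    by (rule test_function_measurable[OF d])
  have D: "((\<lambda>t. \<phi> (x + t *\<^sub>R h)) has_vector_derivative directional_derivative h \<phi> (x + t *\<^sub>R h)) (at t within {0..1})" for t
  proof -
    have "((\<lambda>t. x + t *\<^sub>R h) has_derivative (\<lambda>s. s *\<^sub>R h)) (at t within {0..1})"
      by (auto intro!: derivative_eq_intros)
    from has_derivative_compose[OF this has_derivative_directional_derivative[OF test_function_differentiable[OF assms]]]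
    show ?thesis
      by (simp add: has_vector_derivative_def directional_derivative_scaleR)
  qed
  have "continuous_on {0..1} (\<lambda>t. directional_derivative h \<phi> (x + t *\<^sub>R h))"
    by (rule continuous_on_compose2[OF test_function_continuous[OF d]]) (auto intro!: continuous_intros)
  from integral_FTC_Icc[OF _ D this]
  have "(LINT t|lborel. indicator {0..1} t *\<^sub>R directional_derivative h \<phi> (x + t *\<^sub>R h)) = \<phi> (x + h) - \<phi> x"
    by simp
  then show ?thesis by (simp add: integral_unit_interval)
qed

text \<open>Supplies the hypothesis of Fubini's theorem: for \<open>t\<close> in [0,1] and
  \<open>x\<close> in the ball of radius \<open>R\<close>, the point \<open>x + t h\<close> stays in
  the ball of radius \<open>R + norm h\<close>, where \<open>\<gamma>\<close> is integrable.\<close>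

lemma integrable_pair_translate:
  fixes \<gamma> w :: "real ^ 'n::finite \<Rightarrow> real"
  assumes \<gamma>: "locally_integrable \<gamma>" and [measurable]: "w \<in> borel_measurable borel"
    and w: "\<And>x. \<bar>w x\<bar> \<le> B" "\<And>x. x \<notin> cball 0 R \<Longrightarrow> w x = 0"
  shows "integrable (lborel \<Otimes>\<^sub>M unit_interval) (\<lambda>(x, t). w x * \<gamma> (x + t *\<^sub>R h))"
proof -
  note [measurable] = locally_integrable_measurable[OF \<gamma>]
  let ?g = "\<lambda>x. ennreal (B * norm (indicator (cball 0 (R + norm h)) x *\<^sub>R \<gamma> x))"
  have B: "B \<ge> 0" using w(1)[of 0] by simp
  have "integrable lborel (\<lambda>x. B * norm (indicator (cball 0 (R + norm h)) x *\<^sub>R \<gamma> x))"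
    using \<gamma> unfolding locally_integrable_def set_integrable_def
    by (intro integrable_mult_right integrable_norm) simp
  moreover have "norm (B * norm (indicator (cball 0 (R + norm h)) x *\<^sub>R \<gamma> x)) =
      B * norm (indicator (cball 0 (R + norm h)) x *\<^sub>R \<gamma> x)" for x
    using B by (simp add: abs_mult)
  ultimately have fin: "(\<integral>\<^sup>+x. ?g x \<partial>lborel) < \<infinity>"
    by (simp only: integrable_iff_bounded)
  have "(\<integral>\<^sup>+z. norm (case z of (x, t) \<Rightarrow> w x * \<gamma> (x + t *\<^sub>R h)) \<partial>(lborel \<Otimes>\<^sub>M unit_interval))
     = (\<integral>\<^sup>+x. (\<integral>\<^sup>+t. norm (w x * \<gamma> (x + t *\<^sub>R h)) \<partial>unit_interval) \<partial>lborel)"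
    by (subst unit_interval.nn_integral_fst[symmetric]) auto
  also have "\<dots> \<le> (\<integral>\<^sup>+x. (\<integral>\<^sup>+t. ?g (x + t *\<^sub>R h) \<partial>unit_interval) \<partial>lborel)"
  proof (rule nn_integral_mono, rule nn_integral_mono_AE, rule AE_unit_intervalI)
    fix x :: "real ^ 'n" and t :: real
    assume t: "0 \<le> t" "t \<le> 1"
    show "ennreal (norm (w x * \<gamma> (x + t *\<^sub>R h))) \<le> ?g (x + t *\<^sub>R h)"
    proof (cases "x \<in> cball 0 R")
      case True
      have "norm (x + t *\<^sub>R h) \<le> norm x + norm h"
        using t by (intro order_trans[OF norm_triangle_ineq]) (auto simp: mult_left_le_one_le)
      with True have "x + t *\<^sub>R h \<in> cball 0 (R + norm h)" by simp
      then show ?thesis using w(1)[of x] by (auto simp: abs_mult intro!: ennreal_leI mult_right_mono)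
    qed (simp add: w)
  qed
  also have "\<dots> = (\<integral>\<^sup>+x. ?g x \<partial>lborel)"
  proof (rule pair_nn_integral_translate)
    have [measurable]: "cball (0 :: real ^ 'n) (R + norm h) \<in> sets borel" by (simp add: borel_closed)
    show "?g \<in> borel_measurable borel" by measurable
  qed
  finally show ?thesis using fin by (simp add: integrable_iff_bounded)
qed

lemma compact_subset_cball:
  fixes K :: "'a::real_normed_vector set"
  assumes "compact K"
  shows "\<exists>R. K \<subseteq> cball 0 R"
  using compact_imp_bounded[OF assms] unfolding bounded_iff by (auto simp: subset_iff)

lemma locally_integrable_line_integral:
  fixes \<gamma> :: "real ^ 'n::finite \<Rightarrow> real"
  assumes \<gamma>: "locally_integrable \<gamma>"
  shows "locally_integrable (\<lambda>x. LINT t|unit_interval. \<gamma> (x + t *\<^sub>R h))"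
  unfolding locally_integrable_def set_integrable_def
proof (intro allI impI)
  fix K :: "(real ^ 'n) set" assume "compact K"
  then obtain R where R: "K \<subseteq> cball 0 R"
    using compact_subset_cball by blast
  have [measurable]: "K \<in> sets borel" using \<open>compact K\<close> by (simp add: compact_imp_closed)
  have "integrable (lborel \<Otimes>\<^sub>M unit_interval) (\<lambda>(x, t). indicator K x * \<gamma> (x + t *\<^sub>R h))"
    using R by (intro integrable_pair_translate[OF \<gamma>, where B=1 and R=R]) (auto simp: indicator_def)
  from lborel_unit.integrable_fst'[OF this]
  show "integrable lborel (\<lambda>x. indicator K x *\<^sub>R (LINT t|unit_interval. \<gamma> (x + t *\<^sub>R h)))"
    by simp
qed

lemma locally_integrable_diff:
  assumes "locally_integrable f" "locally_integrable g"
  shows "locally_integrable (\<lambda>x. f x - g x)"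
  using assms unfolding locally_integrable_def by (auto intro: set_integral_diff)

lemma locally_integrable_translate:
  fixes f :: "real ^ 'n::finite \<Rightarrow> 'b::{banach, second_countable_topology}"
  assumes "locally_integrable f" and c: "c \<noteq> 0"
  shows "locally_integrable (\<lambda>x. f (c *\<^sub>R x + h))"
  unfolding locally_integrable_def set_integrable_def
proof (intro allI impI)
  fix K :: "(real ^ 'n) set" assume "compact K"
  then have "compact ((\<lambda>x. c *\<^sub>R x + h) ` K)" by (intro compact_continuous_image continuous_intros)
  then have "integrable lborel (\<lambda>x. indicator ((\<lambda>x. c *\<^sub>R x + h) ` K) x *\<^sub>R f x)"
    using assms unfolding locally_integrable_def set_integrable_def by blast
  from integrable_lborel_affine[OF this c, of h]
  show "integrable lborel (\<lambda>x. indicator K x *\<^sub>R f (c *\<^sub>R x + h))"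
    using c by (simp add: indicator_def image_iff)
qed

text \<open>Tested against \<open>\<phi>\<close>, the increment of \<open>u\<close> moves to an
  increment of \<open>\<phi>\<close> in direction \<open>- h\<close>. That is a segment integral of
  directional derivatives, the weak identity applies to the translated test function for each
  \<open>t\<close>, and shifting back turns the result into the segment integral of
  \<open>\<gamma>\<close>. The exceptional null set may depend on \<open>h\<close>.\<close>

lemma weak_derivative_increment:
  fixes u \<gamma> :: "real ^ 'n::finite \<Rightarrow> real"
  assumes u: "locally_integrable u" and \<gamma>: "locally_integrable \<gamma>"
    and weak: "\<And>\<phi>. test_function \<phi> \<Longrightarrow>
      (LINT x|lborel. u x * directional_derivative h \<phi> x) = - (LINT x|lborel. \<gamma> x * \<phi> x)"
  shows "AE x in lborel. u (x + h) - u x = (LINT t|unit_interval. \<gamma> (x + t *\<^sub>R h))"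
proof -
  let ?I = "\<lambda>x. LINT t|unit_interval. \<gamma> (x + t *\<^sub>R h)"
  have uh: "locally_integrable (\<lambda>x. u (x + h))" using locally_integrable_translate[OF u, of 1 h] by simp
  note li = locally_integrable_line_integral[OF \<gamma>, of h]
  have "AE x in lborel. u (x + h) - u x - ?I x = 0"
  proof (rule AE_eq_0_if_test_integrals_eq_0)
    show "locally_integrable (\<lambda>x. u (x + h) - u x - ?I x)"
      by (intro locally_integrable_diff uh u li)
    fix \<phi> :: "real ^ 'n \<Rightarrow> real" assume \<phi>: "test_function \<phi>"
    note [measurable] = locally_integrable_measurable[OF u] locally_integrable_measurable[OF \<gamma>]
      test_function_measurable[OF \<phi>] test_function_measurable[OF test_function_directional_derivative[OF \<phi>]]
    have \<phi>t: "test_function (\<lambda>x. \<phi> (x + b))" for b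
      using test_function_affine[OF \<phi>, of 1 b] by simp
    obtain K where K: "compact K" "\<And>x. x \<notin> K \<Longrightarrow> \<phi> x = 0" using test_function_support[OF \<phi>] by blast
    obtain R where R: "K \<subseteq> cball 0 R" using compact_subset_cball[OF K(1)] by blast
    obtain B where B: "\<And>x. \<bar>\<phi> x\<bar> \<le> B" using test_function_bounded[OF \<phi>] by blast
    define D where "D = directional_derivative h \<phi>"
    have tD: "test_function D" unfolding D_def by (rule test_function_directional_derivative[OF \<phi>])
    note [measurable] = test_function_measurable[OF tD]
    obtain K' where K': "compact K'" "\<And>x. x \<notin> K' \<Longrightarrow> D x = 0" using test_function_support[OF tD] by blast
    obtain R' where R': "K' \<subseteq> cball 0 R'" using compact_subset_cball[OF K'(1)] by blast
    obtain B' where B': "\<And>x. \<bar>D x\<bar> \<le> B'" using test_function_bounded[OF tD] by blast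
    have "(LINT x|lborel. u (x + h) * \<phi> x) = (LINT x|lborel. u x * \<phi> (x + - h))"
      using integral_lborel_translate[of "\<lambda>x. u x * \<phi> (x + - h)" h] by simp
    then have "(LINT x|lborel. u (x + h) * \<phi> x) - (LINT x|lborel. u x * \<phi> x)
        = (LINT x|lborel. u x * \<phi> (x + - h) - u x * \<phi> x)"
      by (subst Bochner_Integration.integral_diff) (auto intro!: locally_integrable_mult_test u \<phi> \<phi>t simp del: add_uminus_conv_diff)
    also have "\<dots> = (LINT x|lborel. (LINT t|unit_interval. u x * - D (x + t *\<^sub>R - h)))"
      using test_function_increment[OF \<phi>, of _ "- h"]
      by (intro Bochner_Integration.integral_cong) (simp_all add: right_diff_distrib[symmetric] directional_derivative_minus D_def)
    also have "\<dots> = (LINT t|unit_interval. (LINT x|lborel. u x * - D (x + t *\<^sub>R - h)))"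
    proof (rule lborel_unit.Fubini_integral[symmetric])
      show "integrable (lborel \<Otimes>\<^sub>M unit_interval) (\<lambda>(x, t). u x * - D (x + t *\<^sub>R - h))"
      proof (rule integrableI_bounded)
        have "(\<integral>\<^sup>+z. norm (case z of (x, t) \<Rightarrow> u x * - D (x + t *\<^sub>R - h)) \<partial>(lborel \<Otimes>\<^sub>M unit_interval))
          = (\<integral>\<^sup>+x. (\<integral>\<^sup>+t. norm (u x * - D (x + t *\<^sub>R - h)) \<partial>unit_interval) \<partial>lborel)"
          by (subst unit_interval.nn_integral_fst[symmetric]) auto
        also have "\<dots> \<le> (\<integral>\<^sup>+x. (\<integral>\<^sup>+t. ennreal (B' * norm (indicator (cball 0 (R' + norm h)) x *\<^sub>R u x)) \<partial>unit_interval) \<partial>lborel)"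
        proof (rule nn_integral_mono, rule nn_integral_mono_AE, rule AE_unit_intervalI)
          fix x :: "real ^ 'n" and t :: real
          assume t: "0 \<le> t" "t \<le> 1"
          show "ennreal (norm (u x * - D (x + t *\<^sub>R - h))) \<le> ennreal (B' * norm (indicator (cball 0 (R' + norm h)) x *\<^sub>R u x))"
          proof (cases "x \<in> cball 0 (R' + norm h)")
            case True
            then show ?thesis using mult_right_mono[OF B'[of "x + t *\<^sub>R - h"], of "\<bar>u x\<bar>"]
              by (auto simp: abs_mult mult.commute[of "\<bar>u x\<bar>"] intro!: ennreal_leI)
          next
            case False
            have "norm x \<le> norm (x + t *\<^sub>R - h) + norm (t *\<^sub>R h)"
              using norm_triangle_ineq[of "x + t *\<^sub>R - h" "t *\<^sub>R h"] by simp
            moreover have "norm (t *\<^sub>R h) \<le> norm h" using t by (simp add: mult_left_le_one_le)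
            ultimately have "x + t *\<^sub>R - h \<notin> K'" using False R' by (auto simp del: norm_scaleR)
            then show ?thesis using K'(2) by simp
          qed
        qed
        also have "\<dots> = (\<integral>\<^sup>+x. norm (B' * norm (indicator (cball 0 (R' + norm h)) x *\<^sub>R u x)) \<partial>lborel)"
          using B'[of 0] by (simp add: nn_integral_unit_const abs_mult)
        also have "\<dots> < \<infinity>"
        proof -
          have "integrable lborel (\<lambda>x. B' * norm (indicator (cball 0 (R' + norm h)) x *\<^sub>R u x))"
            using u unfolding locally_integrable_def set_integrable_def
            by (intro integrable_mult_right integrable_norm) simp
          then show ?thesis by (simp only: integrable_iff_bounded)
        qed
        finally show "(\<integral>\<^sup>+z. norm (case z of (x, t) \<Rightarrow> u x * - D (x + t *\<^sub>R - h)) \<partial>(lborel \<Otimes>\<^sub>M unit_interval)) < \<infinity>" .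
      qed measurable
    qed
    also have "\<dots> = (LINT t|unit_interval. (LINT x|lborel. \<phi> x * \<gamma> (x + t *\<^sub>R h)))"
    proof (rule Bochner_Integration.integral_cong[OF refl])
      fix t
      have "(LINT x|lborel. u x * D (x + t *\<^sub>R - h)) = - (LINT x|lborel. \<gamma> x * \<phi> (x + t *\<^sub>R - h))"
        unfolding D_def directional_derivative_translate[OF \<phi>, symmetric] by (rule weak[OF \<phi>t])
      also have "(LINT x|lborel. \<gamma> x * \<phi> (x + t *\<^sub>R - h)) = (LINT x|lborel. \<phi> x * \<gamma> (x + t *\<^sub>R h))"
        using integral_lborel_translate[of "\<lambda>x. \<gamma> x * \<phi> (x + t *\<^sub>R - h)" "t *\<^sub>R h"] by (simp add: mult.commute)
      finally show "(LINT x|lborel. u x * - D (x + t *\<^sub>R - h)) = (LINT x|lborel. \<phi> x * \<gamma> (x + t *\<^sub>R h))" by simp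
    qed
    also have "\<dots> = (LINT x|lborel. (LINT t|unit_interval. \<phi> x * \<gamma> (x + t *\<^sub>R h)))"
      using K(2) subsetD[OF R] B
      by (intro lborel_unit.Fubini_integral integrable_pair_translate[OF \<gamma>, where B=B and R=R]) (simp_all, blast)
    also have "\<dots> = (LINT x|lborel. ?I x * \<phi> x)" by (simp add: mult.commute)
    finally have "(LINT x|lborel. u (x + h) * \<phi> x) - (LINT x|lborel. u x * \<phi> x) = (LINT x|lborel. ?I x * \<phi> x)" .
    then show "(LINT x|lborel. (u (x + h) - u x - ?I x) * \<phi> x) = 0"
      using locally_integrable_mult_test[OF uh \<phi>] locally_integrable_mult_test[OF u \<phi>] locally_integrable_mult_test[OF li \<phi>]
      by (simp add: left_diff_distrib)
  qed
  then show ?thesis by eventually_elim simp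
qed

text \<open>Cauchy-Schwarz against the constant 1 on a measure of total mass 1. If \<open>G\<close>
  is not integrable, the left side is 0 by default.\<close>

lemma square_line_integral_le:
  assumes [measurable]: "G \<in> borel_measurable borel"
  shows "ennreal ((LINT t|unit_interval. G t)\<^sup>2) \<le> (\<integral>\<^sup>+t. ennreal ((G t)\<^sup>2) \<partial>unit_interval)"
proof (cases "integrable unit_interval G")
  case True
  have "ennreal \<bar>LINT t|unit_interval. G t\<bar> \<le> (\<integral>\<^sup>+t. ennreal \<bar>G t\<bar> \<partial>unit_interval)"
    using integral_norm_bound_ennreal[OF True] by simp
  then have "(ennreal \<bar>LINT t|unit_interval. G t\<bar>)\<^sup>2 \<le> (\<integral>\<^sup>+t. ennreal \<bar>G t\<bar> * 1 \<partial>unit_interval)\<^sup>2"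
    by (simp add: power_mono)
  also have "\<dots> \<le> (\<integral>\<^sup>+t. (ennreal \<bar>G t\<bar>)\<^sup>2 \<partial>unit_interval) * (\<integral>\<^sup>+t. 1\<^sup>2 \<partial>unit_interval)"
    by (rule Cauchy_Schwarz_nn_integral) auto
  finally show ?thesis by (simp add: ennreal_power)
qed (simp add: not_integrable_integral_eq)

text \<open>Cauchy-Schwarz on each segment, followed by averaging over translates.
  \<open>\<Gamma>\<close> will be a derivative in direction \<open>h\<close>, so the factor
  \<open>(norm h)^2\<close> is hidden in it.\<close>

lemma translation_bound:
  fixes v \<Gamma> :: "real ^ 'n::finite \<Rightarrow> real"
  assumes [measurable]: "v \<in> borel_measurable borel" "\<Gamma> \<in> borel_measurable borel"
    and inc: "AE x in lborel. v (x + h) - v x = (LINT t|unit_interval. \<Gamma> (x + t *\<^sub>R h))"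
  shows "(\<integral>\<^sup>+x. ennreal ((v (x + h) - v x)\<^sup>2) \<partial>lborel) \<le> (\<integral>\<^sup>+x. ennreal ((\<Gamma> x)\<^sup>2) \<partial>lborel)"
proof -
  have "(\<integral>\<^sup>+x. ennreal ((v (x + h) - v x)\<^sup>2) \<partial>lborel)
      \<le> (\<integral>\<^sup>+x. (\<integral>\<^sup>+t. ennreal ((\<Gamma> (x + t *\<^sub>R h))\<^sup>2) \<partial>unit_interval) \<partial>lborel)"
  proof (rule nn_integral_mono_AE, use inc in eventually_elim)
    case (elim x)
    show ?case unfolding elim by (rule square_line_integral_le) measurable
  qed
  also have "\<dots> = (\<integral>\<^sup>+x. ennreal ((\<Gamma> x)\<^sup>2) \<partial>lborel)"
    using pair_nn_integral_translate[of "\<lambda>x. ennreal ((\<Gamma> x)\<^sup>2)" h] by simp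
  finally show ?thesis .
qed

text \<open>The substitution s -> s t. It degenerates at \<open>t = 0\<close>, where the right side
  lives on a single point. The half-line \<open>{..t}\<close> can stand for [0,t] because the
  measure is carried by [0,1].\<close>

lemma integral_unit_interval_initial_segment:
  fixes G :: "real \<Rightarrow> real"
  assumes [measurable]: "G \<in> borel_measurable borel" and t: "0 \<le> t" "t \<le> 1"
  shows "(LINT s|unit_interval. t * G (s * t)) = (LINT s|unit_interval. indicator {..t} s * G s)"
proof (cases "t = 0")
  case True
  have "AE s in unit_interval. s \<noteq> 0"
    unfolding AE_unit_interval using AE_lborel_singleton[of "0::real"] by eventually_elim simp
  moreover have "AE s in unit_interval. 0 \<le> s"
    by (rule AE_unit_intervalI)
  ultimately have "AE s in unit_interval. indicator {..0} s * G s = 0"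
    by eventually_elim simp
  then have "(LINT s|unit_interval. indicator {..0} s * G s) = (LINT s|unit_interval. 0)"
    by (intro integral_cong_AE) auto
  then show ?thesis using True by simp
next
  case False
  then have t0: "t > 0" using t by simp
  have "(LINT s|unit_interval. indicator {..t} s * G s) = (LINT s|lborel. indicator {0..t} s * G s)"
    using t by (subst integral_unit_interval) (auto intro!: Bochner_Integration.integral_cong simp: indicator_def)
  also have "\<dots> = \<bar>t\<bar> *\<^sub>R (LINT s|lborel. indicator {0..t} (0 + t * s) * G (0 + t * s))"
    by (rule lborel_integral_real_affine[OF False])
  also have "\<dots> = (LINT s|lborel. t * (indicator {0..1} s * G (s * t)))"
    using t0 by (subst integral_mult_right_zero)
      (auto intro!: arg_cong[where f="\<lambda>x. t * x"] Bochner_Integration.integral_cong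
        simp: indicator_def mult.commute zero_le_mult_iff)
  also have "\<dots> = (LINT s|lborel. indicator {0..1} s * (t * G (s * t)))"
    by (simp add: mult.left_commute)
  finally have *: "(LINT s|unit_interval. indicator {..t} s * G s) = (LINT s|lborel. indicator {0..1} s * (t * G (s * t)))" .
  have "(LINT s|unit_interval. t * G (s * t)) = (LINT s|lborel. indicator {0..1} s * (t * G (s * t)))"
    by (rule integral_unit_interval) measurable
  then show ?thesis by (simp only: *)
qed

text \<open>The unit square is cut along its diagonal, and the two triangles contribute equally by
  the symmetry of G(t) G(s).\<close>

lemma square_integral_eq_triangle:
  fixes G :: "real \<Rightarrow> real"
  assumes G: "integrable unit_interval G"
  shows "(LINT t|unit_interval. G t)\<^sup>2 =
    2 * (LINT t|unit_interval. G t * (LINT s|unit_interval. indicator {..t} s * G s))"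
proof -
  have [measurable]: "G \<in> borel_measurable borel"
    using G by (auto simp: integrable_iff_bounded)
  have GG: "integrable (unit_interval \<Otimes>\<^sub>M unit_interval) (\<lambda>(t, s). G t * G s)"
  proof (rule integrableI_bounded)
    have "(\<integral>\<^sup>+z. norm (case z of (t, s) \<Rightarrow> G t * G s) \<partial>(unit_interval \<Otimes>\<^sub>M unit_interval))
      = (\<integral>\<^sup>+t. (\<integral>\<^sup>+s. norm (G t * G s) \<partial>unit_interval) \<partial>unit_interval)"
      by (subst unit_interval.nn_integral_fst[symmetric]) auto
    also have "\<dots> = (\<integral>\<^sup>+t. norm (G t) \<partial>unit_interval) * (\<integral>\<^sup>+s. norm (G s) \<partial>unit_interval)"
      by (simp add: abs_mult ennreal_mult' nn_integral_cmult nn_integral_multc)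
    also have "\<dots> < \<infinity>" using G by (simp add: integrable_iff_bounded ennreal_mult_less_top)
    finally show "(\<integral>\<^sup>+z. norm (case z of (t, s) \<Rightarrow> G t * G s) \<partial>(unit_interval \<Otimes>\<^sub>M unit_interval)) < \<infinity>" .
  qed measurable
  have T1: "integrable (unit_interval \<Otimes>\<^sub>M unit_interval) (\<lambda>(t, s). G t * (indicator {..t} s * G s))"
    by (rule Bochner_Integration.integrable_bound[OF GG]) (auto simp: indicator_def split: prod.splits)
  have T2: "integrable (unit_interval \<Otimes>\<^sub>M unit_interval) (\<lambda>(t, s). G t * (indicator {t<..} s * G s))"
    by (rule Bochner_Integration.integrable_bound[OF GG]) (auto simp: indicator_def split: prod.splits)
  let ?J = "LINT t|unit_interval. (LINT s|unit_interval. G t * (indicator {..t} s * G s))"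
  have "(LINT t|unit_interval. G t)\<^sup>2 = (LINT t|unit_interval. (LINT s|unit_interval. G t * G s))"
    by (simp add: power2_eq_square)
  also have "\<dots> = integral\<^sup>L (unit_interval \<Otimes>\<^sub>M unit_interval) (\<lambda>(t, s). G t * G s)"
    by (rule unit_unit.integral_fst[OF GG])
  also have "\<dots> = integral\<^sup>L (unit_interval \<Otimes>\<^sub>M unit_interval) (\<lambda>z. (case z of (t, s) \<Rightarrow> G t * (indicator {..t} s * G s))
      + (case z of (t, s) \<Rightarrow> G t * (indicator {t<..} s * G s)))"
    by (intro Bochner_Integration.integral_cong) (auto simp: indicator_def)
  also have "\<dots> = integral\<^sup>L (unit_interval \<Otimes>\<^sub>M unit_interval) (\<lambda>(t, s). G t * (indicator {..t} s * G s))
      + integral\<^sup>L (unit_interval \<Otimes>\<^sub>M unit_interval) (\<lambda>(t, s). G t * (indicator {t<..} s * G s))"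
    by (rule Bochner_Integration.integral_add[OF T1 T2])
  also have "integral\<^sup>L (unit_interval \<Otimes>\<^sub>M unit_interval) (\<lambda>(t, s). G t * (indicator {..t} s * G s)) = ?J"
    by (rule unit_unit.integral_fst[OF T1, symmetric])
  also have "integral\<^sup>L (unit_interval \<Otimes>\<^sub>M unit_interval) (\<lambda>(t, s). G t * (indicator {t<..} s * G s))
      = (LINT s|unit_interval. (LINT t|unit_interval. G t * (indicator {t<..} s * G s)))"
    by (rule unit_unit.integral_snd[OF T2, symmetric])
  also have "\<dots> = ?J"
  \<comment> \<open>After the order is exchanged, the two integrands differ only on the diagonal
    \<open>t = s\<close>, a null set for each fixed \<open>s\<close>.\<close>
  proof (rule Bochner_Integration.integral_cong[OF refl], rule integral_cong_AE)
    fix s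
    have "AE t in unit_interval. t \<noteq> s"
      unfolding AE_unit_interval using AE_lborel_singleton[of s] by eventually_elim simp
    then show "AE t in unit_interval. G t * (indicator {t<..} s * G s) = G s * (indicator {..s} t * G t)"
      by eventually_elim (auto simp: indicator_def)
    show "(\<lambda>t. G t * (indicator {t<..} s * G s)) \<in> borel_measurable unit_interval"
      unfolding indicator_def greaterThan_iff by measurable
  qed measurable
  finally show ?thesis by simp
qed

text \<open>With \<open>G(t) = \<gamma>(x + t h)\<close> one has \<open>u(x + t h) = u(x) + \<integral>\<^sub>0\<^sup>t G\<close>, and the chain rule for \<open>u\<^sup>2\<close> reduces to
  the identity \<open>(\<integral> G)\<^sup>2 = 2 \<integral> G(t) \<integral>\<^sub>0\<^sup>t G\<close>.\<close>

lemma weak_derivative_square_increment: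
  fixes u \<gamma> :: "real ^ 'n::finite \<Rightarrow> real"
  assumes u: "locally_integrable u" and \<gamma>: "locally_integrable \<gamma>"
    and weak: "\<And>\<phi>. test_function \<phi> \<Longrightarrow>
      (LINT x|lborel. u x * directional_derivative h \<phi> x) = - (LINT x|lborel. \<gamma> x * \<phi> x)"
    and L2: "(\<integral>\<^sup>+x. ennreal ((\<gamma> x)\<^sup>2) \<partial>lborel) < \<infinity>"
  shows "AE x in lborel. (u (x + h))\<^sup>2 - (u x)\<^sup>2 =
    (LINT t|unit_interval. 2 * (u (x + t *\<^sub>R h) * \<gamma> (x + t *\<^sub>R h)))"
proof -
  note [measurable] = locally_integrable_measurable[OF u] locally_integrable_measurable[OF \<gamma>]
  have inc1: "AE x in lborel. u (x + h) - u x = (LINT t|unit_interval. \<gamma> (x + t *\<^sub>R h))"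
    by (rule weak_derivative_increment[OF u \<gamma> weak])
  \<comment> \<open>In direction \<open>t h\<close> the weak derivative is
    \<open>t * \<gamma>\<close>, so the increment formula holds for every initial part of the
    segment.\<close>
  have inc: "AE x in lborel. u (x + t *\<^sub>R h) - u x = (LINT s|unit_interval. t * \<gamma> (x + (s * t) *\<^sub>R h))" for t
  proof -
    have "AE x in lborel. u (x + t *\<^sub>R h) - u x = (LINT s|unit_interval. t * \<gamma> (x + s *\<^sub>R t *\<^sub>R h))"
    proof (rule weak_derivative_increment[OF u])
      show "locally_integrable (\<lambda>x. t * \<gamma> x)"
        using \<gamma> unfolding locally_integrable_def by simp
      show "(LINT x|lborel. u x * directional_derivative (t *\<^sub>R h) \<phi> x) = - (LINT x|lborel. t * \<gamma> x * \<phi> x)"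
        if "test_function \<phi>" for \<phi>
        using weak[OF that] by (simp add: directional_derivative_scaleR mult.assoc mult.left_commute[of _ t])
    qed
    then show ?thesis by simp
  qed
  have "AE t in unit_interval. AE x in lborel. u (x + t *\<^sub>R h) - u x = (LINT s|unit_interval. t * \<gamma> (x + (s * t) *\<^sub>R h))"
    using inc by simp
  \<comment> \<open>The null set of \<open>x\<close> depends on \<open>t\<close>. Fubini for null
    sets reverses the quantifiers, so that almost every \<open>x\<close> has the formula for almost
    every \<open>t\<close> on its segment.\<close>
  then have "AE x in lborel. AE t in unit_interval. u (x + t *\<^sub>R h) - u x = (LINT s|unit_interval. t * \<gamma> (x + (s * t) *\<^sub>R h))"
    by (subst lborel_unit.AE_commute) measurable
  moreover have "AE x in lborel. integrable unit_interval (\<lambda>t. \<gamma> (x + t *\<^sub>R h))"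
  proof -
    have "(\<integral>\<^sup>+x. (\<integral>\<^sup>+t. ennreal ((\<gamma> (x + t *\<^sub>R h))\<^sup>2) \<partial>unit_interval) \<partial>lborel) \<noteq> \<infinity>"
      using pair_nn_integral_translate[of "\<lambda>x. ennreal ((\<gamma> x)\<^sup>2)" h] L2 by simp
    then have "AE x in lborel. (\<integral>\<^sup>+t. ennreal ((\<gamma> (x + t *\<^sub>R h))\<^sup>2) \<partial>unit_interval) \<noteq> \<infinity>"
      by (rule nn_integral_PInf_AE[rotated]) measurable
    then show ?thesis
    proof eventually_elim
      case (elim x)
      \<comment> \<open>On a finite measure, square integrability gives integrability through |a| <=
        1 + a^2.\<close>
      have "integrable unit_interval (\<lambda>t. 1 + (\<gamma> (x + t *\<^sub>R h))\<^sup>2)"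
        using elim by (intro Bochner_Integration.integrable_add) (auto simp: integrable_iff_bounded less_top)
      then show ?case
      proof (rule Bochner_Integration.integrable_bound)
        show "AE t in unit_interval. norm (\<gamma> (x + t *\<^sub>R h)) \<le> norm (1 + (\<gamma> (x + t *\<^sub>R h))\<^sup>2)"
        proof (rule AE_I2)
          fix t
          have "\<bar>a\<bar> \<le> 1 + a\<^sup>2" for a :: real
            using sum_squares_bound[of 1 "\<bar>a\<bar>"] zero_le_power2[of a] by simp
          then show "norm (\<gamma> (x + t *\<^sub>R h)) \<le> norm (1 + (\<gamma> (x + t *\<^sub>R h))\<^sup>2)"
            by (smt (verit) real_norm_def zero_le_power2)
        qed
      qed measurable
    qed
  qed
  ultimately show ?thesis using inc1
  proof eventually_elim
    case (elim x)
    define G where "G t = \<gamma> (x + t *\<^sub>R h)" for t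
    have G: "integrable unit_interval G" using elim(2) by (simp add: G_def[abs_def])
    have [measurable]: "G \<in> borel_measurable borel" unfolding G_def by measurable
    let ?S = "\<lambda>t. LINT s|unit_interval. indicator {..t} s * G s"
    have "AE t in unit_interval. 0 \<le> t \<and> t \<le> 1" by (rule AE_unit_intervalI) simp
    with elim(1) have uS: "AE t in unit_interval. u (x + t *\<^sub>R h) = u x + ?S t"
    proof eventually_elim
      case (elim t)
      then show ?case using integral_unit_interval_initial_segment[of G t] by (simp add: G_def)
    qed
    have S_le: "\<bar>?S t\<bar> \<le> (LINT s|unit_interval. \<bar>G s\<bar>)" for t
    proof -
      have "\<bar>?S t\<bar> \<le> (LINT s|unit_interval. \<bar>indicator {..t} s * G s\<bar>)" by (rule integral_abs_bound)
      also have "\<dots> \<le> (LINT s|unit_interval. \<bar>G s\<bar>)"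
        using G by (intro integral_mono' integrable_abs) (auto simp: indicator_def)
      finally show ?thesis .
    qed
    have GS: "integrable unit_interval (\<lambda>t. G t * ?S t)"
    proof (rule Bochner_Integration.integrable_bound)
      show "integrable unit_interval (\<lambda>t. (LINT s|unit_interval. \<bar>G s\<bar>) * G t)" using G by simp
      show "AE t in unit_interval. norm (G t * ?S t) \<le> norm ((LINT s|unit_interval. \<bar>G s\<bar>) * G t)"
        using mult_right_mono[OF S_le, of "\<bar>G _\<bar>"] by (intro AE_I2) (simp add: abs_mult mult.commute)
      show "(\<lambda>t. G t * ?S t) \<in> borel_measurable unit_interval"
        unfolding indicator_def atMost_iff by measurable
    qed
    have "(LINT t|unit_interval. 2 * (u (x + t *\<^sub>R h) * \<gamma> (x + t *\<^sub>R h)))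
        = (LINT t|unit_interval. 2 * (u x * G t + G t * ?S t))"
    proof (rule integral_cong_AE)
      show "AE t in unit_interval. 2 * (u (x + t *\<^sub>R h) * \<gamma> (x + t *\<^sub>R h)) = 2 * (u x * G t + G t * ?S t)"
        using uS by eventually_elim (simp add: G_def algebra_simps)
      show "(\<lambda>t. 2 * (u x * G t + G t * ?S t)) \<in> borel_measurable unit_interval"
        by (intro borel_measurable_times borel_measurable_add borel_measurable_const
            borel_measurable_integrable[OF GS] borel_measurable_integrable[OF G])
    qed measurable
    also have "\<dots> = 2 * (u x * (LINT t|unit_interval. G t) + (LINT t|unit_interval. G t * ?S t))"
      using G GS by simp
    also have "\<dots> = (u x + (LINT t|unit_interval. G t))\<^sup>2 - (u x)\<^sup>2"
      using square_integral_eq_triangle[OF G] by (simp add: power2_sum)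
    also have "u x + (LINT t|unit_interval. G t) = u (x + h)"
      using elim(3) by (simp add: G_def)
    finally show ?case by simp
  qed
qed

section \<open>A Gagliardo-Nirenberg inequality from translation estimates\<close>

text \<open>The part of the value \<open>s\<close> lying between the levels \<open>a\<close> and
  \<open>2 * a\<close>. For \<open>a >= 0\<close> it is 0 below \<open>a\<close> and saturates at
  \<open>a\<close>; over dyadic levels the layers telescope.\<close>

definition layer :: "real \<Rightarrow> real \<Rightarrow> real" where
  "layer a s = min s (2 * a) - min s a"

lemma layer_mono: "a \<ge> 0 \<Longrightarrow> s' \<le> s \<Longrightarrow> layer a s' \<le> layer a s"
  by (auto simp: layer_def min_def)

lemma layer_low: "a \<ge> 0 \<Longrightarrow> s \<le> a \<Longrightarrow> layer a s = 0"
  by (auto simp: layer_def min_def)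

lemma layer_high: "a \<ge> 0 \<Longrightarrow> 2 * a \<le> s \<Longrightarrow> layer a s = a"
  by (auto simp: layer_def min_def)

lemma measurable_layer [measurable]:
  assumes [measurable]: "v \<in> borel_measurable M"
  shows "(\<lambda>x. layer a (v x)) \<in> borel_measurable M"
  unfolding layer_def by measurable

lemma sum_layer: "(\<Sum>j<J. layer (l * 2 ^ j) s) = min s (l * 2 ^ J) - min s l"
  by (induction J) (auto simp: layer_def)

text \<open>Layers are monotone, so their increments share one sign and add up to at most |s - s'|.
  For numbers of one sign the sum of squares is at most the square of the sum. No factor
  \<open>J\<close> appears, which lets the number of levels grow.\<close>

lemma sum_layer_squares_le:
  assumes l: "l > 0"
  shows "(\<Sum>j<J. (layer (l * 2 ^ j) s - layer (l * 2 ^ j) s')\<^sup>2) \<le> (s - s')\<^sup>2"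
proof -
  have *: "(\<Sum>j<J. (layer (l * 2 ^ j) s - layer (l * 2 ^ j) s')\<^sup>2) \<le> (s - s')\<^sup>2" if "s' \<le> s" for s s'
  proof -
    define d where "d j = layer (l * 2 ^ j) s - layer (l * 2 ^ j) s'" for j
    have d0: "0 \<le> d j" for j unfolding d_def using layer_mono[OF _ that, of "l * 2 ^ j"] l by simp
    have S: "(\<Sum>j<J. d j) \<le> s - s'"
      unfolding d_def sum_subtractf sum_layer using that by (auto simp: min_def)
    have "(\<Sum>j<J. (d j)\<^sup>2) \<le> (\<Sum>j<J. d j * (\<Sum>i<J. d i))"
      unfolding power2_eq_square using d0 by (intro sum_mono mult_left_mono member_le_sum) auto
    also have "\<dots> = (\<Sum>j<J. d j)\<^sup>2" by (simp add: power2_eq_square sum_distrib_right)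
    also have "\<dots> \<le> (s - s')\<^sup>2" using S d0 by (intro power_mono sum_nonneg) auto
    finally show ?thesis unfolding d_def .
  qed
  show ?thesis
    using *[of s' s] *[of s s'] by (cases "s' \<le> s") (simp_all add: power2_commute)
qed

section \<open>Level sets estimated through increments\<close>

lemma nn_integral_translate:
  fixes f :: "'a::euclidean_space \<Rightarrow> ennreal"
  assumes "f \<in> borel_measurable borel"
  shows "(\<integral>\<^sup>+x. f (x + t) \<partial>lborel) = (\<integral>\<^sup>+x. f x \<partial>lborel)"
  using nn_integral_lborel_affine[OF assms, of 1 t] by (simp add: one_ennreal_def[symmetric])

text \<open>The increment by \<open>n h\<close> is split into \<open>n\<close> steps by
  \<open>h\<close>. Cauchy-Schwarz costs one factor \<open>n\<close>, and the \<open>n\<close> steps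
  have equal integrals by translation invariance.\<close>

lemma nn_integral_iterated_increment:
  fixes w :: "'a::euclidean_space \<Rightarrow> real"
  assumes [measurable]: "w \<in> borel_measurable borel"
  shows "(\<integral>\<^sup>+x. ennreal ((w (x + real n *\<^sub>R h) - w x)\<^sup>2) \<partial>lborel)
    \<le> ennreal ((real n)\<^sup>2) * (\<integral>\<^sup>+x. ennreal ((w (x + h) - w x)\<^sup>2) \<partial>lborel)"
proof -
  let ?d = "\<lambda>k x. w (x + real (Suc k) *\<^sub>R h) - w (x + real k *\<^sub>R h)"
  let ?I = "\<integral>\<^sup>+x. ennreal ((w (x + h) - w x)\<^sup>2) \<partial>lborel"
  have "(w (x + real n *\<^sub>R h) - w x)\<^sup>2 \<le> (\<Sum>k<n. real n * (?d k x)\<^sup>2)" for x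
  proof -
    have "w (x + real n *\<^sub>R h) - w x = (\<Sum>k<n. ?d k x)"
      using sum_lessThan_telescope[of "\<lambda>k. w (x + real k *\<^sub>R h)" n] by simp
    then show ?thesis
      using sum_squared_le_sum_of_squares[of "\<lambda>k. ?d k x" "{..<n}"]
      by (simp add: sum_distrib_left mult.commute)
  qed
  then have "(\<integral>\<^sup>+x. ennreal ((w (x + real n *\<^sub>R h) - w x)\<^sup>2) \<partial>lborel)
      \<le> (\<integral>\<^sup>+x. (\<Sum>k<n. ennreal (real n) * ennreal ((?d k x)\<^sup>2)) \<partial>lborel)"
    by (intro nn_integral_mono) (simp add: ennreal_mult[symmetric] sum_ennreal ennreal_leI)
  also have "\<dots> = (\<Sum>k<n. ennreal (real n) * (\<integral>\<^sup>+x. ennreal ((?d k x)\<^sup>2) \<partial>lborel))"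
    by (simp add: nn_integral_sum nn_integral_cmult)
  also have "\<dots> = (\<Sum>k<n. ennreal (real n) * ?I)"
  proof (intro sum.cong refl arg_cong[where f="\<lambda>z. ennreal (real n) * z"])
    fix k
    show "(\<integral>\<^sup>+x. ennreal ((?d k x)\<^sup>2) \<partial>lborel) = ?I"
      using nn_integral_translate[of "\<lambda>x. ennreal ((w (x + h) - w x)\<^sup>2)" "real k *\<^sub>R h"]
      by (simp add: algebra_simps)
  qed
  also have "\<dots> = ennreal ((real n)\<^sup>2) * ?I"
    by (simp add: power2_eq_square ennreal_mult mult.assoc ennreal_of_nat_eq_real_of_nat)
  finally show ?thesis .
qed

lemma emeasure_cube:
  assumes "\<rho> \<ge> 0"
  shows "emeasure lborel (cbox 0 (\<rho> *\<^sub>R One) :: 'a::euclidean_space set) = ennreal (\<rho> ^ DIM('a))"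
  using assms by (subst emeasure_lborel_cbox) auto

lemma norm_le_cube:
  assumes "h \<in> cbox 0 (\<rho> *\<^sub>R One :: 'a::euclidean_space)"
  shows "(norm h)\<^sup>2 \<le> real DIM('a) * \<rho>\<^sup>2"
proof -
  have "(norm h)\<^sup>2 = (\<Sum>b\<in>Basis. (h \<bullet> b)\<^sup>2)"
    unfolding power2_norm_eq_inner by (subst euclidean_inner) (simp add: power2_eq_square)
  also have "\<dots> \<le> (\<Sum>b\<in>(Basis :: 'a set). \<rho>\<^sup>2)"
    using assms by (intro sum_mono power_mono) (auto simp: mem_box)
  finally show ?thesis by simp
qed

text \<open>A translate of a point with \<open>v \<ge> 2 a\<close> by \<open>n h\<close>, where \<open>h\<close> runs through a cube such
  that \<open>n h\<close> covers a volume of at least twice that of \<open>{v > a}\<close>, leaves \<open>{v > a}\<close> at least half of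
  the time.\<close>

lemma level_set_le_increments:
  fixes v :: "'a::euclidean_space \<Rightarrow> real"
  assumes [measurable]: "v \<in> borel_measurable borel"
    and a: "a > 0" and \<rho>: "\<rho> > 0" and n: "n \<ge> 1"
    and E: "emeasure lborel {x. a < v x} \<le> ennreal ((real n * \<rho>) ^ DIM('a) / 2)"
  shows "ennreal (a\<^sup>2 * (\<rho> ^ DIM('a) / 2)) * emeasure lborel {x. 2 * a \<le> v x}
    \<le> (\<integral>\<^sup>+h. indicator (cbox 0 (\<rho> *\<^sub>R One)) h *
        (\<integral>\<^sup>+x. ennreal ((layer a (v (x + real n *\<^sub>R h)) - layer a (v x))\<^sup>2) \<partial>lborel) \<partial>lborel)"
proof -
  let ?Q = "cbox 0 (\<rho> *\<^sub>R One) :: 'a set"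
  let ?f = "\<lambda>x h. ennreal ((layer a (v (x + real n *\<^sub>R h)) - layer a (v x))\<^sup>2)"
  have [measurable]: "?Q \<in> sets borel" by (simp add: borel_closed)
  have "ennreal (a\<^sup>2 * (\<rho> ^ DIM('a) / 2)) * emeasure lborel {x. 2 * a \<le> v x}
      = (\<integral>\<^sup>+x. ennreal (a\<^sup>2 * (\<rho> ^ DIM('a) / 2)) * indicator {x. 2 * a \<le> v x} x \<partial>lborel)"
    by (simp add: nn_integral_cmult)
  also have "\<dots> \<le> (\<integral>\<^sup>+x. (\<integral>\<^sup>+h. indicator ?Q h * ?f x h \<partial>lborel) \<partial>lborel)"
  proof (rule nn_integral_mono)
    fix x :: 'a
    show "ennreal (a\<^sup>2 * (\<rho> ^ DIM('a) / 2)) * indicator {x. 2 * a \<le> v x} x \<le> (\<integral>\<^sup>+h. indicator ?Q h * ?f x h \<partial>lborel)"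
    proof (cases "2 * a \<le> v x")
      case True
      let ?B = "{h. a < v (x + real n *\<^sub>R h)}"
      have [measurable]: "?B \<in> sets borel" by measurable
      \<comment> \<open>The map h -> n h + x scales volume by n^N, so the bad increments fill at
        most half of the cube.\<close>
      have "emeasure lborel ?B = (\<integral>\<^sup>+h. indicator {y. a < v y} (real n *\<^sub>R h + x) \<partial>lborel)"
      proof -
        have "emeasure lborel ?B = (\<integral>\<^sup>+h. indicator ?B h \<partial>lborel)" by simp
        also have "\<dots> = (\<integral>\<^sup>+h. indicator {y. a < v y} (real n *\<^sub>R h + x) \<partial>lborel)"
          by (intro nn_integral_cong) (simp add: indicator_def add.commute)
        finally show ?thesis .
      qed
      also have "\<dots> = ennreal (1 / real n ^ DIM('a)) * emeasure lborel {y. a < v y}"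
        using n by (subst nn_integral_lborel_affine) auto
      also have "\<dots> \<le> ennreal (1 / real n ^ DIM('a)) * ennreal ((real n * \<rho>) ^ DIM('a) / 2)"
        by (intro mult_left_mono E) simp
      also have "\<dots> = ennreal (\<rho> ^ DIM('a) / 2)"
        using n \<rho> by (simp add: ennreal_mult[symmetric] power_mult_distrib)
      finally have B: "emeasure lborel ?B \<le> ennreal (\<rho> ^ DIM('a) / 2)" .
      have "ennreal (\<rho> ^ DIM('a)) = emeasure lborel ?Q" using \<rho> by (simp add: emeasure_cube)
      also have "\<dots> \<le> emeasure lborel ((?Q - ?B) \<union> ?B)" by (intro emeasure_mono) auto
      also have "\<dots> \<le> emeasure lborel (?Q - ?B) + emeasure lborel ?B" by (intro emeasure_subadditive) auto
      also have "\<dots> \<le> emeasure lborel (?Q - ?B) + ennreal (\<rho> ^ DIM('a) / 2)" by (intro add_left_mono B)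
      finally have half: "ennreal (\<rho> ^ DIM('a) / 2) \<le> emeasure lborel (?Q - ?B)"
        using \<rho> by (cases "emeasure lborel (?Q - ?B)") (auto simp: ennreal_plus[symmetric] simp del: ennreal_plus)
      have "ennreal (a\<^sup>2 * (\<rho> ^ DIM('a) / 2)) * indicator {x. 2 * a \<le> v x} x = ennreal (a\<^sup>2) * ennreal (\<rho> ^ DIM('a) / 2)"
        using True \<rho> by (simp add: ennreal_mult[symmetric])
      also have "\<dots> \<le> ennreal (a\<^sup>2) * emeasure lborel (?Q - ?B)" by (intro mult_left_mono half) simp
      also have "\<dots> = (\<integral>\<^sup>+h. ennreal (a\<^sup>2) * indicator (?Q - ?B) h \<partial>lborel)" by (simp add: nn_integral_cmult)
      \<comment> \<open>For a good increment the layer drops from its full height \<open>a\<close>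
        at \<open>x\<close> to 0 at the translate, so the integrand equals
        \<open>a^2\<close>.\<close>
      also have "\<dots> \<le> (\<integral>\<^sup>+h. indicator ?Q h * ?f x h \<partial>lborel)"
        using a True by (intro nn_integral_mono) (auto simp: indicator_def layer_low layer_high not_less)
      finally show ?thesis .
    qed simp
  qed
  also have "\<dots> = (\<integral>\<^sup>+h. (\<integral>\<^sup>+x. indicator ?Q h * ?f x h \<partial>lborel) \<partial>lborel)"
    by (rule lborel_pair.Fubini') measurable
  also have "\<dots> = (\<integral>\<^sup>+h. indicator ?Q h * (\<integral>\<^sup>+x. ?f x h \<partial>lborel) \<partial>lborel)"
    by (simp add: nn_integral_cmult)
  finally show ?thesis .
qed

text \<open>Chebyshev's inequality.\<close>

lemma emeasure_level_set_le:
  fixes v :: "'a::euclidean_space \<Rightarrow> real"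
  assumes [measurable]: "v \<in> borel_measurable borel"
    and M: "(\<integral>\<^sup>+x. ennreal (v x ^ r) \<partial>lborel) \<le> ennreal M" and a: "a > 0"
  shows "emeasure lborel {x. a < v x} \<le> ennreal (M / a ^ r)"
proof -
  have "ennreal (a ^ r) * emeasure lborel {x. a < v x} = (\<integral>\<^sup>+x. ennreal (a ^ r) * indicator {x. a < v x} x \<partial>lborel)"
    by (simp add: nn_integral_cmult)
  also have "\<dots> \<le> (\<integral>\<^sup>+x. ennreal (v x ^ r) \<partial>lborel)"
    using a by (intro nn_integral_mono) (auto simp: indicator_def intro!: ennreal_leI power_mono)
  also note M
  finally have "ennreal (1 / a ^ r) * (ennreal (a ^ r) * emeasure lborel {x. a < v x}) \<le> ennreal (1 / a ^ r) * ennreal M"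
    by (intro mult_left_mono) auto
  also have "ennreal (1 / a ^ r) * (ennreal (a ^ r) * emeasure lborel {x. a < v x}) = emeasure lborel {x. a < v x}"
    using a by (simp add: mult.assoc[symmetric] ennreal_mult[symmetric])
  finally show ?thesis using a by (simp add: ennreal_mult'[symmetric])
qed

text \<open>All levels use increments \<open>h\<close> from one common cube of side \<open>\<rho>\<close>: the multiple
  \<open>n h\<close> appropriate to a level costs a factor \<open>n\<^sup>2\<close>, and the squared increments of the layers add up
  to at most those of \<open>v\<close>. Hence the levels can be summed, which gives the strong-type bound.\<close>

lemma sum_level_sets_le:
  fixes v :: "'a::euclidean_space \<Rightarrow> real"
  defines "N \<equiv> real DIM('a)"
  assumes v [measurable]: "v \<in> borel_measurable borel"
    and M: "(\<integral>\<^sup>+x. ennreal (v x ^ r) \<partial>lborel) \<le> ennreal M" "M > 0"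
    and D: "\<And>h. (\<integral>\<^sup>+x. ennreal ((v (x + h) - v x)\<^sup>2) \<partial>lborel) \<le> ennreal ((norm h)\<^sup>2 * D)" "D \<ge> 0"
    and l: "l > 0"
  shows "(\<Sum>j<J. ennreal ((l * 2 ^ j) powr (2 + 2 * real r / N)) * emeasure lborel {x. 2 * (l * 2 ^ j) \<le> v x})
    \<le> ennreal (8 * N * (2 * M) powr (2 / N) * D)"
proof -
  let ?a = "\<lambda>j::nat. l * 2 ^ j"
  let ?N = "DIM('a)"
  have N: "N > 0" "real ?N = N" by (simp_all add: N_def)
  have a: "?a j > 0" for j using l by simp
  \<comment> \<open>Side of a cube whose volume is twice the Chebyshev bound for the level
    set.\<close>
  define R where "R j = (2 * M / ?a j ^ r) powr (1 / N)" for j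
  have R0: "R j > 0" for j using M(2) a[of j] l by (simp add: R_def)
  have RN: "R j ^ ?N = 2 * M / ?a j ^ r" for j
  proof -
    have "R j ^ ?N = R j powr N" using powr_realpow[OF R0, of j ?N] N by simp
    also have "\<dots> = 2 * M / ?a j ^ r" using N(1) M(2) l by (simp add: R_def powr_powr)
    finally show ?thesis .
  qed
  \<comment> \<open>This weight makes the cost of a level independent of the level; it is the origin
    of the exponent 2 + 2r/N.\<close>
  have R2: "?a j powr (2 * real r / N) * (R j)\<^sup>2 = (2 * M) powr (2 / N)" for j
  proof -
    have "(R j)\<^sup>2 = R j powr 2" using R0[of j] by simp
    also have "\<dots> = (2 * M / ?a j ^ r) powr (2 / N)" by (simp add: R_def powr_powr)
    also have "\<dots> = (2 * M) powr (2 / N) / (?a j ^ r) powr (2 / N)"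
      by (rule powr_divide)
    also have "(?a j ^ r) powr (2 / N) = ?a j powr (2 * real r / N)"
      using powr_realpow[OF a, of j r, symmetric] by (simp only: powr_powr) (simp add: mult.commute)
    finally show ?thesis using a[of j] l by simp
  qed
  \<comment> \<open>Any side below all \<open>R j\<close> serves, since \<open>\<rho>\<close>
    cancels in the end. The element 1 keeps the set nonempty when \<open>J = 0\<close>.\<close>
  define \<rho> where "\<rho> = Min (insert 1 (R ` {..<J}))"
  have \<rho>0: "\<rho> > 0" unfolding \<rho>_def using R0 by (subst Min_gr_iff) auto
  have \<rho>R: "\<rho> \<le> R j" if "j < J" for j unfolding \<rho>_def using that by (intro Min_le) auto
  let ?Q = "cbox 0 (\<rho> *\<^sub>R One) :: 'a set"
  have [measurable]: "?Q \<in> sets borel" by (simp add: borel_closed)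
  define X where "X j = (\<integral>\<^sup>+h. indicator ?Q h *
      (\<integral>\<^sup>+x. ennreal ((layer (?a j) (v (x + h)) - layer (?a j) (v x))\<^sup>2) \<partial>lborel) \<partial>lborel)" for j
  define C where "C = 8 * (2 * M) powr (2 / N) / \<rho> ^ (?N + 2)"
  have C0: "C \<ge> 0" using \<rho>0 by (simp add: C_def)
  have each: "ennreal (?a j powr (2 + 2 * real r / N)) * emeasure lborel {x. 2 * ?a j \<le> v x} \<le> ennreal C * X j"
    if j: "j < J" for j
  proof -
    \<comment> \<open>As \<open>R j / \<rho> >= 1\<close>, rounding up at most doubles it: the
      \<open>n\<close>-fold cube reaches side \<open>R j\<close>, and the cost \<open>n^2\<close> is
      at most 4 (R j / \<rho>)^2.\<close>
    define n where "n = nat \<lceil>R j / \<rho>\<rceil>"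
    have q1: "1 \<le> R j / \<rho>" using \<rho>R[OF j] \<rho>0 by simp
    have n1: "n \<ge> 1" using q1 unfolding n_def by linarith
    have nl: "R j / \<rho> \<le> real n" using q1 unfolding n_def by linarith
    have nu: "real n \<le> 2 * (R j / \<rho>)" using q1 unfolding n_def by linarith
    have "emeasure lborel {x. ?a j < v x} \<le> ennreal (M / ?a j ^ r)"
      by (rule emeasure_level_set_le[OF v M(1) a])
    also have "M / ?a j ^ r = R j ^ ?N / 2" by (simp add: RN)
    also have "ennreal (R j ^ ?N / 2) \<le> ennreal ((real n * \<rho>) ^ ?N / 2)"
      using nl \<rho>0 R0[of j] by (intro ennreal_leI divide_right_mono power_mono) (auto simp: field_simps)
    finally have E: "emeasure lborel {x. ?a j < v x} \<le> ennreal ((real n * \<rho>) ^ ?N / 2)" .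
    have "ennreal ((?a j)\<^sup>2 * (\<rho> ^ ?N / 2)) * emeasure lborel {x. 2 * ?a j \<le> v x}
      \<le> (\<integral>\<^sup>+h. indicator ?Q h *
        (\<integral>\<^sup>+x. ennreal ((layer (?a j) (v (x + real n *\<^sub>R h)) - layer (?a j) (v x))\<^sup>2) \<partial>lborel) \<partial>lborel)"
      by (rule level_set_le_increments[OF v a \<rho>0 n1 E])
    also have "\<dots> \<le> (\<integral>\<^sup>+h. indicator ?Q h * (ennreal ((real n)\<^sup>2) *
        (\<integral>\<^sup>+x. ennreal ((layer (?a j) (v (x + h)) - layer (?a j) (v x))\<^sup>2) \<partial>lborel)) \<partial>lborel)"
      by (intro nn_integral_mono mult_left_mono nn_integral_iterated_increment) auto
    also have "\<dots> = ennreal ((real n)\<^sup>2) * X j"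
      unfolding X_def by (subst nn_integral_cmult[symmetric]) (auto simp: mult.left_commute)
    also have "\<dots> \<le> ennreal (4 * (R j)\<^sup>2 / \<rho>\<^sup>2) * X j"
    proof (intro mult_right_mono ennreal_leI)
      have "(real n)\<^sup>2 \<le> (2 * (R j / \<rho>))\<^sup>2" using nu by (intro power_mono) auto
      then show "(real n)\<^sup>2 \<le> 4 * (R j)\<^sup>2 / \<rho>\<^sup>2" by (simp add: power_mult_distrib power_divide)
    qed simp
    finally have le: "ennreal ((?a j)\<^sup>2 * (\<rho> ^ ?N / 2)) * emeasure lborel {x. 2 * ?a j \<le> v x}
        \<le> ennreal (4 * (R j)\<^sup>2 / \<rho>\<^sup>2) * X j" .
    \<comment> \<open>Multiplying by this factor gives the level set its weight on the left and the
      common constant \<open>C\<close> on the right.\<close>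
    let ?c = "2 * ?a j powr (2 * real r / N) / \<rho> ^ ?N"
    have c0: "?c \<ge> 0" using \<rho>0 by simp
    have 1: "?c * ((?a j)\<^sup>2 * (\<rho> ^ ?N / 2)) = ?a j powr (2 + 2 * real r / N)"
      using \<rho>0 a[of j] by (simp add: powr_add)
    have "?c * (4 * (R j)\<^sup>2 / \<rho>\<^sup>2) = 8 * (?a j powr (2 * real r / N) * (R j)\<^sup>2) / \<rho> ^ (?N + 2)"
      using \<rho>0 by (simp add: power_add power2_eq_square)
    then have 2: "?c * (4 * (R j)\<^sup>2 / \<rho>\<^sup>2) = C" unfolding R2 C_def .
    have "ennreal ?c * (ennreal ((?a j)\<^sup>2 * (\<rho> ^ ?N / 2)) * emeasure lborel {x. 2 * ?a j \<le> v x})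
        \<le> ennreal ?c * (ennreal (4 * (R j)\<^sup>2 / \<rho>\<^sup>2) * X j)"
      by (intro mult_left_mono le) simp
    moreover have "ennreal ?c * (ennreal y * z) = ennreal (?c * y) * z" for y z
      by (simp only: ennreal_mult'[OF c0] mult.assoc)
    ultimately show ?thesis by (simp only: 1 2)
  qed
  have "(\<Sum>j<J. X j) = (\<integral>\<^sup>+h. (\<Sum>j<J. indicator ?Q h *
      (\<integral>\<^sup>+x. ennreal ((layer (?a j) (v (x + h)) - layer (?a j) (v x))\<^sup>2) \<partial>lborel)) \<partial>lborel)"
    unfolding X_def by (rule nn_integral_sum[symmetric]) measurable
  also have "\<dots> = (\<integral>\<^sup>+h. indicator ?Q h *
      (\<integral>\<^sup>+x. (\<Sum>j<J. ennreal ((layer (?a j) (v (x + h)) - layer (?a j) (v x))\<^sup>2)) \<partial>lborel) \<partial>lborel)"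
  proof (rule nn_integral_cong)
    fix h :: 'a
    have "(\<integral>\<^sup>+x. (\<Sum>j<J. ennreal ((layer (?a j) (v (x + h)) - layer (?a j) (v x))\<^sup>2)) \<partial>lborel)
        = (\<Sum>j<J. (\<integral>\<^sup>+x. ennreal ((layer (?a j) (v (x + h)) - layer (?a j) (v x))\<^sup>2) \<partial>lborel))"
      by (rule nn_integral_sum) measurable
    then show "(\<Sum>j<J. indicator ?Q h * (\<integral>\<^sup>+x. ennreal ((layer (?a j) (v (x + h)) - layer (?a j) (v x))\<^sup>2) \<partial>lborel))
      = indicator ?Q h * (\<integral>\<^sup>+x. (\<Sum>j<J. ennreal ((layer (?a j) (v (x + h)) - layer (?a j) (v x))\<^sup>2)) \<partial>lborel)"
      by (simp only: sum_distrib_left)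
  qed
  also have "\<dots> \<le> (\<integral>\<^sup>+h. ennreal (N * \<rho>\<^sup>2 * D) * indicator ?Q h \<partial>lborel)"
  proof (rule nn_integral_mono)
    fix h :: 'a
    show "indicator ?Q h * (\<integral>\<^sup>+x. (\<Sum>j<J. ennreal ((layer (?a j) (v (x + h)) - layer (?a j) (v x))\<^sup>2)) \<partial>lborel)
      \<le> ennreal (N * \<rho>\<^sup>2 * D) * indicator ?Q h"
    proof (cases "h \<in> ?Q")
      case True
      have "(\<integral>\<^sup>+x. (\<Sum>j<J. ennreal ((layer (?a j) (v (x + h)) - layer (?a j) (v x))\<^sup>2)) \<partial>lborel)
        \<le> (\<integral>\<^sup>+x. ennreal ((v (x + h) - v x)\<^sup>2) \<partial>lborel)"
        by (intro nn_integral_mono) (simp add: sum_ennreal ennreal_leI sum_layer_squares_le[OF l])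
      also note D(1)
      also have "ennreal ((norm h)\<^sup>2 * D) \<le> ennreal (N * \<rho>\<^sup>2 * D)"
        using norm_le_cube[OF True] D(2) N by (intro ennreal_leI mult_right_mono) auto
      finally show ?thesis using True by simp
    qed simp
  qed
  also have "\<dots> = ennreal (N * \<rho> ^ (?N + 2) * D)"
    using \<rho>0 D(2) N
    by (simp add: nn_integral_cmult emeasure_cube ennreal_mult'[symmetric] power_add power2_eq_square mult_ac)
  finally have X: "(\<Sum>j<J. X j) \<le> ennreal (N * \<rho> ^ (?N + 2) * D)" .
  have "(\<Sum>j<J. ennreal (?a j powr (2 + 2 * real r / N)) * emeasure lborel {x. 2 * ?a j \<le> v x})
      \<le> (\<Sum>j<J. ennreal C * X j)"
    by (intro sum_mono each) simp
  also have "\<dots> = ennreal C * (\<Sum>j<J. X j)" by (simp add: sum_distrib_left)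
  \<comment> \<open>Here the power \<open>\<rho> ^ (?N + 2)\<close> cancels against the denominator
    of \<open>C\<close>.\<close>
  also have "\<dots> \<le> ennreal C * ennreal (N * \<rho> ^ (?N + 2) * D)" by (intro mult_left_mono X) simp
  also have "\<dots> = ennreal (8 * N * (2 * M) powr (2 / N) * D)"
    unfolding ennreal_mult'[OF C0, symmetric]
    using \<rho>0 by (intro arg_cong[where f=ennreal]) (simp add: C_def)
  finally show ?thesis .
qed

lemma dyadic_level:
  fixes s l :: real
  assumes "2 * l \<le> s" "s < 2 * (l * 2 ^ J)"
  shows "\<exists>j<J. 2 * (l * 2 ^ j) \<le> s \<and> s < 4 * (l * 2 ^ j)"
  using assms
proof (induction J)
  case (Suc J)
  show ?case
  proof (cases "s < 2 * (l * 2 ^ J)")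
    case True
    with Suc show ?thesis using less_Suc_eq by blast
  next
    case False
    with Suc.prems show ?thesis by (intro exI[of _ J]) auto
  qed
qed simp

text \<open>The first factor comes from replacing \<open>v\<close> by four times the level on a
  dyadic slab, the second from summing the level sets.\<close>

definition gn_const :: "nat \<Rightarrow> nat \<Rightarrow> real" where
  "gn_const N r = 4 powr (2 + 2 * real r / real N) * (8 * real N * 2 powr (2 / real N))"

text \<open>On the slab where \<open>v\<close> lies between two and four times a dyadic level, its
  power is at most 4^q times that of the level, so the weighted sum over level sets controls the
  integral. The bound does not depend on the number of levels, hence monotone convergence removes
  the truncation of the values.\<close>

lemma gagliardo_nirenberg:
  fixes v :: "'a::euclidean_space \<Rightarrow> real"
  defines "N \<equiv> real DIM('a)"
  assumes v [measurable]: "v \<in> borel_measurable borel" and v0: "\<And>x. v x \<ge> 0"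
    and M: "(\<integral>\<^sup>+x. ennreal (v x ^ r) \<partial>lborel) \<le> ennreal M" "M > 0"
    and D: "\<And>h. (\<integral>\<^sup>+x. ennreal ((v (x + h) - v x)\<^sup>2) \<partial>lborel) \<le> ennreal ((norm h)\<^sup>2 * D)" "D \<ge> 0"
  shows "(\<integral>\<^sup>+x. ennreal (v x powr (2 + 2 * real r / N)) \<partial>lborel)
    \<le> ennreal (gn_const DIM('a) r * M powr (2 / N) * D)"
proof -
  define q where "q = 2 + 2 * real r / N"
  have q0: "q > 0" by (simp add: q_def N_def add_pos_nonneg)
  define A where "A k = {x. 2 / 2 ^ k \<le> v x \<and> v x < 2 * 2 ^ k}" for k :: nat
  have [measurable]: "A k \<in> sets borel" for k unfolding A_def by measurable
  let ?f = "\<lambda>k x. ennreal (v x powr q) * indicator (A k) x"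
  have A: "(\<integral>\<^sup>+x. ?f k x \<partial>lborel) \<le> ennreal (gn_const DIM('a) r * M powr (2 / N) * D)" for k
  proof -
    \<comment> \<open>Starting at 2^(-k), exactly \<open>2 * k\<close> doublings cover the range of
      values in \<open>A k\<close>.\<close>
    define l :: real where "l = 1 / 2 ^ k"
    have l: "l > 0" by (simp add: l_def)
    let ?a = "\<lambda>j::nat. l * 2 ^ j"
    have "(\<integral>\<^sup>+x. ?f k x \<partial>lborel) \<le> (\<integral>\<^sup>+x. (\<Sum>j<2 * k. ennreal (4 powr q) * (ennreal (?a j powr q) * indicator {x. 2 * ?a j \<le> v x} x)) \<partial>lborel)"
    proof (rule nn_integral_mono)
      fix x
      show "?f k x \<le> (\<Sum>j<2 * k. ennreal (4 powr q) * (ennreal (?a j powr q) * indicator {x. 2 * ?a j \<le> v x} x))"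
      proof (cases "x \<in> A k")
        case True
        moreover have "l * 2 ^ (2 * k) = 2 ^ k"
          by (simp add: l_def power_mult power2_eq_square power_mult_distrib mult.commute[of 2 k])
        ultimately have "2 * l \<le> v x" "v x < 2 * (l * 2 ^ (2 * k))"
          unfolding A_def mem_Collect_eq by (simp_all add: l_def)
        from dyadic_level[OF this] obtain j where j: "j < 2 * k" "2 * ?a j \<le> v x" "v x < 4 * ?a j" by blast
        have "v x powr q \<le> (4 * ?a j) powr q" using v0[of x] j(3) q0 by (intro powr_mono2) auto
        also have "\<dots> = 4 powr q * ?a j powr q" by (rule powr_mult)
        finally have "?f k x \<le> ennreal (4 powr q) * (ennreal (?a j powr q) * indicator {x. 2 * ?a j \<le> v x} x)"
          using True j(2) by (simp add: ennreal_mult'[symmetric] ennreal_leI)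
        also have "\<dots> \<le> (\<Sum>j<2 * k. ennreal (4 powr q) * (ennreal (?a j powr q) * indicator {x. 2 * ?a j \<le> v x} x))"
          using j(1) by (intro member_le_sum) auto
        finally show ?thesis .
      qed simp
    qed
    also have "\<dots> = ennreal (4 powr q) * (\<Sum>j<2 * k. ennreal (?a j powr q) * emeasure lborel {x. 2 * ?a j \<le> v x})"
      by (simp add: nn_integral_sum nn_integral_cmult sum_distrib_left)
    also have "\<dots> \<le> ennreal (4 powr q) * ennreal (8 * N * (2 * M) powr (2 / N) * D)"
      unfolding q_def N_def by (intro mult_left_mono sum_level_sets_le[OF v M D l]) simp
    also have "\<dots> = ennreal (gn_const DIM('a) r * M powr (2 / N) * D)"
      using M(2) by (simp add: ennreal_mult'[symmetric] gn_const_def q_def N_def powr_mult mult_ac)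
    finally show ?thesis .
  qed
  have "incseq ?f"
  proof (intro incseq_SucI le_funI)
    fix k x
    have "A k \<subseteq> A (Suc k)"
    proof
      fix y assume "y \<in> A k"
      then have "2 / 2 ^ k \<le> v y" "v y < 2 * 2 ^ k" by (auto simp: A_def)
      moreover have "2 / 2 ^ Suc k \<le> (2 / 2 ^ k :: real)" "(2 * 2 ^ k :: real) \<le> 2 * 2 ^ Suc k"
        by (simp_all add: field_simps)
      ultimately show "y \<in> A (Suc k)" unfolding A_def by simp
    qed
    then show "?f k x \<le> ?f (Suc k) x" by (auto simp: indicator_def)
  qed
  have "(\<integral>\<^sup>+x. ennreal (v x powr q) \<partial>lborel) \<le> (\<integral>\<^sup>+x. (SUP k. ?f k x) \<partial>lborel)"
  proof (rule nn_integral_mono)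
    fix x
    show "ennreal (v x powr q) \<le> (SUP k. ?f k x)"
    proof (cases "v x = 0")
      case False
      then have pos: "v x > 0" using v0[of x] by simp
      obtain k1 where k1: "2 / v x < 2 ^ k1" using real_arch_pow[of 2 "2 / v x"] by auto
      obtain k2 where k2: "v x < 2 ^ k2" using real_arch_pow[of 2 "v x"] by auto
      define k where "k = max k1 k2"
      have "(2::real) ^ k1 \<le> 2 ^ k" "(2::real) ^ k2 \<le> 2 ^ k" unfolding k_def by (auto intro: power_increasing)
      with k1 k2 have "2 / v x \<le> 2 ^ k" "v x < 2 ^ k" by linarith+
      then have "x \<in> A k" using pos by (auto simp: A_def field_simps)
      then show ?thesis by (intro SUP_upper2[of k]) auto
    qed simp
  qed
  also have "\<dots> = (SUP k. (\<integral>\<^sup>+x. ?f k x \<partial>lborel))"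
    by (rule nn_integral_monotone_convergence_SUP) (use \<open>incseq ?f\<close> in auto)
  also have "\<dots> \<le> ennreal (gn_const DIM('a) r * M powr (2 / N) * D)"
    by (intro SUP_least A)
  finally show ?thesis unfolding q_def .
qed

section \<open>Weak gradients\<close>

lemma locally_integrable_component:
  fixes g :: "real ^ 'n::finite \<Rightarrow> real ^ 'n"
  assumes "locally_integrable g"
  shows "locally_integrable (\<lambda>x. g x $ i)"
  unfolding locally_integrable_def set_integrable_def
proof (intro allI impI)
  fix K :: "(real ^ 'n) set" assume "compact K"
  then have "integrable lborel (\<lambda>x. indicator K x *\<^sub>R g x)"
    using assms unfolding locally_integrable_def set_integrable_def by blast
  from integrable_bounded_linear[OF bounded_linear_vec_nth this, of i]
  show "integrable lborel (\<lambda>x. indicator K x *\<^sub>R g x $ i)" by simp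
qed

lemma locally_integrable_cmult:
  fixes f :: "real ^ 'n::finite \<Rightarrow> 'b::{banach, second_countable_topology}"
  assumes "locally_integrable f"
  shows "locally_integrable (\<lambda>x. c *\<^sub>R f x)"
  using assms unfolding locally_integrable_def by (simp add: set_integrable_scaleR_right)

lemma locally_integrable_inner:
  fixes g :: "real ^ 'n::finite \<Rightarrow> real ^ 'n"
  assumes "locally_integrable g"
  shows "locally_integrable (\<lambda>x. g x \<bullet> h)"
  unfolding locally_integrable_def set_integrable_def
proof (intro allI impI)
  fix K :: "(real ^ 'n) set" assume "compact K"
  then have "integrable lborel (\<lambda>x. indicator K x *\<^sub>R g x)"
    using assms unfolding locally_integrable_def set_integrable_def by blast
  from integrable_inner_left[OF this, of h]
  show "integrable lborel (\<lambda>x. indicator K x *\<^sub>R (g x \<bullet> h))" by simp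
qed

lemma has_weak_gradient_directional:
  assumes g: "has_weak_gradient u g" and \<phi>: "test_function \<phi>"
  shows "(LINT x|lborel. u x * directional_derivative h \<phi> x) = - (LINT x|lborel. (g x \<bullet> h) * \<phi> x)"
proof -
  have u: "locally_integrable u" and lg: "locally_integrable g"
    using g unfolding has_weak_gradient_def by auto
  have 1: "integrable lborel (\<lambda>x. u x * partial_derivative i \<phi> x)" for i
    by (intro locally_integrable_mult_test u test_function_partial_derivative \<phi>)
  have 2: "integrable lborel (\<lambda>x. g x $ i * \<phi> x)" for i
    by (intro locally_integrable_mult_test locally_integrable_component lg \<phi>)
  have w: "(LINT x|lborel. u x * partial_derivative i \<phi> x) = - (LINT x|lborel. g x $ i * \<phi> x)" for i
    using g \<phi> unfolding has_weak_gradient_def by blast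
  have "(LINT x|lborel. u x * directional_derivative h \<phi> x)
      = (LINT x|lborel. (\<Sum>i\<in>UNIV. h $ i * (u x * partial_derivative i \<phi> x)))"
    by (simp add: directional_derivative_def sum_distrib_left mult_ac)
  also have "\<dots> = (\<Sum>i\<in>UNIV. h $ i * (LINT x|lborel. u x * partial_derivative i \<phi> x))"
    using 1 by simp
  also have "\<dots> = - (\<Sum>i\<in>UNIV. h $ i * (LINT x|lborel. g x $ i * \<phi> x))"
    by (simp add: w sum_negf)
  also have "(\<Sum>i\<in>UNIV. h $ i * (LINT x|lborel. g x $ i * \<phi> x))
      = (LINT x|lborel. (\<Sum>i\<in>UNIV. h $ i * (g x $ i * \<phi> x)))"
    using 2 by simp
  also have "\<dots> = (LINT x|lborel. (g x \<bullet> h) * \<phi> x)"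
    by (simp add: inner_vec_def sum_distrib_left mult_ac)
  finally show ?thesis .
qed

lemma inner_square_le: "(g \<bullet> h)\<^sup>2 \<le> (norm h)\<^sup>2 * (norm g)\<^sup>2"
  using Cauchy_Schwarz_ineq[of g h] by (simp add: power2_norm_eq_inner mult.commute)

text \<open>The absolute value is 1-Lipschitz, so passing to a nonnegative function costs nothing
  and needs no weak gradient of |u|.\<close>

lemma nn_integral_increment_le:
  fixes u :: "real ^ 'n::finite \<Rightarrow> real"
  assumes g: "has_weak_gradient u g"
    and G: "(\<integral>\<^sup>+x. ennreal ((norm (g x))\<^sup>2) \<partial>lborel) \<le> ennreal G"
  shows "(\<integral>\<^sup>+x. ennreal ((\<bar>u (x + h)\<bar> - \<bar>u x\<bar>)\<^sup>2) \<partial>lborel) \<le> ennreal ((norm h)\<^sup>2 * G)"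
proof -
  have u: "locally_integrable u" and lg: "locally_integrable g"
    using g unfolding has_weak_gradient_def by auto
  note [measurable] = locally_integrable_measurable[OF u] locally_integrable_measurable[OF lg]
  have "(\<integral>\<^sup>+x. ennreal ((\<bar>u (x + h)\<bar> - \<bar>u x\<bar>)\<^sup>2) \<partial>lborel) \<le> (\<integral>\<^sup>+x. ennreal ((u (x + h) - u x)\<^sup>2) \<partial>lborel)"
    by (intro nn_integral_mono ennreal_leI) (simp add: abs_le_square_iff[symmetric])
  also have "\<dots> \<le> (\<integral>\<^sup>+x. ennreal ((g x \<bullet> h)\<^sup>2) \<partial>lborel)"
    by (intro translation_bound weak_derivative_increment u locally_integrable_inner lg
        has_weak_gradient_directional[OF g]) measurable
  also have "\<dots> \<le> (\<integral>\<^sup>+x. ennreal ((norm h)\<^sup>2) * ennreal ((norm (g x))\<^sup>2) \<partial>lborel)"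
    by (intro nn_integral_mono) (simp add: ennreal_mult[symmetric] inner_square_le ennreal_leI)
  also have "\<dots> = ennreal ((norm h)\<^sup>2) * (\<integral>\<^sup>+x. ennreal ((norm (g x))\<^sup>2) \<partial>lborel)"
    by (rule nn_integral_cmult) measurable
  also have "\<dots> \<le> ennreal ((norm h)\<^sup>2) * ennreal G" by (intro mult_left_mono G) simp
  finally show ?thesis by (simp add: ennreal_mult')
qed

text \<open>The derivative of u^2 along the segment is 2 u (g . h), whence the factor 4. The bound
  \<open>G\<close> enters only as finiteness, which the chain rule along segments requires.\<close>

lemma nn_integral_square_increment_le:
  fixes u :: "real ^ 'n::finite \<Rightarrow> real"
  assumes g: "has_weak_gradient u g"
    and G: "(\<integral>\<^sup>+x. ennreal ((norm (g x))\<^sup>2) \<partial>lborel) \<le> ennreal G"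
    and Q: "(\<integral>\<^sup>+x. ennreal ((u x)\<^sup>2 * (norm (g x))\<^sup>2) \<partial>lborel) \<le> ennreal Q"
  shows "(\<integral>\<^sup>+x. ennreal (((u (x + h))\<^sup>2 - (u x)\<^sup>2)\<^sup>2) \<partial>lborel) \<le> ennreal ((norm h)\<^sup>2 * (4 * Q))"
proof -
  have u: "locally_integrable u" and lg: "locally_integrable g"
    using g unfolding has_weak_gradient_def by auto
  note [measurable] = locally_integrable_measurable[OF u] locally_integrable_measurable[OF lg]
  have "(\<integral>\<^sup>+x. ennreal ((g x \<bullet> h)\<^sup>2) \<partial>lborel) \<le> (\<integral>\<^sup>+x. ennreal ((norm h)\<^sup>2) * ennreal ((norm (g x))\<^sup>2) \<partial>lborel)"
    by (intro nn_integral_mono) (simp add: ennreal_mult[symmetric] inner_square_le ennreal_leI)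
  also have "\<dots> = ennreal ((norm h)\<^sup>2) * (\<integral>\<^sup>+x. ennreal ((norm (g x))\<^sup>2) \<partial>lborel)"
    by (rule nn_integral_cmult) measurable
  also have "\<dots> < \<infinity>" using le_less_trans[OF G, of top] by (simp add: ennreal_mult_less_top)
  finally have fin: "(\<integral>\<^sup>+x. ennreal ((g x \<bullet> h)\<^sup>2) \<partial>lborel) < \<infinity>" .
  have "(\<integral>\<^sup>+x. ennreal (((u (x + h))\<^sup>2 - (u x)\<^sup>2)\<^sup>2) \<partial>lborel) \<le> (\<integral>\<^sup>+x. ennreal ((2 * (u x * (g x \<bullet> h)))\<^sup>2) \<partial>lborel)"
    by (intro translation_bound weak_derivative_square_increment u locally_integrable_inner lg fin
        has_weak_gradient_directional[OF g]) measurable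
  also have "\<dots> \<le> (\<integral>\<^sup>+x. ennreal (4 * (norm h)\<^sup>2) * ennreal ((u x)\<^sup>2 * (norm (g x))\<^sup>2) \<partial>lborel)"
  proof (rule nn_integral_mono)
    fix x
    have "(2 * (u x * (g x \<bullet> h)))\<^sup>2 = 4 * (u x)\<^sup>2 * (g x \<bullet> h)\<^sup>2" by (simp add: power_mult_distrib)
    also have "\<dots> \<le> 4 * (u x)\<^sup>2 * ((norm h)\<^sup>2 * (norm (g x))\<^sup>2)" by (intro mult_left_mono inner_square_le) simp
    finally show "ennreal ((2 * (u x * (g x \<bullet> h)))\<^sup>2) \<le> ennreal (4 * (norm h)\<^sup>2) * ennreal ((u x)\<^sup>2 * (norm (g x))\<^sup>2)"
      by (simp add: ennreal_mult[symmetric] mult_ac ennreal_leI)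
  qed
  also have "\<dots> = ennreal (4 * (norm h)\<^sup>2) * (\<integral>\<^sup>+x. ennreal ((u x)\<^sup>2 * (norm (g x))\<^sup>2) \<partial>lborel)"
    by (rule nn_integral_cmult) measurable
  also have "\<dots> \<le> ennreal (4 * (norm h)\<^sup>2) * ennreal Q" by (intro mult_left_mono Q) simp
  also have "\<dots> = ennreal ((norm h)\<^sup>2 * (4 * Q))"
    using ennreal_mult'[of "4 * (norm h)\<^sup>2" Q] by (simp add: mult_ac)
  finally show ?thesis .
qed

text \<open>The fundamental lemma in each component. It makes the choice hidden in
  \<open>weak_gradient\<close> harmless for all integrals.\<close>

lemma has_weak_gradient_unique:
  assumes g: "has_weak_gradient u g" and g': "has_weak_gradient u g'"
  shows "AE x in lborel. g x = g' x"
proof -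
  have lg: "locally_integrable g" "locally_integrable g'"
    using g g' unfolding has_weak_gradient_def by auto
  have "AE x in lborel. g x $ i - g' x $ i = 0" for i
  proof (rule AE_eq_0_if_test_integrals_eq_0)
    show "locally_integrable (\<lambda>x. g x $ i - g' x $ i)"
      by (intro locally_integrable_diff locally_integrable_component lg)
    fix \<phi> :: "real ^ 'a \<Rightarrow> real" assume \<phi>: "test_function \<phi>"
    have "(LINT x|lborel. u x * partial_derivative i \<phi> x) = - (LINT x|lborel. g x $ i * \<phi> x)"
      using g \<phi> unfolding has_weak_gradient_def by blast
    moreover have "(LINT x|lborel. u x * partial_derivative i \<phi> x) = - (LINT x|lborel. g' x $ i * \<phi> x)"
      using g' \<phi> unfolding has_weak_gradient_def by blast
    ultimately show "(LINT x|lborel. (g x $ i - g' x $ i) * \<phi> x) = 0"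
      using locally_integrable_mult_test[OF locally_integrable_component[OF lg(1)] \<phi>]
        locally_integrable_mult_test[OF locally_integrable_component[OF lg(2)] \<phi>]
      by (simp add: left_diff_distrib)
  qed
  then have "AE x in lborel. \<forall>i\<in>UNIV. g x $ i - g' x $ i = 0"
    by (intro AE_finite_allI) auto
  then show ?thesis by eventually_elim (simp add: vec_eq_iff)
qed

lemma has_weak_gradient_weak_gradient:
  "has_weak_gradient u g \<Longrightarrow> has_weak_gradient u (weak_gradient u)"
  unfolding weak_gradient_def by (rule someI[of "has_weak_gradient u"])

lemma weak_gradient_AE_eq:
  "has_weak_gradient u g \<Longrightarrow> AE x in lborel. weak_gradient u x = g x"
  using has_weak_gradient_unique has_weak_gradient_weak_gradient by blast

text \<open>The test function is transported by the inverse dilation; both sides then acquire the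
  same Jacobian.\<close>

lemma has_weak_gradient_dilation:
  fixes u :: "real ^ 'n::finite \<Rightarrow> real"
  assumes g: "has_weak_gradient u g" and t: "t > 0"
  shows "has_weak_gradient (\<lambda>x. a * u (t *\<^sub>R x)) (\<lambda>x. (a * t) *\<^sub>R g (t *\<^sub>R x))"
  unfolding has_weak_gradient_def
proof (intro conjI allI impI)
  have u: "locally_integrable u" and lg: "locally_integrable g"
    using g unfolding has_weak_gradient_def by auto
  show "locally_integrable (\<lambda>x. a * u (t *\<^sub>R x))"
    using locally_integrable_cmult[OF locally_integrable_translate[OF u, of t 0], of a] t by simp
  show "locally_integrable (\<lambda>x. (a * t) *\<^sub>R g (t *\<^sub>R x))"
    using locally_integrable_cmult[OF locally_integrable_translate[OF lg, of t 0], of "a * t"] t by simp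
  fix \<phi> :: "real ^ 'n \<Rightarrow> real" and i
  assume \<phi>: "test_function \<phi>"
  define \<psi> where "\<psi> x = \<phi> ((1 / t) *\<^sub>R x + 0)" for x
  have \<psi>: "test_function \<psi>" unfolding \<psi>_def using t by (intro test_function_affine[OF \<phi>]) auto
  have p: "partial_derivative i \<phi> x = t * partial_derivative i \<psi> (t *\<^sub>R x)" for x
    unfolding \<psi>_def partial_derivative_affine[OF test_function_differentiable[OF \<phi>]] using t by simp
  have p': "\<phi> x = \<psi> (t *\<^sub>R x)" for x unfolding \<psi>_def using t by simp
  have "(LINT x|lborel. a * u (t *\<^sub>R x) * partial_derivative i \<phi> x)
      = (LINT x|lborel. (a * t) * (u (t *\<^sub>R x + 0) * partial_derivative i \<psi> (t *\<^sub>R x + 0)))"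
    by (simp add: p mult_ac)
  also have "\<dots> = (a * t) * ((1 / \<bar>t\<bar> ^ DIM(real ^ 'n)) *\<^sub>R (LINT x|lborel. u x * partial_derivative i \<psi> x))"
    using t integral_lborel_affine[of t "\<lambda>x. u x * partial_derivative i \<psi> x" 0] by simp
  also have "(LINT x|lborel. u x * partial_derivative i \<psi> x) = - (LINT x|lborel. g x $ i * \<psi> x)"
    using g \<psi> unfolding has_weak_gradient_def by blast
  also have "(a * t) * ((1 / \<bar>t\<bar> ^ DIM(real ^ 'n)) *\<^sub>R - (LINT x|lborel. g x $ i * \<psi> x))
      = - ((a * t) * (LINT x|lborel. g (t *\<^sub>R x + 0) $ i * \<psi> (t *\<^sub>R x + 0)))"
    using t integral_lborel_affine[of t "\<lambda>x. g x $ i * \<psi> x" 0] by simp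
  also have "\<dots> = - (LINT x|lborel. ((a * t) *\<^sub>R g (t *\<^sub>R x)) $ i * \<phi> x)"
    by (simp add: p' mult_ac flip: integral_mult_right_zero)
  finally show "(LINT x|lborel. a * u (t *\<^sub>R x) * partial_derivative i \<phi> x)
      = - (LINT x|lborel. ((a * t) *\<^sub>R g (t *\<^sub>R x)) $ i * \<phi> x)" .
qed

text \<open>The integral of the increment by a unit vector vanishes by translation invariance, and
  it is also an average of translates of the partial derivative, all with the same integral. This
  replaces integration by parts.\<close>

lemma integral_partial_derivative_test_function:
  fixes \<phi> :: "real ^ 'n::finite \<Rightarrow> real"
  assumes \<phi>: "test_function \<phi>"
  shows "(LINT x|lborel. partial_derivative i \<phi> x) = 0"
proof -
  note d = test_function_partial_derivative[OF \<phi>, of i]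
  note [measurable] = test_function_measurable[OF d] test_function_measurable[OF \<phi>]
  have int: "integrable lborel f" if "test_function f" for f :: "real ^ 'n \<Rightarrow> real"
  proof -
    have "locally_integrable (\<lambda>x :: real ^ 'n. 1 :: real)"
      unfolding locally_integrable_def set_integrable_def
      by (auto intro!: integrable_real_indicator emeasure_compact_finite simp: compact_imp_closed)
    from locally_integrable_mult_test[OF this that] show ?thesis by simp
  qed
  let ?h = "axis i 1 :: real ^ 'n"
  have dir: "directional_derivative ?h \<phi> = partial_derivative i \<phi>"
    by (rule ext) (simp add: directional_derivative_def axis_def if_distrib[of "\<lambda>c. c * _"] cong: if_cong)
  have pair: "integrable (lborel \<Otimes>\<^sub>M unit_interval) (\<lambda>(x, t). partial_derivative i \<phi> (x + t *\<^sub>R ?h))"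
  proof (rule integrableI_bounded)
    have "(\<integral>\<^sup>+z. norm (case z of (x, t) \<Rightarrow> partial_derivative i \<phi> (x + t *\<^sub>R ?h)) \<partial>(lborel \<Otimes>\<^sub>M unit_interval))
      = (\<integral>\<^sup>+x. (\<integral>\<^sup>+t. norm (partial_derivative i \<phi> (x + t *\<^sub>R ?h)) \<partial>unit_interval) \<partial>lborel)"
      by (subst unit_interval.nn_integral_fst[symmetric]) auto
    also have "\<dots> = (\<integral>\<^sup>+x. norm (partial_derivative i \<phi> x) \<partial>lborel)"
      by (rule pair_nn_integral_translate) measurable
    also have "\<dots> < \<infinity>" using int[OF d] by (simp add: integrable_iff_bounded)
    finally show "(\<integral>\<^sup>+z. norm (case z of (x, t) \<Rightarrow> partial_derivative i \<phi> (x + t *\<^sub>R ?h)) \<partial>(lborel \<Otimes>\<^sub>M unit_interval)) < \<infinity>" .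
  qed measurable
  have "0 = (LINT x|lborel. \<phi> (x + ?h) - \<phi> x)"
    using int[OF \<phi>] integrable_lborel_affine[OF int[OF \<phi>], of 1 ?h] by (simp add: integral_lborel_translate)
  also have "\<dots> = (LINT x|lborel. (LINT t|unit_interval. partial_derivative i \<phi> (x + t *\<^sub>R ?h)))"
    by (simp add: test_function_increment[OF \<phi>] dir)
  also have "\<dots> = (LINT t|unit_interval. (LINT x|lborel. partial_derivative i \<phi> (x + t *\<^sub>R ?h)))"
    by (rule lborel_unit.Fubini_integral[symmetric, OF pair])
  also have "\<dots> = (LINT x|lborel. partial_derivative i \<phi> x)"
    by (simp add: integral_lborel_translate measure_def)
  finally show ?thesis by simp
qed

text \<open>The product of two test functions is a test function, so the integral of its partial
  derivative vanishes; the product rule then gives the weak identity.\<close>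

lemma test_function_has_weak_gradient:
  assumes \<phi>: "test_function \<phi>"
  shows "has_weak_gradient \<phi> (\<lambda>x. \<chi> i. partial_derivative i \<phi> x)"
  unfolding has_weak_gradient_def
proof (intro conjI allI impI)
  have li: "locally_integrable f" if "continuous_on UNIV f" for f :: "real ^ 'a \<Rightarrow> 'b::{banach, second_countable_topology}"
    unfolding locally_integrable_def set_integrable_def
    using borel_integrable_compact continuous_on_subset[OF that] by blast
  show "locally_integrable \<phi>" by (intro li test_function_continuous \<phi>)
  show "locally_integrable (\<lambda>x. \<chi> i. partial_derivative i \<phi> x)"
    by (intro li continuous_on_vec_lambda test_function_continuous test_function_partial_derivative \<phi>)
  fix \<psi> :: "real ^ 'a \<Rightarrow> real" and i
  assume \<psi>: "test_function \<psi>"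
  note li\<phi> = li[OF test_function_continuous[OF \<phi>]]
  note li\<phi>' = li[OF test_function_continuous[OF test_function_partial_derivative[OF \<phi>]]]
  have "test_function (\<lambda>x. \<phi> x * \<psi> x)"
    using test_function_mult[OF \<phi>] \<psi> unfolding test_function_def by blast
  from integral_partial_derivative_test_function[OF this, of i]
  have "(LINT x|lborel. \<phi> x * partial_derivative i \<psi> x + partial_derivative i \<phi> x * \<psi> x) = 0"
    unfolding partial_derivative_mult[OF test_function_differentiable[OF \<phi>] test_function_differentiable[OF \<psi>]] .
  then show "(LINT x|lborel. \<phi> x * partial_derivative i \<psi> x) = - (LINT x|lborel. (\<chi> i. partial_derivative i \<phi> x) $ i * \<psi> x)"
    using locally_integrable_mult_test[OF li\<phi> test_function_partial_derivative[OF \<psi>]] locally_integrable_mult_test[OF li\<phi>' \<psi>]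
    by simp
qed

section \<open>The energy on the mass spheres\<close>

definition kinetic :: "(real ^ 'n::finite \<Rightarrow> real) \<Rightarrow> real" where
  "kinetic u = 1 / 2 * (LINT x|lborel. norm (weak_gradient u x) ^ 2)
     + (LINT x|lborel. \<bar>u x\<bar> ^ 2 * norm (weak_gradient u x) ^ 2)"

definition potential :: "real \<Rightarrow> (real ^ 'n::finite \<Rightarrow> real) \<Rightarrow> real" where
  "potential p u = 1 / (p + 1) * (LINT x|lborel. \<bar>u x\<bar> powr (p + 1))"

lemma energy_eq: "energy p u = kinetic u - potential p u"
  by (simp add: energy_def kinetic_def potential_def)

lemma mass_sphereD:
  fixes u :: "real ^ 'n::finite \<Rightarrow> real"
  assumes "u \<in> \<sigma> c"
  shows "u \<in> borel_measurable borel" "has_weak_gradient u (weak_gradient u)"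
    "weak_gradient u \<in> borel_measurable borel"
    "integrable lborel (\<lambda>x. \<bar>u x\<bar> ^ 2)" "(LINT x|lborel. \<bar>u x\<bar> ^ 2) = c"
    "integrable lborel (\<lambda>x. norm (weak_gradient u x) ^ 2)"
    "integrable lborel (\<lambda>x. \<bar>u x\<bar> ^ 2 * norm (weak_gradient u x) ^ 2)"
  using assms has_weak_gradient_weak_gradient
  unfolding mass_sphere_def H1_def L2_def by auto

text \<open>Membership and both Dirichlet integrals can be read off from any explicit weak gradient
  \<open>g\<close>, since it agrees almost everywhere with the chosen one.\<close>

lemma mass_sphereI:
  fixes u :: "real ^ 'n::finite \<Rightarrow> real"
  assumes u [measurable]: "u \<in> borel_measurable borel" and hg: "has_weak_gradient u g"
    and g [measurable]: "g \<in> borel_measurable borel"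
    and "integrable lborel (\<lambda>x. \<bar>u x\<bar> ^ 2)" "(LINT x|lborel. \<bar>u x\<bar> ^ 2) = c"
    and G: "integrable lborel (\<lambda>x. norm (g x) ^ 2)"
    and Q: "integrable lborel (\<lambda>x. \<bar>u x\<bar> ^ 2 * norm (g x) ^ 2)"
  shows "u \<in> \<sigma> c"
    "(LINT x|lborel. norm (weak_gradient u x) ^ 2) = (LINT x|lborel. norm (g x) ^ 2)"
    "(LINT x|lborel. \<bar>u x\<bar> ^ 2 * norm (weak_gradient u x) ^ 2) = (LINT x|lborel. \<bar>u x\<bar> ^ 2 * norm (g x) ^ 2)"
proof -
  have "has_weak_gradient u (weak_gradient u)" by (rule has_weak_gradient_weak_gradient[OF hg])
  then have [measurable]: "weak_gradient u \<in> borel_measurable borel"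
    unfolding has_weak_gradient_def by (blast intro: locally_integrable_measurable)
  have eq: "AE x in lborel. weak_gradient u x = g x" by (rule weak_gradient_AE_eq[OF hg])
  have 1: "AE x in lborel. norm (weak_gradient u x) ^ 2 = norm (g x) ^ 2"
    using eq by eventually_elim simp
  have 2: "AE x in lborel. \<bar>u x\<bar> ^ 2 * norm (weak_gradient u x) ^ 2 = \<bar>u x\<bar> ^ 2 * norm (g x) ^ 2"
    using eq by eventually_elim simp
  show "(LINT x|lborel. norm (weak_gradient u x) ^ 2) = (LINT x|lborel. norm (g x) ^ 2)"
    by (rule integral_cong_AE) (use 1 in measurable)
  show "(LINT x|lborel. \<bar>u x\<bar> ^ 2 * norm (weak_gradient u x) ^ 2) = (LINT x|lborel. \<bar>u x\<bar> ^ 2 * norm (g x) ^ 2)"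
    by (rule integral_cong_AE) (use 2 in measurable)
  have "integrable lborel (\<lambda>x. norm (weak_gradient u x) ^ 2)"
    using G by (subst integrable_cong_AE[OF _ _ 1]) measurable
  moreover have "integrable lborel (\<lambda>x. \<bar>u x\<bar> ^ 2 * norm (weak_gradient u x) ^ 2)"
    using Q by (subst integrable_cong_AE[OF _ _ 2]) measurable
  ultimately show "u \<in> \<sigma> c"
    using assms unfolding mass_sphere_def H1_def L2_def by auto
qed

text \<open>Amplitude and scale are kept separate because two specialisations are needed:
  \<open>a = 1\<close>, which changes the mass, and a = t^(N/2), which preserves it.\<close>

lemma mass_sphere_dilation:
  fixes u :: "real ^ 'n::finite \<Rightarrow> real"
  defines "N \<equiv> CARD('n)"
  assumes u: "u \<in> \<sigma> c" and a: "a > 0" and t: "t > 0"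
  defines "v \<equiv> (\<lambda>x. a * u (t *\<^sub>R x))"
  shows "v \<in> \<sigma> (a\<^sup>2 / t ^ N * c)"
    "(LINT x|lborel. norm (weak_gradient v x) ^ 2) = a\<^sup>2 * t\<^sup>2 / t ^ N * (LINT x|lborel. norm (weak_gradient u x) ^ 2)"
    "(LINT x|lborel. \<bar>v x\<bar> ^ 2 * norm (weak_gradient v x) ^ 2)
      = a ^ 4 * t\<^sup>2 / t ^ N * (LINT x|lborel. \<bar>u x\<bar> ^ 2 * norm (weak_gradient u x) ^ 2)"
    "potential p v = a powr (p + 1) / t ^ N * potential p u"
proof -
  note D = mass_sphereD[OF u]
  note [measurable] = D(1) D(3)
  let ?g = "\<lambda>x. (a * t) *\<^sub>R weak_gradient u (t *\<^sub>R x)"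
  have t0: "t \<noteq> 0" using t by simp
  have dil: "integrable lborel (\<lambda>x. k * f (t *\<^sub>R x)) \<and> (LINT x|lborel. k * f (t *\<^sub>R x)) = k / t ^ N * (LINT x|lborel. f x)"
    if "integrable lborel f" for f :: "real ^ 'n \<Rightarrow> real" and k
    using integrable_lborel_affine[OF that t0, of 0] integral_lborel_affine[OF t0, of f 0] t
    by (simp add: N_def)
  have hg: "has_weak_gradient v ?g" unfolding v_def by (rule has_weak_gradient_dilation[OF D(2) t])
  have M: "(\<lambda>x. \<bar>v x\<bar> ^ 2) = (\<lambda>x. a\<^sup>2 * \<bar>u (t *\<^sub>R x)\<bar> ^ 2)"
    unfolding v_def by (simp add: power_mult_distrib)
  have G: "(\<lambda>x. norm (?g x) ^ 2) = (\<lambda>x. a\<^sup>2 * t\<^sup>2 * norm (weak_gradient u (t *\<^sub>R x)) ^ 2)"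
    by (simp add: power_mult_distrib abs_mult)
  have Q: "(\<lambda>x. \<bar>v x\<bar> ^ 2 * norm (?g x) ^ 2)
      = (\<lambda>x. a ^ 4 * t\<^sup>2 * (\<bar>u (t *\<^sub>R x)\<bar> ^ 2 * norm (weak_gradient u (t *\<^sub>R x)) ^ 2))"
  proof -
    have "a ^ 4 = a\<^sup>2 * a\<^sup>2" by (simp flip: power_add)
    then show ?thesis unfolding v_def by (simp add: power_mult_distrib mult_ac)
  qed
  have meas: "v \<in> borel_measurable borel" "?g \<in> borel_measurable borel"
    unfolding v_def by measurable
  have int: "integrable lborel (\<lambda>x. \<bar>v x\<bar> ^ 2)" "(LINT x|lborel. \<bar>v x\<bar> ^ 2) = a\<^sup>2 / t ^ N * c"
    "integrable lborel (\<lambda>x. norm (?g x) ^ 2)" "integrable lborel (\<lambda>x. \<bar>v x\<bar> ^ 2 * norm (?g x) ^ 2)"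
    unfolding M G Q using dil[OF D(4), of "a\<^sup>2"] dil[OF D(6)] dil[OF D(7)] D(5) by auto
  note * = mass_sphereI[OF meas(1) hg meas(2) int]
  show "v \<in> \<sigma> (a\<^sup>2 / t ^ N * c)" by (rule *(1))
  show "(LINT x|lborel. norm (weak_gradient v x) ^ 2) = a\<^sup>2 * t\<^sup>2 / t ^ N * (LINT x|lborel. norm (weak_gradient u x) ^ 2)"
    unfolding *(2) G using dil[OF D(6)] by auto
  show "(LINT x|lborel. \<bar>v x\<bar> ^ 2 * norm (weak_gradient v x) ^ 2)
      = a ^ 4 * t\<^sup>2 / t ^ N * (LINT x|lborel. \<bar>u x\<bar> ^ 2 * norm (weak_gradient u x) ^ 2)"
    unfolding *(3) Q using dil[OF D(7)] by auto
  have "(LINT x|lborel. \<bar>v x\<bar> powr (p + 1)) = (LINT x|lborel. a powr (p + 1) * \<bar>u (t *\<^sub>R x + 0)\<bar> powr (p + 1))"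
    using a unfolding v_def by (simp add: abs_mult powr_mult)
  also have "\<dots> = a powr (p + 1) / t ^ N * (LINT x|lborel. \<bar>u x\<bar> powr (p + 1))"
    using integral_lborel_affine[OF t0, of "\<lambda>x. \<bar>u x\<bar> powr (p + 1)" 0] t by (simp add: N_def)
  finally show "potential p v = a powr (p + 1) / t ^ N * potential p u"
    by (simp add: potential_def)
qed

text \<open>With amplitude 1 both kinetic terms contain exactly two derivatives, so they scale by
  one common factor. This is why the energy reduces to a single parameter.\<close>

lemma kinetic_dilation:
  fixes u :: "real ^ 'n::finite \<Rightarrow> real"
  assumes u: "u \<in> \<sigma> c" and s: "s > 0"
  defines "N \<equiv> real CARD('n)"
  defines "v \<equiv> (\<lambda>x. u (s powr (- 1 / N) *\<^sub>R x))"
  shows "v \<in> \<sigma> (s * c)" "kinetic v = s * s powr (- 2 / N) * kinetic u" "potential p v = s * potential p u"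
proof -
  let ?t = "s powr (- 1 / N)"
  have t: "?t > 0" using s by simp
  have N: "N > 0" by (simp add: N_def)
  have tN: "?t ^ CARD('n) = 1 / s"
  proof -
    have "?t ^ CARD('n) = ?t powr N" using t unfolding N_def by (simp only: powr_realpow)
    also have "\<dots> = s powr (- 1 / N * N)" by (simp only: powr_powr)
    also have "\<dots> = 1 / s" using s N by (simp add: powr_minus_divide)
    finally show ?thesis .
  qed
  have t2: "?t\<^sup>2 = s powr (- 2 / N)"
    using s by (simp add: powr_power)
  have v: "v = (\<lambda>x. 1 * u (?t *\<^sub>R x))" by (simp add: v_def)
  note * = mass_sphere_dilation[OF u zero_less_one t, unfolded tN t2]
  show "v \<in> \<sigma> (s * c)" unfolding v using *(1) by simp
  show "potential p v = s * potential p u" unfolding v *(4) by simp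
  show "kinetic v = s * s powr (- 2 / N) * kinetic u"
    unfolding kinetic_def v *(2,3) by (simp add: algebra_simps)
qed

text \<open>Here the two kinetic terms separate: powers 2 and N + 2 of \<open>t\<close>, against N
  (p - 1) / 2 for the potential. At p = 3 + 4/N the potential has power N + 2.\<close>

lemma mass_preserving_dilation:
  fixes u :: "real ^ 'n::finite \<Rightarrow> real"
  assumes u: "u \<in> \<sigma> c" and t: "t > 0"
  defines "N \<equiv> real CARD('n)"
  defines "v \<equiv> (\<lambda>x. t powr (N / 2) * u (t *\<^sub>R x))"
  shows "v \<in> \<sigma> c"
    "kinetic v = t\<^sup>2 * (1 / 2 * (LINT x|lborel. norm (weak_gradient u x) ^ 2))
      + t\<^sup>2 * t ^ CARD('n) * (LINT x|lborel. \<bar>u x\<bar> ^ 2 * norm (weak_gradient u x) ^ 2)"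
    "potential p v = t powr (N * (p - 1) / 2) * potential p u"
proof -
  let ?a = "t powr (N / 2)"
  have a: "?a > 0" using t by simp
  have a2: "?a\<^sup>2 = t ^ CARD('n)"
    using t by (simp add: powr_power N_def powr_realpow)
  have a4: "?a ^ 4 = t ^ CARD('n) * t ^ CARD('n)"
    using a2 by (metis power2_eq_square power_even_eq numeral_Bit0 mult_2)
  have ap: "?a powr (p + 1) / t ^ CARD('n) = t powr (N * (p - 1) / 2)"
  proof -
    have "?a powr (p + 1) = t powr (N * (p - 1) / 2 + N)"
      by (simp add: powr_powr field_simps)
    also have "\<dots> = t powr (N * (p - 1) / 2) * t ^ CARD('n)"
      using t by (simp add: powr_add N_def powr_realpow)
    finally show ?thesis using t by simp
  qed
  note * = mass_sphere_dilation[OF u a t, unfolded a2 a4, folded N_def]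
  show "v \<in> \<sigma> c" unfolding v_def using *(1) t by simp
  show "kinetic v = t\<^sup>2 * (1 / 2 * (LINT x|lborel. norm (weak_gradient u x) ^ 2))
      + t\<^sup>2 * t ^ CARD('n) * (LINT x|lborel. \<bar>u x\<bar> ^ 2 * norm (weak_gradient u x) ^ 2)"
    unfolding kinetic_def v_def *(2,3) using t by simp
  show "potential p v = t powr (N * (p - 1) / 2) * potential p u" unfolding v_def *(4) ap ..
qed

section \<open>Gagliardo-Nirenberg bounds on the mass spheres\<close>

lemma integrable_of_nn_integral_le:
  assumes [measurable]: "f \<in> borel_measurable M" and f0: "\<And>x. f x \<ge> 0"
    and B: "(\<integral>\<^sup>+x. ennreal (f x) \<partial>M) \<le> ennreal B" "B \<ge> 0"
  shows "integrable M f" "(LINT x|M. f x) \<le> B"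
proof -
  show int: "integrable M f"
    using f0 le_less_trans[OF B(1), of top] by (simp add: integrable_iff_bounded)
  have "ennreal (LINT x|M. f x) \<le> ennreal B"
    using B(1) nn_integral_eq_integral[OF int] f0 by simp
  then show "(LINT x|M. f x) \<le> B" using B(2) by (simp add: ennreal_le_iff)
qed

text \<open>Taken with |u|, r = 2 and with u^2, r = 1, so that the integral of the r-th power is the
  mass each time. For u^2 the exponent 2 + 2/N doubles to 4 + 4/N in terms of |u|.\<close>

lemma gagliardo_nirenberg_mass_sphere:
  fixes u :: "real ^ 'n::finite \<Rightarrow> real"
  assumes u: "u \<in> \<sigma> c" and c: "c > 0"
  defines "N \<equiv> real CARD('n)"
  shows "integrable lborel (\<lambda>x. \<bar>u x\<bar> powr (2 + 4 / N))"
    "(LINT x|lborel. \<bar>u x\<bar> powr (2 + 4 / N))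
      \<le> gn_const CARD('n) 2 * c powr (2 / N) * (LINT x|lborel. norm (weak_gradient u x) ^ 2)"
    "integrable lborel (\<lambda>x. \<bar>u x\<bar> powr (4 + 4 / N))"
    "(LINT x|lborel. \<bar>u x\<bar> powr (4 + 4 / N))
      \<le> gn_const CARD('n) 1 * c powr (2 / N) * (4 * (LINT x|lborel. \<bar>u x\<bar> ^ 2 * norm (weak_gradient u x) ^ 2))"
proof -
  note D = mass_sphereD[OF u]
  note [measurable] = D(1) D(3)
  have gn0: "gn_const k r \<ge> 0" for k r by (simp add: gn_const_def)
  let ?G = "LINT x|lborel. norm (weak_gradient u x) ^ 2"
  let ?Q = "LINT x|lborel. \<bar>u x\<bar> ^ 2 * norm (weak_gradient u x) ^ 2"
  have M: "(\<integral>\<^sup>+x. ennreal (\<bar>u x\<bar> ^ 2) \<partial>lborel) \<le> ennreal c"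
    using nn_integral_eq_integral[OF D(4)] D(5) by simp
  have G: "(\<integral>\<^sup>+x. ennreal ((norm (weak_gradient u x))\<^sup>2) \<partial>lborel) \<le> ennreal ?G"
    using nn_integral_eq_integral[OF D(6)] by simp
  have Q: "(\<integral>\<^sup>+x. ennreal ((u x)\<^sup>2 * (norm (weak_gradient u x))\<^sup>2) \<partial>lborel) \<le> ennreal ?Q"
    using nn_integral_eq_integral[OF D(7)] by simp
  have "(\<integral>\<^sup>+x. ennreal (\<bar>u x\<bar> powr (2 + 2 * real 2 / real DIM(real ^ 'n))) \<partial>lborel)
      \<le> ennreal (gn_const DIM(real ^ 'n) 2 * c powr (2 / real DIM(real ^ 'n)) * ?G)"
    by (intro gagliardo_nirenberg M c nn_integral_increment_le[OF D(2) G]) auto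
  then have 1: "(\<integral>\<^sup>+x. ennreal (\<bar>u x\<bar> powr (2 + 4 / N)) \<partial>lborel) \<le> ennreal (gn_const CARD('n) 2 * c powr (2 / N) * ?G)"
    by (simp add: N_def)
  show "integrable lborel (\<lambda>x. \<bar>u x\<bar> powr (2 + 4 / N))"
    "(LINT x|lborel. \<bar>u x\<bar> powr (2 + 4 / N)) \<le> gn_const CARD('n) 2 * c powr (2 / N) * ?G"
    using gn0 by (intro integrable_of_nn_integral_le[OF _ _ 1]; simp)+
  have "(\<integral>\<^sup>+x. ennreal ((u x)\<^sup>2 powr (2 + 2 * real 1 / real DIM(real ^ 'n))) \<partial>lborel)
      \<le> ennreal (gn_const DIM(real ^ 'n) 1 * c powr (2 / real DIM(real ^ 'n)) * (4 * ?Q))"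
    using M by (intro gagliardo_nirenberg c nn_integral_square_increment_le[OF D(2) G Q]) auto
  moreover have "(u x)\<^sup>2 powr (2 + 2 * real 1 / real DIM(real ^ 'n)) = \<bar>u x\<bar> powr (4 + 4 / N)" for x
  proof -
    have "(u x)\<^sup>2 = \<bar>u x\<bar> powr 2" by simp
    then show ?thesis by (simp only: powr_powr) (simp add: N_def algebra_simps)
  qed
  ultimately have 2: "(\<integral>\<^sup>+x. ennreal (\<bar>u x\<bar> powr (4 + 4 / N)) \<partial>lborel) \<le> ennreal (gn_const CARD('n) 1 * c powr (2 / N) * (4 * ?Q))"
    by (simp add: N_def)
  show "integrable lborel (\<lambda>x. \<bar>u x\<bar> powr (4 + 4 / N))"
    "(LINT x|lborel. \<bar>u x\<bar> powr (4 + 4 / N)) \<le> gn_const CARD('n) 1 * c powr (2 / N) * (4 * ?Q)"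
    using gn0 by (intro integrable_of_nn_integral_le[OF _ _ 2]; simp)+
qed

lemma powr_le_sum_endpoints:
  fixes s a b q :: real
  assumes "s \<ge> 0" "a \<le> q" "q \<le> b"
  shows "s powr q \<le> s powr a + s powr b"
proof (cases "s \<le> 1")
  case True
  then have "s powr q \<le> s powr a"
    using assms by (cases "s = 0") (auto intro: powr_mono')
  then show ?thesis by (smt (verit) powr_ge_zero)
next
  case False
  then have "s powr q \<le> s powr b" using assms by (intro powr_mono) auto
  then show ?thesis by (smt (verit) powr_ge_zero)
qed

text \<open>Large \<open>s\<close> are absorbed by the higher power with an arbitrarily small
  factor, which needs \<open>q < b\<close> strictly; small \<open>s\<close> are left to the
  square.\<close>

lemma powr_interpolation:
  fixes q b \<epsilon> :: real
  assumes "2 \<le> q" "q < b" "\<epsilon> > 0"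
  shows "\<exists>C\<ge>0. \<forall>s\<ge>0. s powr q \<le> \<epsilon> * s powr b + C * s\<^sup>2"
proof -
  \<comment> \<open>The point where s^q equals \<epsilon> s^b.\<close>
  define S where "S = (1 / \<epsilon>) powr (1 / (b - q))"
  have S: "S > 0" using assms(3) by (simp add: S_def)
  have "s powr q \<le> \<epsilon> * s powr b + S powr (q - 2) * s\<^sup>2" if s: "s \<ge> 0" for s
  proof (cases "s \<le> S")
    case True
    have "s powr q \<le> S powr (q - 2) * s\<^sup>2"
    proof (cases "s = 0")
      case False
      have "s powr q = s powr (q - 2) * s powr 2" by (simp flip: powr_add)
      also have "\<dots> \<le> S powr (q - 2) * s powr 2" using True s assms by (intro mult_right_mono powr_mono2) auto
      finally show ?thesis using s by simp
    qed simp
    moreover have "0 \<le> \<epsilon> * s powr b" using assms by simp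
    ultimately show ?thesis by linarith
  next
    case False
    have "1 / \<epsilon> = S powr (b - q)" using assms by (simp add: S_def powr_powr)
    also have "\<dots> \<le> s powr (b - q)" using False S assms by (intro powr_mono2) auto
    finally have "1 \<le> \<epsilon> * s powr (b - q)" using assms(3) by (simp add: field_simps)
    then have "s powr q * 1 \<le> s powr q * (\<epsilon> * s powr (b - q))" by (intro mult_left_mono) auto
    also have "\<dots> = \<epsilon> * s powr b" by (simp add: mult.left_commute flip: powr_add)
    finally have "s powr q \<le> \<epsilon> * s powr b" by simp
    moreover have "0 \<le> S powr (q - 2) * s\<^sup>2" by simp
    ultimately show ?thesis by linarith
  qed
  then show ?thesis by (intro exI[of _ "S powr (q - 2)"]) auto
qed

lemma integral_powr_pos:
  fixes u :: "real ^ 'n::finite \<Rightarrow> real"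
  assumes u: "u \<in> \<sigma> c" and c: "c > 0" and int: "integrable lborel (\<lambda>x. \<bar>u x\<bar> powr q)"
  shows "(LINT x|lborel. \<bar>u x\<bar> powr q) > 0"
proof (rule ccontr)
  assume "\<not> (LINT x|lborel. \<bar>u x\<bar> powr q) > 0"
  moreover have "(LINT x|lborel. \<bar>u x\<bar> powr q) \<ge> 0" by (intro Bochner_Integration.integral_nonneg) auto
  ultimately have "(LINT x|lborel. \<bar>u x\<bar> powr q) = 0" by linarith
  then have "AE x in lborel. \<bar>u x\<bar> powr q = 0"
    using integral_nonneg_eq_0_iff_AE[OF int] by simp
  then have "AE x in lborel. \<bar>u x\<bar> ^ 2 = 0" by eventually_elim simp
  then have "(LINT x|lborel. \<bar>u x\<bar> ^ 2) = 0" by (rule integral_eq_zero_AE)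
  then show False using mass_sphereD(5)[OF u] c by simp
qed

lemma dirichlet_nonneg:
  "0 \<le> (LINT x|lborel. norm (weak_gradient u x) ^ 2)"
  "0 \<le> (LINT x|lborel. \<bar>u x\<bar> ^ 2 * norm (weak_gradient u x) ^ 2)"
  by (intro Bochner_Integration.integral_nonneg; simp)+

text \<open>By the first inequality a vanishing Dirichlet integral would force the integral of
  |u|^(2 + 4/N) to vanish, hence the mass.\<close>

lemma kinetic_pos:
  fixes u :: "real ^ 'n::finite \<Rightarrow> real"
  assumes u: "u \<in> \<sigma> c" and c: "c > 0"
  shows "kinetic u > 0"
proof -
  note gn = gagliardo_nirenberg_mass_sphere[OF u c]
  have "0 < gn_const CARD('n) 2 * c powr (2 / real CARD('n)) * (LINT x|lborel. norm (weak_gradient u x) ^ 2)"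
    using gn(2) integral_powr_pos[OF u c gn(1)] by linarith
  then have "(LINT x|lborel. norm (weak_gradient u x) ^ 2) \<noteq> 0" by auto
  then show ?thesis using dirichlet_nonneg[of u] unfolding kinetic_def by linarith
qed

lemma potential_nonneg: "p > 0 \<Longrightarrow> 0 \<le> potential p u"
  unfolding potential_def by (intro mult_nonneg_nonneg Bochner_Integration.integral_nonneg) auto

lemma mass_sphere_powr_integrable:
  fixes u :: "real ^ 'n::finite \<Rightarrow> real"
  defines "N \<equiv> real CARD('n)"
  assumes u: "u \<in> \<sigma> c" and c: "c > 0" and p: "p \<in> {1 + 4 / N .. 3 + 4 / N}"
  shows "integrable lborel (\<lambda>x. \<bar>u x\<bar> powr (p + 1))"
proof -
  note gn = gagliardo_nirenberg_mass_sphere[OF u c, folded N_def]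
  have [measurable]: "u \<in> borel_measurable borel" by (rule mass_sphereD[OF u])
  have "integrable lborel (\<lambda>x. \<bar>u x\<bar> powr (2 + 4 / N) + \<bar>u x\<bar> powr (4 + 4 / N))"
    by (intro Bochner_Integration.integrable_add gn)
  then show ?thesis
  proof (rule Bochner_Integration.integrable_bound)
    show "AE x in lborel. norm (\<bar>u x\<bar> powr (p + 1)) \<le> norm (\<bar>u x\<bar> powr (2 + 4 / N) + \<bar>u x\<bar> powr (4 + 4 / N))"
    proof (rule AE_I2)
      fix x
      show "norm (\<bar>u x\<bar> powr (p + 1)) \<le> norm (\<bar>u x\<bar> powr (2 + 4 / N) + \<bar>u x\<bar> powr (4 + 4 / N))"
        using p powr_le_sum_endpoints[of "\<bar>u x\<bar>" "2 + 4 / N" "p + 1" "4 + 4 / N"] by simp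
    qed
  qed measurable
qed

lemma potential_pos:
  fixes u :: "real ^ 'n::finite \<Rightarrow> real"
  defines "N \<equiv> real CARD('n)"
  assumes u: "u \<in> \<sigma> c" and c: "c > 0" and p: "p \<in> {1 + 4 / N .. 3 + 4 / N}"
  shows "potential p u > 0"
proof -
  have "N > 0" by (simp add: N_def)
  then have "4 / N > 0" by simp
  then have "p > 0" using p by (simp only: atLeastAtMost_iff) linarith
  then show ?thesis
    using integral_powr_pos[OF u c mass_sphere_powr_integrable[OF u c p[unfolded N_def]]]
    unfolding potential_def by simp
qed

text \<open>The power p + 1 is dominated by the sum of the two endpoint powers, each controlled by
  its own half of the kinetic part with the same power of \<open>c\<close>.\<close>

lemma potential_le_kinetic:
  fixes p :: real
  defines "N \<equiv> real CARD('n::finite)"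
  assumes p: "p \<in> {1 + 4 / N .. 3 + 4 / N}"
  obtains K where "K > 0"
    "\<And>c (u :: real ^ 'n \<Rightarrow> real). c > 0 \<Longrightarrow> u \<in> \<sigma> c \<Longrightarrow> potential p u \<le> K * c powr (2 / N) * kinetic u"
proof
  have N: "4 / N > 0" by (simp add: N_def)
  then have p0: "p > 0" using p by (simp only: atLeastAtMost_iff) linarith
  \<comment> \<open>The 2 undoes the factor 1/2 in \<open>kinetic\<close>; the 4 comes from the
    square of the gradient 2 u grad u.\<close>
  define K where "K = 2 * gn_const CARD('n) 2 + 4 * gn_const CARD('n) 1"
  have gn0: "gn_const CARD('n) r > 0" for r by (simp add: gn_const_def)
  show "K > 0" using gn0[of 1] gn0[of 2] unfolding K_def by linarith
  fix c :: real and u :: "real ^ 'n \<Rightarrow> real"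
  assume c: "c > 0" and u: "u \<in> \<sigma> c"
  let ?G = "LINT x|lborel. norm (weak_gradient u x) ^ 2"
  let ?Q = "LINT x|lborel. \<bar>u x\<bar> ^ 2 * norm (weak_gradient u x) ^ 2"
  let ?P = "LINT x|lborel. \<bar>u x\<bar> powr (p + 1)"
  note gn = gagliardo_nirenberg_mass_sphere[OF u c, folded N_def]
  note nonneg = dirichlet_nonneg[of u]
  have P0: "0 \<le> ?P" by (intro Bochner_Integration.integral_nonneg) auto
  have "potential p u \<le> ?P"
    using p0 mult_right_mono[OF _ P0, of "1 / (p + 1)" 1] unfolding potential_def by simp
  also have "?P \<le> (LINT x|lborel. \<bar>u x\<bar> powr (2 + 4 / N) + \<bar>u x\<bar> powr (4 + 4 / N))"
    using p by (intro integral_mono Bochner_Integration.integrable_add gn powr_le_sum_endpoints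
        mass_sphere_powr_integrable[OF u c p[unfolded N_def]]) auto
  also have "\<dots> = (LINT x|lborel. \<bar>u x\<bar> powr (2 + 4 / N)) + (LINT x|lborel. \<bar>u x\<bar> powr (4 + 4 / N))"
    by (rule Bochner_Integration.integral_add[OF gn(1) gn(3)])
  also have "\<dots> \<le> gn_const CARD('n) 2 * c powr (2 / N) * ?G + gn_const CARD('n) 1 * c powr (2 / N) * (4 * ?Q)"
    by (intro add_mono gn)
  also have "\<dots> = c powr (2 / N) * (2 * gn_const CARD('n) 2 * (1 / 2 * ?G) + 4 * gn_const CARD('n) 1 * ?Q)"
    by (simp add: algebra_simps)
  also have "\<dots> \<le> c powr (2 / N) * (K * (1 / 2 * ?G) + K * ?Q)"
    using gn0[of 1] gn0[of 2] nonneg by (intro mult_left_mono add_mono mult_right_mono) (auto simp: K_def)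
  also have "\<dots> = K * c powr (2 / N) * kinetic u"
    by (simp add: kinetic_def algebra_simps)
  finally show "potential p u \<le> K * c powr (2 / N) * kinetic u" .
qed

text \<open>Interpolation between the square, whose integral is the mass 1 and yields the constant
  \<open>C\<close>, and the power 4 + 4/N, which the quasilinear term controls.\<close>

lemma potential_le_small_kinetic:
  fixes p \<epsilon> :: real
  defines "N \<equiv> real CARD('n::finite)"
  assumes p: "1 + 4 / N \<le> p" "p < 3 + 4 / N" and \<epsilon>: "\<epsilon> > 0"
  obtains C where "\<And>u :: real ^ 'n \<Rightarrow> real. u \<in> \<sigma> 1 \<Longrightarrow> potential p u \<le> \<epsilon> * kinetic u + C"
proof -
  have N: "4 / N > 0" by (simp add: N_def)
  then have p0: "p > 0" using p by linarith
  \<comment> \<open>The constant of the second inequality at mass 1; dividing \<epsilon> by it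
    leaves exactly \<epsilon> in front of the quasilinear term.\<close>
  let ?K = "4 * gn_const CARD('n) 1"
  have K: "?K > 0" by (simp add: gn_const_def)
  obtain C where C: "C \<ge> 0" "\<And>s. s \<ge> 0 \<Longrightarrow> s powr (p + 1) \<le> \<epsilon> / ?K * s powr (4 + 4 / N) + C * s\<^sup>2"
    using powr_interpolation[of "p + 1" "4 + 4 / N" "\<epsilon> / ?K"] p N \<epsilon> K by (auto simp: add.commute)
  show ?thesis
  proof (rule that[of C])
    fix u :: "real ^ 'n \<Rightarrow> real" assume u: "u \<in> \<sigma> 1"
    let ?G = "LINT x|lborel. norm (weak_gradient u x) ^ 2"
    let ?Q = "LINT x|lborel. \<bar>u x\<bar> ^ 2 * norm (weak_gradient u x) ^ 2"
    let ?P = "LINT x|lborel. \<bar>u x\<bar> powr (p + 1)"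
    note gn = gagliardo_nirenberg_mass_sphere[OF u zero_less_one, folded N_def]
    note nonneg = dirichlet_nonneg[of u]
    note D = mass_sphereD[OF u]
    have P0: "0 \<le> ?P" by (intro Bochner_Integration.integral_nonneg) auto
    have "potential p u \<le> ?P"
      using p0 mult_right_mono[OF _ P0, of "1 / (p + 1)" 1] unfolding potential_def by simp
    also have "?P \<le> (LINT x|lborel. \<epsilon> / ?K * \<bar>u x\<bar> powr (4 + 4 / N) + C * \<bar>u x\<bar> ^ 2)"
      using p by (intro integral_mono Bochner_Integration.integrable_add integrable_mult_right gn D C
          mass_sphere_powr_integrable[OF u zero_less_one]) (auto simp: N_def)
    also have "\<dots> = (LINT x|lborel. \<epsilon> / ?K * \<bar>u x\<bar> powr (4 + 4 / N)) + (LINT x|lborel. C * \<bar>u x\<bar> ^ 2)"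
      by (intro Bochner_Integration.integral_add integrable_mult_right gn D)
    also have "\<dots> = \<epsilon> / ?K * (LINT x|lborel. \<bar>u x\<bar> powr (4 + 4 / N)) + C"
      by (simp only: integral_mult_right_zero D(5) mult_1_right)
    also have "\<dots> \<le> \<epsilon> / ?K * (?K * ?Q) + C"
      using gn(4) K \<epsilon> by (intro add_right_mono mult_left_mono) auto
    also have "\<dots> = \<epsilon> * ?Q + C" using K by simp
    also have "\<dots> \<le> \<epsilon> * kinetic u + C"
      using nonneg \<epsilon> unfolding kinetic_def by (intro add_right_mono mult_left_mono) auto
    finally show "potential p u \<le> \<epsilon> * kinetic u + C" .
  qed
qed

text \<open>A bump function has positive mass because it is positive on a box of positive volume; a
  dilation by the inverse mass normalises it.\<close>

lemma mass_sphere_1_nonempty: "\<exists>u :: real ^ 'n::finite \<Rightarrow> real. u \<in> \<sigma> 1"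
proof -
  define \<phi> where "\<phi> = (bump 0 One :: real ^ 'n \<Rightarrow> real)"
  have \<phi>: "test_function \<phi>" unfolding \<phi>_def by (rule test_function_bump)
  obtain K where K: "compact K" "\<And>x. x \<notin> K \<Longrightarrow> \<phi> x = 0" using test_function_support[OF \<phi>] by blast
  let ?g = "\<lambda>x. \<chi> i. partial_derivative i \<phi> x"
  have g: "continuous_on UNIV ?g"
    by (intro continuous_on_vec_lambda test_function_continuous test_function_partial_derivative \<phi>)
  have "\<exists>K'. compact K' \<and> (\<forall>x. x \<notin> K' \<longrightarrow> ?g x = 0)"
  proof -
    have "\<forall>i. \<exists>K. compact K \<and> (\<forall>x. x \<notin> K \<longrightarrow> partial_derivative i \<phi> x = 0)"
      using test_function_support[OF test_function_partial_derivative[OF \<phi>]] by metis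
    then obtain L where L: "\<And>i. compact (L i)" "\<And>i x. x \<notin> L i \<Longrightarrow> partial_derivative i \<phi> x = 0" by metis
    then show ?thesis
      by (intro exI[of _ "\<Union>i\<in>UNIV. L i"]) (auto simp: vec_eq_iff intro!: compact_UN)
  qed
  then obtain K' where K': "compact K'" "\<And>x. x \<notin> K' \<Longrightarrow> ?g x = 0" by blast
  have int: "integrable lborel f" if "continuous_on UNIV f" "compact L" "\<And>x. x \<notin> L \<Longrightarrow> f x = 0"
    for f :: "real ^ 'n \<Rightarrow> real" and L
  proof -
    have "integrable lborel (\<lambda>x. indicator L x *\<^sub>R f x)"
      using that by (intro borel_integrable_compact) (auto intro: continuous_on_subset)
    moreover have "(\<lambda>x. indicator L x *\<^sub>R f x) = f" using that(3) by (auto simp: indicator_def fun_eq_iff)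
    ultimately show ?thesis by simp
  qed
  have c\<phi>: "continuous_on UNIV \<phi>" by (rule test_function_continuous[OF \<phi>])
  have i1: "integrable lborel (\<lambda>x. \<bar>\<phi> x\<bar> ^ 2)"
    by (rule int[OF _ K(1)]) (auto intro!: continuous_intros c\<phi> simp: K(2))
  have i2: "integrable lborel (\<lambda>x. norm (?g x) ^ 2)"
  proof (rule int[OF _ K'(1)])
    show "continuous_on UNIV (\<lambda>x. norm (?g x) ^ 2)" by (intro continuous_on_power continuous_on_norm g)
    show "norm (?g x) ^ 2 = 0" if "x \<notin> K'" for x unfolding K'(2)[OF that] by simp
  qed
  have i3: "integrable lborel (\<lambda>x. \<bar>\<phi> x\<bar> ^ 2 * norm (?g x) ^ 2)"
  proof (rule int[OF _ K(1)])
    show "continuous_on UNIV (\<lambda>x. \<bar>\<phi> x\<bar> ^ 2 * norm (?g x) ^ 2)"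
      by (intro continuous_on_mult continuous_on_power continuous_on_norm continuous_on_rabs g c\<phi>)
    show "\<bar>\<phi> x\<bar> ^ 2 * norm (?g x) ^ 2 = 0" if "x \<notin> K" for x using K(2)[OF that] by simp
  qed
  define c where "c = (LINT x|lborel. \<bar>\<phi> x\<bar> ^ 2)"
  have \<phi>c: "\<phi> \<in> \<sigma> c"
    by (rule mass_sphereI[OF test_function_measurable[OF \<phi>] test_function_has_weak_gradient[OF \<phi>]
          borel_measurable_continuous_onI[OF g] i1 c_def[symmetric] i2 i3])
  have "c \<noteq> 0"
  proof
    assume "c = 0"
    then have "AE x in lborel. \<bar>\<phi> x\<bar> ^ 2 = 0"
      unfolding c_def using integral_nonneg_eq_0_iff_AE[OF i1] by simp
    then have "AE x in lborel. x \<notin> box 0 (One :: real ^ 'n)"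
      by eventually_elim (simp add: \<phi>_def flip: bump_pos_iff)
    then have "emeasure lborel (box 0 (One :: real ^ 'n)) = 0"
      by (subst (asm) AE_iff_measurable[OF _ refl]) auto
    then show False by (simp add: emeasure_lborel_box_eq)
  qed
  moreover have "c \<ge> 0" unfolding c_def by (intro Bochner_Integration.integral_nonneg) simp
  ultimately have c: "c > 0" by simp
  have "1 / c > 0" using c by simp
  from kinetic_dilation(1)[OF \<phi>c this] show ?thesis using c by auto
qed

section \<open>Infima of affine functions\<close>

text \<open>A real infimum is meaningful only for families bounded below. At \<open>t > 0\<close>
  this follows from the assumption \<open>bound\<close> below with
  \<open>\<epsilon> = t\<close>.\<close>

definition affine_inf :: "('a \<Rightarrow> real) \<Rightarrow> ('a \<Rightarrow> real) \<Rightarrow> 'a set \<Rightarrow> real \<Rightarrow> real" where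
  "affine_inf A B S t = (INF u\<in>S. t * A u - B u)"

context
  fixes A B :: "'a \<Rightarrow> real" and S :: "'a set"
  assumes nonempty: "S \<noteq> {}"
    and bound: "\<And>\<epsilon>. \<epsilon> > 0 \<Longrightarrow> \<exists>C. \<forall>u\<in>S. B u \<le> \<epsilon> * A u + C"
begin

lemma affine_inf_lower: "t > 0 \<Longrightarrow> u \<in> S \<Longrightarrow> affine_inf A B S t \<le> t * A u - B u"
  unfolding affine_inf_def
proof (rule cINF_lower)
  assume "t > 0"
  then obtain C where "\<forall>u\<in>S. B u \<le> t * A u + C" using bound by blast
  then show "bdd_below ((\<lambda>u. t * A u - B u) ` S)"
    by (intro bdd_belowI[of _ "- C"]) force
qed

lemma affine_inf_greatest: "(\<And>u. u \<in> S \<Longrightarrow> x \<le> t * A u - B u) \<Longrightarrow> x \<le> affine_inf A B S t"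
  unfolding affine_inf_def using nonempty by (rule cINF_greatest)

lemma affine_inf_mono:
  assumes "0 < s" "s \<le> t" "\<And>u. u \<in> S \<Longrightarrow> A u \<ge> 0"
  shows "affine_inf A B S s \<le> affine_inf A B S t"
proof (rule affine_inf_greatest)
  fix u assume u: "u \<in> S"
  have "affine_inf A B S s \<le> s * A u - B u" using assms u by (intro affine_inf_lower)
  also have "\<dots> \<le> t * A u - B u" using assms(2) assms(3)[OF u] by (simp add: mult_right_mono)
  finally show "affine_inf A B S s \<le> t * A u - B u" .
qed

lemma continuous_on_affine_inf: "continuous_on {0<..} (affine_inf A B S)"
proof -
  have "convex_on {0<..} (\<lambda>t. - affine_inf A B S t)"
  proof (rule convex_onI)
    fix s x y :: real
    assume s: "0 < s" "s < 1" and xy: "x \<in> {0<..}" "y \<in> {0<..}"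
    have "(1 - s) * affine_inf A B S x + s * affine_inf A B S y \<le> affine_inf A B S ((1 - s) *\<^sub>R x + s *\<^sub>R y)"
    proof (rule affine_inf_greatest)
      fix u assume u: "u \<in> S"
      have "(1 - s) * affine_inf A B S x + s * affine_inf A B S y \<le> (1 - s) * (x * A u - B u) + s * (y * A u - B u)"
        using s xy u by (intro add_mono mult_left_mono affine_inf_lower) auto
      also have "\<dots> = ((1 - s) *\<^sub>R x + s *\<^sub>R y) * A u - B u" by (simp add: algebra_simps)
      finally show "(1 - s) * affine_inf A B S x + s * affine_inf A B S y \<le> ((1 - s) *\<^sub>R x + s *\<^sub>R y) * A u - B u" .
    qed
    then show "- affine_inf A B S ((1 - s) *\<^sub>R x + s *\<^sub>R y) \<le> (1 - s) * - affine_inf A B S x + s * - affine_inf A B S y"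
      by simp
  qed simp
  then have "continuous_on {0<..} (\<lambda>t. - affine_inf A B S t)"
    by (intro convex_on_continuous) auto
  from continuous_on_minus[OF this] show ?thesis by simp
qed

end

section \<open>The minimal energy\<close>

text \<open>The mass-changing dilation is invertible. The equality concerns images rather than
  infima, so that it also yields functions with a prescribed energy.\<close>

lemma energy_image_mass_sphere:
  fixes p c :: real
  defines "N \<equiv> real CARD('n::finite)"
  assumes c: "c > 0"
  shows "energy p ` (\<sigma> c :: (real ^ 'n \<Rightarrow> real) set)
    = (\<lambda>u. c * (c powr (- 2 / N) * kinetic u - potential p u)) ` (\<sigma> 1 :: (real ^ 'n \<Rightarrow> real) set)"
proof (intro equalityI subsetI)
  fix e assume "e \<in> energy p ` (\<sigma> c :: (real ^ 'n \<Rightarrow> real) set)"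
  then obtain u :: "real ^ 'n \<Rightarrow> real" where u: "u \<in> \<sigma> c" "e = energy p u" by blast
  define v where "v x = u ((1 / c) powr (- 1 / real CARD('n)) *\<^sub>R x)" for x
  have c': "1 / c > 0" using c by simp
  note * = kinetic_dilation[OF u(1) c', folded N_def, folded v_def[folded N_def, abs_def]]
  have "(1 / c) powr (- 2 / N) * c powr (- 2 / N) = 1"
    using c by (simp flip: powr_mult)
  then have "kinetic u = c * (c powr (- 2 / N) * kinetic v)"
    using c unfolding *(2) by (simp add: field_simps)
  moreover have "potential p u = c * potential p v" using c *(3)[of p] by simp
  ultimately have "e = c * (c powr (- 2 / N) * kinetic v - potential p v)"
    unfolding u(2) energy_eq by (simp add: right_diff_distrib)
  moreover have "v \<in> \<sigma> 1" using *(1) c by simp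
  ultimately show "e \<in> (\<lambda>u :: real ^ 'n \<Rightarrow> real. c * (c powr (- 2 / N) * kinetic u - potential p u)) ` \<sigma> 1"
    by (rule image_eqI)
next
  fix e assume "e \<in> (\<lambda>u :: real ^ 'n \<Rightarrow> real. c * (c powr (- 2 / N) * kinetic u - potential p u)) ` \<sigma> 1"
  then obtain u :: "real ^ 'n \<Rightarrow> real"
    where u: "u \<in> \<sigma> 1" "e = c * (c powr (- 2 / N) * kinetic u - potential p u)" by blast
  note * = kinetic_dilation[OF u(1) c, folded N_def]
  let ?v = "\<lambda>x. u (c powr (- 1 / N) *\<^sub>R x)"
  have "e = energy p ?v" unfolding energy_eq *(2,3) u(2) by (simp add: algebra_simps)
  moreover have "?v \<in> \<sigma> c" using *(1) by simp
  ultimately show "e \<in> energy p ` (\<sigma> c :: (real ^ 'n \<Rightarrow> real) set)" by (rule image_eqI)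
qed

lemma m_bar_nonpos:
  assumes c: "c > 0" and p: "p > 0"
  shows "m_bar TYPE('n::finite) p c \<le> 0"
proof (rule ereal_le_epsilon2)
  fix e :: real assume e: "e > 0"
  obtain w :: "real ^ 'n \<Rightarrow> real" where "w \<in> \<sigma> 1" using mass_sphere_1_nonempty by blast
  from kinetic_dilation(1)[OF this c] obtain u :: "real ^ 'n \<Rightarrow> real" where u: "u \<in> \<sigma> c" by auto
  have k: "kinetic u > 0" by (rule kinetic_pos[OF u c])
  \<comment> \<open>The root makes t^2 times the kinetic part at most \<open>e\<close>; the cap 1
    keeps the extra factor t^N of the quasilinear term at most 1.\<close>
  define t where "t = min 1 (sqrt (e / kinetic u))"
  have t: "0 < t" "t \<le> 1" using e k by (auto simp: t_def)
  have "t\<^sup>2 \<le> (sqrt (e / kinetic u))\<^sup>2" using t by (intro power_mono) (auto simp: t_def)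
  then have te: "t\<^sup>2 * kinetic u \<le> e" using e k by (simp add: field_simps)
  note * = mass_preserving_dilation[OF u t(1)]
  let ?v = "\<lambda>x. t powr (real CARD('n) / 2) * u (t *\<^sub>R x)"
  note nonneg = dirichlet_nonneg[of u]
  have "t ^ CARD('n) \<le> 1" using t by (simp add: power_le_one)
  then have "kinetic ?v \<le> t\<^sup>2 * (1 / 2 * (LINT x|lborel. norm (weak_gradient u x) ^ 2))
      + t\<^sup>2 * 1 * (LINT x|lborel. \<bar>u x\<bar> ^ 2 * norm (weak_gradient u x) ^ 2)"
    unfolding *(2) using nonneg by (intro add_left_mono mult_right_mono mult_left_mono) auto
  also have "\<dots> = t\<^sup>2 * kinetic u" by (simp add: kinetic_def algebra_simps)
  finally have "energy p ?v \<le> e" using te potential_nonneg[OF p, of ?v] unfolding energy_eq by linarith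
  moreover have "m_bar TYPE('n) p c \<le> ereal (energy p ?v)"
    unfolding m_bar_def by (rule INF_lower[OF *(1)])
  ultimately show "m_bar TYPE('n) p c \<le> 0 + ereal e"
    by (metis add_0 ereal_less_eq(3) order_trans)
qed

text \<open>Dilating \<open>\<sigma> 1\<close> onto \<open>\<sigma> c\<close> turns the minimal energy into \<open>c g(c\<^sup>-\<^sup>2\<^sup>/\<^sup>N)\<close> with \<open>g\<close> an infimum
  of affine functions.\<close>

definition reduced_energy :: "'n::finite itself \<Rightarrow> real \<Rightarrow> real \<Rightarrow> real" where
  "reduced_energy _ p = affine_inf kinetic (potential p) (\<sigma> 1 :: (real ^ 'n \<Rightarrow> real) set)"

definition scaled_mass :: "'n::finite itself \<Rightarrow> real \<Rightarrow> real" where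
  "scaled_mass _ c = c powr (- 2 / real CARD('n))"

lemma scaled_mass_pos: "c > 0 \<Longrightarrow> scaled_mass N c > 0"
  by (simp add: scaled_mass_def)

lemma scaled_mass_antimono: "0 < c \<Longrightarrow> c \<le> d \<Longrightarrow> scaled_mass N d \<le> scaled_mass N c"
  unfolding scaled_mass_def by (intro powr_mono2') auto

lemma scaled_mass_inverse:
  assumes "t > 0"
  obtains c where "c > 0" "scaled_mass TYPE('n::finite) c = t"
  using assms by (intro that[of "t powr (- real CARD('n) / 2)"]) (simp_all add: scaled_mass_def powr_powr)

lemma continuous_scaled_mass: "c > 0 \<Longrightarrow> isCont (scaled_mass N) c"
  unfolding scaled_mass_def[abs_def] by (intro continuous_intros) auto

lemma scaled_mass_large:
  assumes "K > 0"
  obtains c\<^sub>0 where "c\<^sub>0 > 0" "\<And>c. 0 < c \<Longrightarrow> c \<le> c\<^sub>0 \<Longrightarrow> K \<le> scaled_mass TYPE('n::finite) c"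
proof -
  obtain c\<^sub>0 where "c\<^sub>0 > 0" "scaled_mass TYPE('n) c\<^sub>0 = K" using scaled_mass_inverse[OF assms] .
  then show ?thesis using that scaled_mass_antimono[where N="TYPE('n)"] by metis
qed

section \<open>Exponents strictly below 3 + 4/N\<close>

context
  fixes p :: real
  assumes p: "1 + 4 / real CARD('n::finite) \<le> p" "p < 3 + 4 / real CARD('n)"
begin

lemma p_mem: "p \<in> {1 + 4 / real CARD('n) .. 3 + 4 / real CARD('n)}"
  using p by simp

lemma p_pos: "p > 0"
proof -
  have "4 / real CARD('n) > 0" by simp
  then show ?thesis using p by linarith
qed

lemma mass_sphere_1_neq_empty: "(\<sigma> 1 :: (real ^ 'n \<Rightarrow> real) set) \<noteq> {}"
  using mass_sphere_1_nonempty by blast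

lemma potential_bound:
  "\<epsilon> > 0 \<Longrightarrow> \<exists>C. \<forall>u\<in>(\<sigma> 1 :: (real ^ 'n \<Rightarrow> real) set). potential p u \<le> \<epsilon> * kinetic u + C"
  using potential_le_small_kinetic[OF p] by metis

lemma reduced_lower:
  fixes u :: "real ^ 'n \<Rightarrow> real"
  assumes "t > 0" "u \<in> \<sigma> 1"
  shows "reduced_energy TYPE('n) p t \<le> t * kinetic u - potential p u"
  unfolding reduced_energy_def
  by (rule affine_inf_lower[OF mass_sphere_1_neq_empty potential_bound assms])

lemma reduced_greatest:
  assumes "\<And>u :: real ^ 'n \<Rightarrow> real. u \<in> \<sigma> 1 \<Longrightarrow> x \<le> t * kinetic u - potential p u"
  shows "x \<le> reduced_energy TYPE('n) p t"
  unfolding reduced_energy_def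
  by (rule affine_inf_greatest[OF mass_sphere_1_neq_empty potential_bound assms])

lemma reduced_energy_mono:
  assumes "0 < s" "s \<le> t"
  shows "reduced_energy TYPE('n) p s \<le> reduced_energy TYPE('n) p t"
  unfolding reduced_energy_def
  by (rule affine_inf_mono[OF mass_sphere_1_neq_empty potential_bound assms])
    (auto intro: less_imp_le[OF kinetic_pos[OF _ zero_less_one]])

lemma continuous_on_reduced_energy: "continuous_on {0<..} (reduced_energy TYPE('n) p)"
  unfolding reduced_energy_def
  by (rule continuous_on_affine_inf[OF mass_sphere_1_neq_empty potential_bound])

lemma m_bar_eq:
  assumes c: "c > 0"
  shows "m_bar TYPE('n) p c = ereal (c * reduced_energy TYPE('n) p (scaled_mass TYPE('n) c))"
proof (rule antisym)
  let ?t = "scaled_mass TYPE('n) c"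
  have t: "?t > 0" by (rule scaled_mass_pos[OF c])
  have m: "m_bar TYPE('n) p c = (INF u\<in>(\<sigma> 1 :: (real ^ 'n \<Rightarrow> real) set). ereal (c * (?t * kinetic u - potential p u)))"
    using arg_cong[OF energy_image_mass_sphere[OF c, where 'n='n and p=p], of "\<lambda>X. Inf (ereal ` X)"]
    unfolding m_bar_def scaled_mass_def image_image .
  show "ereal (c * reduced_energy TYPE('n) p ?t) \<le> m_bar TYPE('n) p c"
    unfolding m
  proof (rule INF_greatest)
    fix u :: "real ^ 'n \<Rightarrow> real" assume u: "u \<in> \<sigma> 1"
    show "ereal (c * reduced_energy TYPE('n) p ?t) \<le> ereal (c * (?t * kinetic u - potential p u))"
      using c reduced_lower[OF t u] by (simp add: mult_left_mono)
  qed
  \<comment> \<open>Only a real value needs an argument: plus infinity is excluded here, and minus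
    infinity satisfies the inequality trivially.\<close>
  have "m_bar TYPE('n) p c \<noteq> \<infinity>" using m_bar_nonpos[OF c p_pos, where 'n='n] by auto
  show "m_bar TYPE('n) p c \<le> ereal (c * reduced_energy TYPE('n) p ?t)"
  proof (cases "m_bar TYPE('n) p c")
    case (real r)
    have "r / c \<le> reduced_energy TYPE('n) p ?t"
    proof (rule reduced_greatest)
      fix u :: "real ^ 'n \<Rightarrow> real" assume u: "u \<in> \<sigma> 1"
      have "m_bar TYPE('n) p c \<le> ereal (c * (?t * kinetic u - potential p u))"
        unfolding m by (rule INF_lower[OF u])
      then show "r / c \<le> ?t * kinetic u - potential p u"
        using real c by (simp add: field_simps)
    qed
    then show ?thesis using real c by (simp add: field_simps)
  qed (use \<open>m_bar TYPE('n) p c \<noteq> \<infinity>\<close> in auto)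
qed

lemma m_bar_neg_iff: "c > 0 \<Longrightarrow> m_bar TYPE('n) p c < 0 \<longleftrightarrow> reduced_energy TYPE('n) p (scaled_mass TYPE('n) c) < 0"
  by (simp add: m_bar_eq mult_less_0_iff)

text \<open>The factor g(c^(-2/N)) is merely nonincreasing in the mass. Strictness comes from
  multiplying a negative number by a strictly larger mass.\<close>

lemma m_bar_strict_decrease:
  assumes c: "0 < c" "c < d" and neg: "m_bar TYPE('n) p c < 0"
  shows "m_bar TYPE('n) p d < m_bar TYPE('n) p c"
proof -
  let ?g = "\<lambda>c. reduced_energy TYPE('n) p (scaled_mass TYPE('n) c)"
  have neg': "?g c < 0" using neg m_bar_neg_iff[OF c(1)] by simp
  have "?g d \<le> ?g c"
    using c by (intro reduced_energy_mono scaled_mass_pos scaled_mass_antimono) auto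
  then have "d * ?g d \<le> d * ?g c" using c by (intro mult_left_mono) auto
  also have "\<dots> < c * ?g c" using c neg' by (intro mult_strict_right_mono_neg)
  finally show ?thesis using c by (simp add: m_bar_eq)
qed

lemma m_bar_isCont:
  assumes c: "c > 0"
  shows "isCont (m_bar TYPE('n) p) c"
proof -
  let ?h = "\<lambda>c. c * reduced_energy TYPE('n) p (scaled_mass TYPE('n) c)"
  have "isCont (reduced_energy TYPE('n) p) (scaled_mass TYPE('n) c)"
    using continuous_on_reduced_energy scaled_mass_pos[OF c, of "TYPE('n)"]
    by (simp add: continuous_on_eq_continuous_at)
  then have "isCont (\<lambda>c. reduced_energy TYPE('n) p (scaled_mass TYPE('n) c)) c"
    by (rule isCont_o2[OF continuous_scaled_mass[OF c]])
  then have "isCont ?h c" by (intro continuous_intros)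
  then have "((\<lambda>d. ereal (?h d)) \<longlongrightarrow> ereal (?h c)) (at c)"
    by (auto simp: isCont_def)
  moreover have "eventually (\<lambda>d. ereal (?h d) = m_bar TYPE('n) p d) (at c)"
    using eventually_at_in_open'[of "{0<..}" c] c by (auto elim!: eventually_mono simp: m_bar_eq)
  ultimately show ?thesis
    unfolding isCont_def m_bar_eq[OF c] by (rule Lim_transform_eventually)
qed

text \<open>The masses with negative infimum are bounded away from 0 by the Gagliardo-Nirenberg
  bound, occur because the potential is positive, and form an upward closed set by strict decrease.
  Continuity decides the boundary case.\<close>

lemma critical_mass_eq:
  obtains s where "s > 0" "critical_mass TYPE('n) p = ereal s"
    "\<And>c. 0 < c \<Longrightarrow> m_bar TYPE('n) p c < 0 \<longleftrightarrow> s < c"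
proof -
  let ?S = "{c. c > 0 \<and> m_bar TYPE('n) p c < 0}"
  obtain K where K: "K > 0"
    "\<And>c (u :: real ^ 'n \<Rightarrow> real). c > 0 \<Longrightarrow> u \<in> \<sigma> c \<Longrightarrow> potential p u \<le> K * c powr (2 / real CARD('n)) * kinetic u"
    using potential_le_kinetic[OF p_mem] by blast
  obtain c\<^sub>0 where c0: "c\<^sub>0 > 0" "\<And>c. 0 < c \<Longrightarrow> c \<le> c\<^sub>0 \<Longrightarrow> K \<le> scaled_mass TYPE('n) c"
    using scaled_mass_large[OF K(1), where 'n='n] by blast
  have low: "c\<^sub>0 \<le> c" if "c \<in> ?S" for c
  proof (rule ccontr)
    assume "\<not> c\<^sub>0 \<le> c"
    with that c0(2) have "K \<le> scaled_mass TYPE('n) c" by auto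
    have "0 \<le> reduced_energy TYPE('n) p (scaled_mass TYPE('n) c)"
    proof (rule reduced_greatest)
      fix u :: "real ^ 'n \<Rightarrow> real" assume u: "u \<in> \<sigma> 1"
      have "potential p u \<le> K * kinetic u" using K(2)[OF zero_less_one u] by simp
      also have "\<dots> \<le> scaled_mass TYPE('n) c * kinetic u"
        using \<open>K \<le> scaled_mass TYPE('n) c\<close> kinetic_pos[OF u] by (intro mult_right_mono) auto
      finally show "0 \<le> scaled_mass TYPE('n) c * kinetic u - potential p u" by simp
    qed
    then show False using that m_bar_neg_iff by force
  qed
  have ne: "?S \<noteq> {}"
  proof -
    obtain u :: "real ^ 'n \<Rightarrow> real" where u: "u \<in> \<sigma> 1" using mass_sphere_1_nonempty by blast
    have k: "kinetic u > 0" and b: "potential p u > 0"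
      using kinetic_pos[OF u] potential_pos[OF u _ p_mem] by auto
    \<comment> \<open>Half of the zero of \<open>t * kinetic u - potential p u\<close>, so that the
      value there is negative.\<close>
    define t where "t = potential p u / (2 * kinetic u)"
    have t: "t > 0" using k b by (simp add: t_def)
    obtain c where c: "c > 0" "scaled_mass TYPE('n) c = t"
      using scaled_mass_inverse[OF t, where 'n='n] by blast
    have "reduced_energy TYPE('n) p t \<le> t * kinetic u - potential p u" by (rule reduced_lower[OF t u])
    also have "\<dots> = - potential p u / 2" using k by (simp add: t_def)
    also have "\<dots> < 0" using b by simp
    finally show ?thesis using c m_bar_neg_iff[OF c(1)] by auto
  qed
  define s where "s = Inf ?S"
  have bdd: "bdd_below ?S" using low by (intro bdd_belowI)
  have s0: "s > 0" using cInf_greatest[OF ne low] c0(1) unfolding s_def by auto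
  have crit: "critical_mass TYPE('n) p = ereal s"
    unfolding critical_mass_def s_def using ereal_Inf'[OF bdd ne] by simp
  have above: "m_bar TYPE('n) p c < 0" if sc: "s < c" for c
  proof -
    obtain d where "d \<in> ?S" "d < c" using sc cInf_lessD[OF ne] unfolding s_def by blast
    then show ?thesis using m_bar_strict_decrease[of d c] by auto
  qed
  \<comment> \<open>A negative value at \<open>s\<close> would persist slightly to the left of
    \<open>s\<close> by continuity, against the choice of \<open>s\<close> as a lower bound.\<close>
  have "\<not> m_bar TYPE('n) p s < 0"
  proof
    assume "m_bar TYPE('n) p s < 0"
    then have "eventually (\<lambda>c. m_bar TYPE('n) p c < 0) (at s)"
      using order_tendstoD(2)[OF m_bar_isCont[OF s0, unfolded isCont_def]] by blast
    then have "eventually (\<lambda>c. m_bar TYPE('n) p c < 0) (at_left s)"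
      by (simp add: eventually_at_split)
    moreover have "eventually (\<lambda>c. c \<in> {0<..<s}) (at_left s)"
      using s0 by (rule eventually_at_left_real)
    ultimately have "eventually (\<lambda>c. m_bar TYPE('n) p c < 0 \<and> c \<in> {0<..<s}) (at_left s)"
      by (rule eventually_conj)
    then obtain c where "m_bar TYPE('n) p c < 0" "c \<in> {0<..<s}"
      using eventually_happens[of _ "at_left s"] trivial_limit_at_left_real by blast
    then show False using cInf_lower[OF _ bdd, of c] unfolding s_def by auto
  qed
  moreover have "s \<le> c" if "0 < c" "m_bar TYPE('n) p c < 0" for c
    unfolding s_def using that by (intro cInf_lower bdd) auto
  ultimately have "m_bar TYPE('n) p c < 0 \<longleftrightarrow> s < c" if "0 < c" for c
    using above[of c] that by (metis order_le_less)
  with s0 crit show ?thesis by (rule that)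
qed

end

text \<open>The argument stays with single functions, since the control of the reduced energy is
  established only for p < 3 + 4/N.\<close>

lemma nonpos_energy_mass_bounds:
  fixes p :: real
  assumes p: "p \<in> {1 + 4 / real CARD('n::finite) .. 3 + 4 / real CARD('n)}"
  shows "nonpos_energy_mass TYPE('n) p \<in> {0<..<\<infinity>}"
proof -
  let ?N = "TYPE('n)"
  let ?S = "{c. c > 0 \<and> (\<exists>u \<in> (\<sigma> c :: (real ^ 'n \<Rightarrow> real) set). energy p u \<le> 0)}"
  obtain K where K: "K > 0"
    "\<And>c (u :: real ^ 'n \<Rightarrow> real). c > 0 \<Longrightarrow> u \<in> \<sigma> c \<Longrightarrow> potential p u \<le> K * c powr (2 / real CARD('n)) * kinetic u"
    using potential_le_kinetic[OF p] by blast
  \<comment> \<open>The factor 2 leaves room: below \<open>c\<^sub>0\<close> the potential part is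
    at most half the kinetic part, so the energy is strictly positive.\<close>
  obtain c\<^sub>0 where c0: "c\<^sub>0 > 0" "\<And>c. 0 < c \<Longrightarrow> c \<le> c\<^sub>0 \<Longrightarrow> 2 * K \<le> scaled_mass ?N c"
    using scaled_mass_large[of "2 * K", where 'n='n] K(1) by auto
  have low: "c\<^sub>0 \<le> c" if cS: "c \<in> ?S" for c
  proof (rule ccontr)
    assume "\<not> c\<^sub>0 \<le> c"
    with cS c0(2) have K2: "2 * K \<le> scaled_mass ?N c" by auto
    obtain u :: "real ^ 'n \<Rightarrow> real" where u: "u \<in> \<sigma> c" "energy p u \<le> 0" and c: "c > 0" using cS by blast
    have k: "kinetic u > 0" by (rule kinetic_pos[OF u(1) c])
    have "2 * K * c powr (2 / real CARD('n)) \<le> scaled_mass ?N c * c powr (2 / real CARD('n))"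
      using K2 by (intro mult_right_mono) auto
    also have "\<dots> = 1" using c by (simp add: scaled_mass_def flip: powr_add)
    finally have "K * c powr (2 / real CARD('n)) * kinetic u \<le> 1 / 2 * kinetic u"
      using k by (intro mult_right_mono) auto
    with K(2)[OF c u(1)] u(2) k show False unfolding energy_eq by linarith
  qed
  have "\<exists>c. c \<in> ?S"
  proof -
    obtain u :: "real ^ 'n \<Rightarrow> real" where u: "u \<in> \<sigma> 1" using mass_sphere_1_nonempty by blast
    have k: "kinetic u > 0" and b: "potential p u > 0"
      using kinetic_pos[OF u] potential_pos[OF u _ p] by auto
    \<comment> \<open>The mass at which the dilate of \<open>u\<close> has energy exactly 0.\<close>
    obtain c where c: "c > 0" "scaled_mass ?N c = potential p u / kinetic u"
      using scaled_mass_inverse[of "potential p u / kinetic u"] k b by auto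
    have "c * (c powr (- 2 / real CARD('n)) * kinetic u - potential p u) \<in> energy p ` (\<sigma> c :: (real ^ 'n \<Rightarrow> real) set)"
      unfolding energy_image_mass_sphere[OF c(1)] using u by (rule imageI)
    moreover have "c * (c powr (- 2 / real CARD('n)) * kinetic u - potential p u) = 0"
      using c(2) k unfolding scaled_mass_def by simp
    ultimately obtain v :: "real ^ 'n \<Rightarrow> real" where "v \<in> \<sigma> c" "energy p v = 0" by auto
    then have "\<exists>v \<in> (\<sigma> c :: (real ^ 'n \<Rightarrow> real) set). energy p v \<le> 0" by (metis order_refl)
    with c(1) show ?thesis by blast
  qed
  then obtain c where c: "c \<in> ?S" by blast
  have "nonpos_energy_mass ?N p \<le> ereal c"
    unfolding nonpos_energy_mass_def by (rule INF_lower[OF c])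
  moreover have "ereal c\<^sub>0 \<le> nonpos_energy_mass ?N p"
    unfolding nonpos_energy_mass_def by (rule INF_greatest) (use low in auto)
  ultimately show ?thesis
    using c0(1) by (cases "nonpos_energy_mass ?N p") auto
qed

lemma m_bar_eq_0_below:
  assumes p: "p > 0" and c: "0 < c" "ereal c < nonpos_energy_mass TYPE('n::finite) p"
  shows "m_bar TYPE('n) p c = 0"
proof (rule antisym)
  show "m_bar TYPE('n) p c \<le> 0" by (rule m_bar_nonpos[OF c(1) p])
  show "0 \<le> m_bar TYPE('n) p c"
    unfolding m_bar_def
  proof (rule INF_greatest)
    fix u :: "real ^ 'n \<Rightarrow> real" assume u: "u \<in> \<sigma> c"
    show "0 \<le> ereal (energy p u)"
    proof (rule ccontr)
      assume "\<not> 0 \<le> ereal (energy p u)"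
      then have "energy p u \<le> 0" by simp
      then have "c \<in> {c. c > 0 \<and> (\<exists>u \<in> (\<sigma> c :: (real ^ 'n \<Rightarrow> real) set). energy p u \<le> 0)}"
        using u c(1) by blast
      from INF_lower[OF this, of ereal] c(2) show False
        unfolding nonpos_energy_mass_def by simp
    qed
  qed
qed

text \<open>Some mass \<open>d < c\<close> carries a function of nonpositive energy. Dilating it to
  mass \<open>c\<close> gives negative energy, which concentration at fixed mass then drives to
  minus infinity.\<close>

lemma m_bar_eq_minus_infinity:
  fixes p :: real
  defines "N \<equiv> real CARD('n::finite)"
  assumes p: "p = 3 + 4 / N" and c: "nonpos_energy_mass TYPE('n) p < ereal c"
  shows "m_bar TYPE('n) p c = -\<infinity>"
proof -
  have N: "N > 0" by (simp add: N_def)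
  obtain d and w :: "real ^ 'n \<Rightarrow> real" where d: "0 < d" "d < c" and w: "w \<in> \<sigma> d" "energy p w \<le> 0"
    using c unfolding nonpos_energy_mass_def INF_less_iff by auto
  define s where "s = c / d"
  have s: "s > 1" using d by (simp add: s_def)
  define u where "u x = w (s powr (- 1 / N) *\<^sub>R x)" for x
  have s0: "s > 0" using s by simp
  note dil = kinetic_dilation[OF w(1) s0, folded N_def, folded u_def[abs_def]]
  have u: "u \<in> \<sigma> c" using dil(1) d by (simp add: s_def)
  \<comment> \<open>For \<open>s > 1\<close> the kinetic part loses weight against the potential,
    and it is positive, so nonpositive energy becomes negative.\<close>
  have "s powr (- 2 / N) < s powr 0" using s N by (intro powr_less_mono) auto
  then have "s powr (- 2 / N) * kinetic w < kinetic w"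
    using kinetic_pos[OF w(1) d(1)] s0 by simp
  then have "s powr (- 2 / N) * kinetic w - potential p w < 0" using w(2) unfolding energy_eq by linarith
  then have neg: "energy p u < 0"
    unfolding energy_eq dil(2,3) using s0 by (simp add: mult_pos_neg mult.assoc flip: right_diff_distrib)
  have "m_bar TYPE('n) p c \<le> ereal r" for r
  proof -
    \<comment> \<open>The energy is negative, so \<open>n\<close> times it is at most
      \<open>r\<close>.\<close>
    obtain n :: nat where n: "r / energy p u \<le> real n" using real_arch_simple by blast
    define t where "t = real n + 1"
    have t: "t \<ge> 1" "t > 0" by (simp_all add: t_def)
    note * = mass_preserving_dilation[OF u t(2), folded N_def]
    let ?v = "\<lambda>x. t powr (N / 2) * u (t *\<^sub>R x)"
    let ?G = "1 / 2 * (LINT x|lborel. norm (weak_gradient u x) ^ 2)"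
    let ?Q = "LINT x|lborel. \<bar>u x\<bar> ^ 2 * norm (weak_gradient u x) ^ 2"
    \<comment> \<open>The endpoint exponent enters here: potential and quasilinear term scale alike
      and can be combined.\<close>
    have "N * (p - 1) / 2 = real (2 + CARD('n))" using N by (simp add: p N_def field_simps)
    then have pt: "t powr (N * (p - 1) / 2) = t\<^sup>2 * t ^ CARD('n)"
      using t(2) by (simp only: powr_realpow power_add)
    have G0: "?G \<ge> 0" using dirichlet_nonneg[of u] by simp
    \<comment> \<open>Since this combination is nonpositive, lowering its factor t^N to 1 can only
      raise the energy.\<close>
    have neg': "?Q - potential p u \<le> 0" using neg G0 unfolding energy_eq kinetic_def by linarith
    have "energy p ?v = t\<^sup>2 * ?G + t\<^sup>2 * t ^ CARD('n) * (?Q - potential p u)"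
      unfolding energy_eq *(2,3) pt by (simp add: algebra_simps)
    also have "\<dots> \<le> t\<^sup>2 * ?G + t\<^sup>2 * 1 * (?Q - potential p u)"
      using t neg' by (intro add_left_mono mult_right_mono_neg mult_left_mono one_le_power) auto
    also have "\<dots> = t\<^sup>2 * energy p u" by (simp add: energy_eq kinetic_def algebra_simps)
    also have "\<dots> \<le> t * energy p u"
      using t neg by (intro mult_right_mono_neg) (auto simp: power2_eq_square)
    also have "\<dots> \<le> r / energy p u * energy p u"
      using n neg by (intro mult_right_mono_neg) (auto simp: t_def)
    also have "\<dots> = r" using neg by simp
    finally have "energy p ?v \<le> r" .
    moreover have "m_bar TYPE('n) p c \<le> ereal (energy p ?v)"
      unfolding m_bar_def by (rule INF_lower[OF *(1)])
    ultimately show ?thesis by (meson ereal_less_eq(3) order_trans)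
  qed
  then show ?thesis by (rule ereal_bot)
qed

theorem theorem1p4:
  fixes p N :: real
  defines "N \<equiv> real CARD('n::finite)"
  defines "m \<equiv> m_bar TYPE('n) p"
  defines "c_pN \<equiv> critical_mass TYPE('n) p"
  defines "c_N \<equiv> nonpos_energy_mass TYPE('n) p"
  assumes "p \<in> {1 + 4 / N .. 3 + 4 / N}"
  shows
    "(p < 3 + 4 / N \<longrightarrow>
        c_pN \<in> {0<..<\<infinity>} \<and>
        (\<forall>c. 0 < c \<and> ereal c \<le> c_pN \<longrightarrow> m c = 0) \<and>
        (\<forall>c. c_pN < ereal c \<longrightarrow> m c < 0) \<and>
        strict_antimono_on {c. c_pN < ereal c} m)
     \<and> (p < 3 + 4 / N \<longrightarrow> (\<forall>c>0. isCont m c))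
     \<and> (p = 3 + 4 / N \<longrightarrow>
        c_N \<in> {0<..<\<infinity>} \<and>
        (\<forall>c. 0 < c \<and> ereal c < c_N \<longrightarrow> m c = 0) \<and>
        (\<forall>c. c_N < ereal c \<longrightarrow> m c = -\<infinity>))"
proof (intro conjI impI)
  have p0: "p > 0"
  proof -
    have "4 / N > 0" by (simp add: N_def)
    then show ?thesis using assms(5) by (simp only: atLeastAtMost_iff) linarith
  qed
  {
    assume p: "p < 3 + 4 / N"
    have p': "1 + 4 / real CARD('n) \<le> p" "p < 3 + 4 / real CARD('n)"
      using p assms(5) by (auto simp: N_def)
    obtain s where s: "s > 0" "c_pN = ereal s" "\<And>c. 0 < c \<Longrightarrow> m c < 0 \<longleftrightarrow> s < c"
      unfolding m_def c_pN_def using critical_mass_eq[OF p'] by blast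
    show "c_pN \<in> {0<..<\<infinity>}" using s by simp
    show "\<forall>c. 0 < c \<and> ereal c \<le> c_pN \<longrightarrow> m c = 0"
      using s m_bar_nonpos[OF _ p0, where 'n='n, folded m_def] by (metis ereal_less_eq(3) not_le order_le_less)
    show "\<forall>c. c_pN < ereal c \<longrightarrow> m c < 0" using s by force
    show "strict_antimono_on {c. c_pN < ereal c} m"
    proof (rule monotone_onI)
      fix c d assume "c \<in> {c. c_pN < ereal c}" "d \<in> {c. c_pN < ereal c}" "c < d"
      then have "0 < c" "s < c" "c < d" using s by auto
      then show "m c > m d"
        using m_bar_strict_decrease[OF p', of c d] s(3)[of c] unfolding m_def by blast
    qed
    show "\<forall>c>0. isCont m c"
      unfolding m_def using m_bar_isCont[OF p'] by blast
  }
  assume p: "p = 3 + 4 / N"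
  show "c_N \<in> {0<..<\<infinity>}"
    unfolding c_N_def by (rule nonpos_energy_mass_bounds) (use assms(5) in \<open>simp add: N_def\<close>)
  show "\<forall>c. 0 < c \<and> ereal c < c_N \<longrightarrow> m c = 0"
    unfolding m_def c_N_def using m_bar_eq_0_below[OF p0] by blast
  show "\<forall>c. c_N < ereal c \<longrightarrow> m c = -\<infinity>"
    unfolding m_def c_N_def using m_bar_eq_minus_infinity[OF p[unfolded N_def]] by blast
qed

end
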